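(* Let $n\ge 2$, let $d\ge 2$ be an even integer, and let $f$ be a form of degree $d$ in $n$ variables such that $y^TH_f(x)y>0$ for all $(x,y)\in S^{n-1}\times S^{n-1}$. Define $$\eta(f)=\frac{\min\{y^TH_f(x)y : (x,y)\in S^{n-1}\times S^{n-1}\}}{\max\{y^TH_f(x)y : (x,y)\in S^{n-1}\times S^{n-1}\}}.$$ If $r$ is a nonnegative integer with $r\ge \frac{n(d-2)(d-3)}{4\log(2)\,\eta(f)}-\frac{n+d-2}{2}-d$ (natural logarithm), then $f$ is $r$-sos-convex.
   Context: $S^{n-1}$ is the unit sphere in $\mathbb{R}^n$ and $H_f(x)$ is the Hessian matrix of $f$ at $x$. A polynomial is a sum of squares (sos) if it equals $\sum_i q_i^2$ for some polynomials $q_i$. For a nonnegative integer $r$, a polynomial $f$ in $x=(x_1,\dots,x_n)$ is called $r$-sos-convex if the polynomial $y^TH_f(x)y\cdot\left(\sum_{i=1}^n x_i^2\right)^r$ in the variables $(x,y)\in\mathbb{R}^{2n}$ is a sum of squares. *)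

theory Defs
  imports "HOL-Analysis.Analysis"
begin

text \<open>Real polynomials in m variables, represented as polynomial functions on
  vectors x :: nat \<Rightarrow> real (only the coordinates x 0, ..., x (m-1) are used).
  Over the reals a polynomial is determined by its polynomial function.\<close>

definition mono_eval :: "nat \<Rightarrow> (nat \<Rightarrow> nat) \<Rightarrow> (nat \<Rightarrow> real) \<Rightarrow> real" where
  "mono_eval m \<alpha> x = (\<Prod>i<m. x i ^ \<alpha> i)"

definition is_poly :: "nat \<Rightarrow> ((nat \<Rightarrow> real) \<Rightarrow> real) \<Rightarrow> bool" where
  "is_poly m p \<longleftrightarrow> (\<exists>A c. finite A \<and> (\<forall>\<alpha>\<in>A. \<forall>i. m \<le> i \<longrightarrow> \<alpha> i = 0) \<and>
      (\<forall>x. p x = (\<Sum>\<alpha>\<in>A. c \<alpha> * mono_eval m \<alpha> x)))"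

definition is_form :: "nat \<Rightarrow> nat \<Rightarrow> ((nat \<Rightarrow> real) \<Rightarrow> real) \<Rightarrow> bool" where
  "is_form n d p \<longleftrightarrow> (\<exists>A c. finite A \<and> (\<forall>\<alpha>\<in>A. (\<forall>i. n \<le> i \<longrightarrow> \<alpha> i = 0) \<and> (\<Sum>i<n. \<alpha> i) = d) \<and>
      (\<forall>x. p x = (\<Sum>\<alpha>\<in>A. c \<alpha> * mono_eval n \<alpha> x)))"

definition is_sos :: "nat \<Rightarrow> ((nat \<Rightarrow> real) \<Rightarrow> real) \<Rightarrow> bool" where
  "is_sos m p \<longleftrightarrow> (\<exists>qs. (\<forall>q\<in>set qs. is_poly m q) \<and> (\<forall>x. p x = (\<Sum>q\<leftarrow>qs. (q x)^2)))"

definition partial :: "nat \<Rightarrow> ((nat \<Rightarrow> real) \<Rightarrow> real) \<Rightarrow> (nat \<Rightarrow> real) \<Rightarrow> real" where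
  "partial i f x = deriv (\<lambda>t. f (x(i := t))) (x i)"

definition hess_quad :: "nat \<Rightarrow> ((nat \<Rightarrow> real) \<Rightarrow> real) \<Rightarrow> (nat \<Rightarrow> real) \<Rightarrow> (nat \<Rightarrow> real) \<Rightarrow> real" where
  "hess_quad n f x y = (\<Sum>i<n. \<Sum>j<n. y i * y j * partial i (partial j f) x)"

definition sphere_n :: "nat \<Rightarrow> (nat \<Rightarrow> real) set" where
  "sphere_n n = {x. (\<forall>i. n \<le> i \<longrightarrow> x i = 0) \<and> (\<Sum>i<n. (x i)^2) = 1}"

definition hess_values :: "nat \<Rightarrow> ((nat \<Rightarrow> real) \<Rightarrow> real) \<Rightarrow> real set" where
  "hess_values n f = {hess_quad n f x y | x y. x \<in> sphere_n n \<and> y \<in> sphere_n n}"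

definition eta :: "nat \<Rightarrow> ((nat \<Rightarrow> real) \<Rightarrow> real) \<Rightarrow> real" where
  "eta n f = Inf (hess_values n f) / Sup (hess_values n f)"

definition r_sos_convex :: "nat \<Rightarrow> nat \<Rightarrow> ((nat \<Rightarrow> real) \<Rightarrow> real) \<Rightarrow> bool" where
  "r_sos_convex n r f \<longleftrightarrow> is_sos (2 * n)
     (\<lambda>z. hess_quad n f (\<lambda>i. if i < n then z i else 0) (\<lambda>i. if i < n then z (n + i) else 0)
          * (\<Sum>i<n. (z i)^2) ^ r)"

end

theory Submission
  imports Defs "HOL-Probability.Probability" "HOL-Computational_Algebra.Polynomial"
begin

text \<open>The proof is Reznick's argument with \<open>y\<close> as a parameter. If \<open>g\<close> is a standard Gaussian
  vector, then for a form \<open>q\<close> of degree \<open>m\<close> the average of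
  \<open>\<kappa>(q)(g) (x \<cdot> g)\<^sup>m\<^sup>+\<^sup>2\<^sup>r\<close> is a positive multiple of \<open>\<bar>x\<bar>\<^sup>2\<^sup>r q(x)\<close>, where \<open>\<kappa>(q)\<close> is an explicit alternating combination of the
  \<open>\<bar>u\<bar>\<^sup>2\<^sup>j \<Delta>\<^sup>j q\<close>. Applied to the Hessian form, nonnegativity of \<open>\<kappa>\<close> makes the Gram matrix of
  the averaged product positive semidefinite, so the product is a sum of squares. A sharp bound for
  second derivatives of forms on the sphere bounds \<open>\<Delta>\<^sup>j q\<close> and hence \<open>\<kappa>\<close> from below.

  The term \<open>- d\<close> makes the hypothesis weaker than the one this argument uses. For \<open>d \<ge> 6\<close> the
  difference is absorbed by \<open>\<eta>(f) \<le> 1 / (d - 1)\<close>. For \<open>d = 4\<close> one uses in addition that the Hessian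
  form at orthonormal pairs is at most \<open>(M - \<mu>) / 2\<close>, with \<open>M\<close> and \<open>\<mu>\<close> its extreme values; this leaves
  the binary quartics, and the ternary ones with \<open>r = 0\<close>, which are shown to be sos-convex directly.\<close>

section \<open>Polynomial functions and their derivatives\<close>

text \<open>The average is Gaussian because moments then factor over the coordinates, and
  integration by parts turns every average into an algebraic identity that is provable by induction
  on the degree. The factors |u|^(2j) make the kernel homogeneous, so that its sign is decided on
  the sphere. They are paid for by the products in the denominators of \<open>kappa\<close>; as
  these grow with r, a large r lets the leading term q dominate. Put m = d - 2, D = r + (n + m)/2
  and t = n m (m - 1) / (4 D). If the values of q on the sphere lie in [mu, M] with mu > 0, the
  terms after the first add up to at most M (exp t - 1) there, so the kernel is nonnegative once exp
  t <= 1 + mu/M. The constant ln 2 comes from ln (1 + eta) >= eta ln 2 on [0,1]: without - d the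
  hypothesis would say t <= eta ln 2. This concavity estimate is wasteful for small eta, which is
  the room that absorbs - d. The absorption also uses d <= n m (m - 1) / 4. For d = 4 the right side
  is n/2, which is smaller than d when n < 8; hence the separate treatment of quartics with a
  sharper bound on the Laplacian.\<close>

definition mono_span :: "nat \<Rightarrow> (nat \<Rightarrow> nat) set \<Rightarrow> ((nat \<Rightarrow> real) \<Rightarrow> real) \<Rightarrow> bool" where
  "mono_span n S p \<longleftrightarrow> (\<exists>A c. finite A \<and> A \<subseteq> S \<and> (\<forall>x. p x = (\<Sum>\<alpha>\<in>A. c \<alpha> * mono_eval n \<alpha> x)))"

text \<open>Polynomials and forms are two instances of one span, so closure under sums, multiples
  and coordinate factors is proved once for both.\<close>

lemma is_poly_mono_span: "is_poly n p \<longleftrightarrow> mono_span n {\<alpha>. \<forall>i\<ge>n. \<alpha> i = 0} p"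
  unfolding is_poly_def mono_span_def by (simp add: subset_eq)

lemma is_form_mono_span:
  "is_form n d p \<longleftrightarrow> mono_span n {\<alpha>. (\<forall>i\<ge>n. \<alpha> i = 0) \<and> (\<Sum>i<n. \<alpha> i) = d} p"
  unfolding is_form_def mono_span_def by (simp add: subset_eq)

lemma mono_span_zero: "mono_span n S (\<lambda>x. 0)"
  unfolding mono_span_def by (rule exI[of _ "{}"]) simp

lemma mono_span_mono: "\<alpha> \<in> S \<Longrightarrow> mono_span n S (\<lambda>x. c * mono_eval n \<alpha> x)"
  unfolding mono_span_def by (rule exI[of _ "{\<alpha>}"], rule exI[of _ "\<lambda>_. c"]) simp

lemma mono_span_add:
  assumes "mono_span n S p" "mono_span n S q"
  shows "mono_span n S (\<lambda>x. p x + q x)"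
proof -
  obtain A c where A: "finite A" "A \<subseteq> S" "\<And>x. p x = (\<Sum>\<alpha>\<in>A. c \<alpha> * mono_eval n \<alpha> x)"
    using assms(1) unfolding mono_span_def by auto
  obtain B e where B: "finite B" "B \<subseteq> S" "\<And>x. q x = (\<Sum>\<alpha>\<in>B. e \<alpha> * mono_eval n \<alpha> x)"
    using assms(2) unfolding mono_span_def by auto
  have "p x + q x = (\<Sum>\<alpha>\<in>A\<union>B. ((if \<alpha> \<in> A then c \<alpha> else 0) + (if \<alpha> \<in> B then e \<alpha> else 0)) * mono_eval n \<alpha> x)" for x
  proof -
    have "(\<Sum>\<alpha>\<in>A\<union>B. (if \<alpha> \<in> A then c \<alpha> else 0) * mono_eval n \<alpha> x) = p x"
      unfolding A(3) using A(1) B(1) by (intro sum.mono_neutral_cong_right) auto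
    moreover have "(\<Sum>\<alpha>\<in>A\<union>B. (if \<alpha> \<in> B then e \<alpha> else 0) * mono_eval n \<alpha> x) = q x"
      unfolding B(3) using A(1) B(1) by (intro sum.mono_neutral_cong_right) auto
    ultimately show ?thesis by (simp add: distrib_right sum.distrib)
  qed
  then show ?thesis
    using A(1,2) B(1,2) unfolding mono_span_def
    by (intro exI[of _ "A \<union> B"] exI[of _ "\<lambda>\<alpha>. (if \<alpha> \<in> A then c \<alpha> else 0) + (if \<alpha> \<in> B then e \<alpha> else 0)"]) auto
qed

lemma mono_span_cmult:
  assumes "mono_span n S p"
  shows "mono_span n S (\<lambda>x. k * p x)"
proof -
  obtain A c where A: "finite A" "A \<subseteq> S" "\<And>x. p x = (\<Sum>\<alpha>\<in>A. c \<alpha> * mono_eval n \<alpha> x)"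
    using assms(1) unfolding mono_span_def by auto
  show ?thesis
    using A unfolding mono_span_def
    by (intro exI[of _ A] exI[of _ "\<lambda>\<alpha>. k * c \<alpha>"]) (auto simp: sum_distrib_left mult.assoc)
qed

lemma mono_span_sum:
  assumes "\<And>i. i \<in> I \<Longrightarrow> mono_span n S (p i)"
  shows "mono_span n S (\<lambda>x. \<Sum>i\<in>I. p i x)"
proof (cases "finite I")
  case True
  then show ?thesis using assms
    by (induction I rule: finite_induct) (auto intro: mono_span_zero mono_span_add)
qed (auto intro: mono_span_zero)

lemma mono_eval_shift:
  assumes "i < n"
  shows "mono_eval n (\<alpha>(i := Suc (\<alpha> i))) x = x i * mono_eval n \<alpha> x"
proof -
  have "mono_eval n (\<alpha>(i := Suc (\<alpha> i))) x
      = x i ^ Suc (\<alpha> i) * (\<Prod>j\<in>{..<n}-{i}. x j ^ (\<alpha>(i := Suc (\<alpha> i))) j)"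
    unfolding mono_eval_def using assms by (subst prod.remove[of _ i]) auto
  also have "(\<Prod>j\<in>{..<n}-{i}. x j ^ (\<alpha>(i := Suc (\<alpha> i))) j) = (\<Prod>j\<in>{..<n}-{i}. x j ^ \<alpha> j)"
    by (intro prod.cong) auto
  also have "x i ^ Suc (\<alpha> i) * \<dots> = x i * mono_eval n \<alpha> x"
    unfolding mono_eval_def using assms by (subst (2) prod.remove[of _ i]) auto
  finally show ?thesis .
qed

lemma mono_span_coord_mult:
  assumes "mono_span n S p" "i < n" "\<And>\<alpha>. \<alpha> \<in> S \<Longrightarrow> \<alpha>(i := Suc (\<alpha> i)) \<in> T"
  shows "mono_span n T (\<lambda>x. x i * p x)"
proof -
  obtain A c where A: "finite A" "A \<subseteq> S" "\<And>x. p x = (\<Sum>\<alpha>\<in>A. c \<alpha> * mono_eval n \<alpha> x)"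
    using assms(1) unfolding mono_span_def by auto
  have "x i * p x = (\<Sum>\<alpha>\<in>A. c \<alpha> * mono_eval n (\<alpha>(i := Suc (\<alpha> i))) x)" for x
    using assms(2) by (simp add: A(3) mono_eval_shift sum_distrib_left mult_ac)
  moreover have "mono_span n T (\<lambda>x. \<Sum>\<alpha>\<in>A. c \<alpha> * mono_eval n (\<alpha>(i := Suc (\<alpha> i))) x)"
    using assms(3) A(2) by (intro mono_span_sum mono_span_mono) auto
  ultimately show ?thesis by simp
qed

lemma sum_fun_upd_Suc:
  fixes \<alpha> :: "nat \<Rightarrow> nat"
  assumes "i < n"
  shows "(\<Sum>j<n. (\<alpha>(i := Suc (\<alpha> i))) j) = Suc (\<Sum>j<n. \<alpha> j)"
proof -
  have "(\<Sum>j<n. (\<alpha>(i := Suc (\<alpha> i))) j) = Suc (\<alpha> i) + (\<Sum>j\<in>{..<n}-{i}. (\<alpha>(i := Suc (\<alpha> i))) j)"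
    using assms by (subst sum.remove[of _ i]) auto
  also have "(\<Sum>j\<in>{..<n}-{i}. (\<alpha>(i := Suc (\<alpha> i))) j) = (\<Sum>j\<in>{..<n}-{i}. \<alpha> j)"
    by (intro sum.cong) auto
  also have "Suc (\<alpha> i) + \<dots> = Suc (\<Sum>j<n. \<alpha> j)"
    using assms by (subst (2) sum.remove[of _ i]) auto
  finally show ?thesis .
qed

section \<open>Closure properties and induction principles for forms and polynomials\<close>

lemma is_form_zero: "is_form n d (\<lambda>x. 0)"
  unfolding is_form_mono_span by (rule mono_span_zero)

lemma is_form_add: "is_form n d p \<Longrightarrow> is_form n d q \<Longrightarrow> is_form n d (\<lambda>x. p x + q x)"
  unfolding is_form_mono_span by (rule mono_span_add)

lemma is_form_cmult: "is_form n d p \<Longrightarrow> is_form n d (\<lambda>x. c * p x)"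
  unfolding is_form_mono_span by (rule mono_span_cmult)

lemma is_form_sum: "(\<And>i. i \<in> I \<Longrightarrow> is_form n d (p i)) \<Longrightarrow> is_form n d (\<lambda>x. \<Sum>i\<in>I. p i x)"
  unfolding is_form_mono_span by (rule mono_span_sum)

lemma is_form_const: "is_form n 0 (\<lambda>x. c)"
  using mono_span_mono[of "\<lambda>_. 0" "{\<alpha>. (\<forall>i\<ge>n. \<alpha> i = 0) \<and> (\<Sum>i<n. \<alpha> i) = 0}" n c]
  unfolding is_form_mono_span by (simp add: mono_eval_def)

lemma is_form_coord_mult:
  assumes "is_form n d p" "i < n"
  shows "is_form n (Suc d) (\<lambda>x. x i * p x)"
  unfolding is_form_mono_span
  by (rule mono_span_coord_mult[OF assms(1)[unfolded is_form_mono_span] assms(2)])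
     (use assms(2) in \<open>simp add: sum_fun_upd_Suc del: fun_upd_apply; simp\<close>)

lemma is_poly_add: "is_poly n p \<Longrightarrow> is_poly n q \<Longrightarrow> is_poly n (\<lambda>x. p x + q x)"
  unfolding is_poly_mono_span by (rule mono_span_add)

lemma is_poly_cmult: "is_poly n p \<Longrightarrow> is_poly n (\<lambda>x. c * p x)"
  unfolding is_poly_mono_span by (rule mono_span_cmult)

lemma is_poly_sum: "(\<And>i. i \<in> I \<Longrightarrow> is_poly n (p i)) \<Longrightarrow> is_poly n (\<lambda>x. \<Sum>i\<in>I. p i x)"
  unfolding is_poly_mono_span by (rule mono_span_sum)

lemma is_form_is_poly: "is_form n d p \<Longrightarrow> is_poly n p"
  unfolding is_form_def is_poly_def by blast

lemma is_poly_const: "is_poly n (\<lambda>x. c)"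
  by (rule is_form_is_poly[OF is_form_const])

lemma is_poly_coord_mult:
  assumes "is_poly n p" "i < n"
  shows "is_poly n (\<lambda>x. x i * p x)"
  unfolding is_poly_mono_span
  by (rule mono_span_coord_mult[OF assms(1)[unfolded is_poly_mono_span] assms(2)])
     (use assms(2) in simp)

lemma is_poly_coord: "i < n \<Longrightarrow> is_poly n (\<lambda>x. x i)"
  using is_poly_coord_mult[OF is_poly_const[of n 1]] by simp

text \<open>A monomial arises from its coefficient by multiplying with one coordinate at a time.
  Carrying \<open>is_form\<close> along lets the step case assume it of the smaller
  monomial.\<close>

lemma mono_eval_induct [consumes 1, case_names const coord]:
  assumes "(\<Sum>i<n. \<alpha> i) = d"
    and "\<And>c. P 0 (\<lambda>x. c)"
    and "\<And>d p i. is_form n d p \<Longrightarrow> P d p \<Longrightarrow> i < n \<Longrightarrow> P (Suc d) (\<lambda>x. x i * p x)"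
  shows "is_form n d (\<lambda>x. c * mono_eval n \<alpha> x) \<and> P d (\<lambda>x. c * mono_eval n \<alpha> x)"
  using assms(1)
proof (induction d arbitrary: \<alpha>)
  case 0
  then have "mono_eval n \<alpha> x = 1" for x by (simp add: mono_eval_def)
  then show ?case using assms(2)[of c] is_form_const[of n c] by simp
next
  case (Suc d)
  then obtain i where i: "i < n" "\<alpha> i \<noteq> 0"
    by (metis lessThan_iff nat.simps(3) sum.neutral)
  define \<beta> where "\<beta> = \<alpha>(i := \<alpha> i - 1)"
  have \<alpha>: "\<alpha> = \<beta>(i := Suc (\<beta> i))" using i by (auto simp: \<beta>_def)
  have "(\<Sum>i<n. \<beta> i) = d" using Suc.prems sum_fun_upd_Suc[OF i(1), of \<beta>] \<alpha> by simp
  note IH = Suc.IH[OF this]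
  have eq: "(\<lambda>x. c * mono_eval n \<alpha> x) = (\<lambda>x. x i * (c * mono_eval n \<beta> x))"
    by (subst \<alpha>) (simp add: mono_eval_shift[OF i(1)] mult_ac del: fun_upd_apply)
  show ?case unfolding eq using IH assms(3) i(1) is_form_coord_mult by blast
qed

text \<open>The zero case ranges over every degree: the empty sum is a form of each degree, while
  constants only provide degree 0.\<close>

lemma is_form_induct [consumes 1, case_names zero const add coord]:
  assumes "is_form n d p"
    and "\<And>d. P d (\<lambda>x. 0)"
    and "\<And>c. P 0 (\<lambda>x. c)"
    and "\<And>d p q. is_form n d p \<Longrightarrow> is_form n d q \<Longrightarrow> P d p \<Longrightarrow> P d q \<Longrightarrow> P d (\<lambda>x. p x + q x)"
    and "\<And>d p i. is_form n d p \<Longrightarrow> P d p \<Longrightarrow> i < n \<Longrightarrow> P (Suc d) (\<lambda>x. x i * p x)"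
  shows "P d p"
proof -
  obtain A c where A: "finite A" "\<forall>\<alpha>\<in>A. (\<Sum>i<n. \<alpha> i) = d"
    and p: "\<And>x. p x = (\<Sum>\<alpha>\<in>A. c \<alpha> * mono_eval n \<alpha> x)"
    using assms(1) unfolding is_form_def by auto
  have "is_form n d (\<lambda>x. \<Sum>\<alpha>\<in>A. c \<alpha> * mono_eval n \<alpha> x) \<and> P d (\<lambda>x. \<Sum>\<alpha>\<in>A. c \<alpha> * mono_eval n \<alpha> x)"
    using A
  proof (induction A rule: finite_induct)
    case empty
    then show ?case using assms(2) by (simp add: is_form_zero)
  next
    case (insert \<alpha> A)
    have "is_form n d (\<lambda>x. c \<alpha> * mono_eval n \<alpha> x) \<and> P d (\<lambda>x. c \<alpha> * mono_eval n \<alpha> x)"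
      using insert.prems by (intro mono_eval_induct assms(3,5)) auto
    then show ?case using insert assms(4) is_form_add by simp
  qed
  moreover have "p = (\<lambda>x. \<Sum>\<alpha>\<in>A. c \<alpha> * mono_eval n \<alpha> x)" using p by (rule ext)
  ultimately show ?thesis by simp
qed

lemma is_poly_induct [consumes 1, case_names const add coord]:
  assumes "is_poly n p"
    and "\<And>c. P (\<lambda>x. c)"
    and "\<And>p q. is_poly n p \<Longrightarrow> is_poly n q \<Longrightarrow> P p \<Longrightarrow> P q \<Longrightarrow> P (\<lambda>x. p x + q x)"
    and "\<And>p i. is_poly n p \<Longrightarrow> P p \<Longrightarrow> i < n \<Longrightarrow> P (\<lambda>x. x i * p x)"
  shows "P p"
proof -
  obtain A c where A: "finite A"
    and p: "\<And>x. p x = (\<Sum>\<alpha>\<in>A. c \<alpha> * mono_eval n \<alpha> x)"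
    using assms(1) unfolding is_poly_def by auto
  have "is_poly n (\<lambda>x. \<Sum>\<alpha>\<in>A. c \<alpha> * mono_eval n \<alpha> x) \<and> P (\<lambda>x. \<Sum>\<alpha>\<in>A. c \<alpha> * mono_eval n \<alpha> x)"
    using A
  proof (induction A rule: finite_induct)
    case empty
    then show ?case using assms(2) by (simp add: is_poly_const)
  next
    case (insert \<alpha> A)
    have "is_form n (\<Sum>i<n. \<alpha> i) (\<lambda>x. c \<alpha> * mono_eval n \<alpha> x) \<and> P (\<lambda>x. c \<alpha> * mono_eval n \<alpha> x)"
    proof (rule mono_eval_induct[where P = "\<lambda>_. P"])
      fix d p i
      assume "is_form n d p" "P p" "i < n"
      then show "P (\<lambda>x. x i * p x)" by (intro assms(4) is_form_is_poly)
    qed (simp_all add: assms(2))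
    moreover have "is_poly n (\<lambda>x. \<Sum>\<alpha>\<in>A. c \<alpha> * mono_eval n \<alpha> x)" "P (\<lambda>x. \<Sum>\<alpha>\<in>A. c \<alpha> * mono_eval n \<alpha> x)"
      using insert by auto
    ultimately show ?case
      using insert(1,2) is_form_is_poly[of n "\<Sum>i<n. \<alpha> i" "\<lambda>x. c \<alpha> * mono_eval n \<alpha> x"]
        assms(3)[of "\<lambda>x. c \<alpha> * mono_eval n \<alpha> x" "\<lambda>x. \<Sum>\<alpha>\<in>A. c \<alpha> * mono_eval n \<alpha> x"]
        is_poly_add[of n "\<lambda>x. c \<alpha> * mono_eval n \<alpha> x" "\<lambda>x. \<Sum>\<alpha>\<in>A. c \<alpha> * mono_eval n \<alpha> x"]
      by simp
  qed
  moreover have "p = (\<lambda>x. \<Sum>\<alpha>\<in>A. c \<alpha> * mono_eval n \<alpha> x)" using p by (rule ext)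
  ultimately show ?thesis by simp
qed

lemma is_poly_mult:
  assumes "is_poly n p" "is_poly n q"
  shows "is_poly n (\<lambda>x. p x * q x)"
  using assms(1)
proof (induction rule: is_poly_induct)
  case (const c)
  then show ?case using is_poly_cmult[OF assms(2)] .
next
  case (add p1 p2)
  then show ?case using is_poly_add by (simp add: distrib_right)
next
  case (coord p i)
  then show ?case using is_poly_coord_mult[of n "\<lambda>x. p x * q x" i] by (simp add: mult.assoc)
qed

lemma is_poly_power: "is_poly n p \<Longrightarrow> is_poly n (\<lambda>x. p x ^ k)"
  by (induction k) (auto intro: is_poly_const is_poly_mult)

lemma is_poly_prod:
  assumes "\<And>i. i \<in> I \<Longrightarrow> is_poly n (p i)"
  shows "is_poly n (\<lambda>x. \<Prod>i\<in>I. p i x)"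
proof (cases "finite I")
  case True
  then show ?thesis using assms
    by (induction I rule: finite_induct) (auto intro: is_poly_const is_poly_mult)
qed (auto intro: is_poly_const)

lemma is_poly_diff: "is_poly n p \<Longrightarrow> is_poly n q \<Longrightarrow> is_poly n (\<lambda>x. p x - q x)"
  using is_poly_add[OF _ is_poly_cmult[of n q "-1"]] by simp

lemmas is_poly_intros = is_poly_add is_poly_cmult is_poly_sum is_poly_const is_poly_coord
  is_poly_mult is_poly_power is_poly_prod is_poly_diff

lemma is_poly_cong_coords:
  assumes "is_poly n p" "\<And>i. i < n \<Longrightarrow> x i = y i"
  shows "p x = p y"
  using assms(1) by (induction rule: is_poly_induct) (auto simp: assms(2))

lemma is_form_homogeneous:
  assumes "is_form n d p"
  shows "p (\<lambda>i. c * x i) = c ^ d * p x"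
  using assms by (induction rule: is_form_induct) (auto simp: algebra_simps)

lemma continuous_on_is_poly: "is_poly n p \<Longrightarrow> continuous_on S p"
  by (induction rule: is_poly_induct)
     (auto intro!: continuous_intros continuous_on_subset[OF continuous_on_product_coordinates])

section \<open>Partial derivatives of polynomial functions\<close>

lemma is_poly_differentiable:
  "is_poly n p \<Longrightarrow> (\<lambda>t. p (x(i := t))) differentiable at t"
proof (induction rule: is_poly_induct)
  case (coord p j)
  have "(\<lambda>t. (x(i := t)) j) differentiable at t"
    by (cases "i = j") auto
  then show ?case using coord by (intro differentiable_mult)
qed (auto intro: differentiable_add)

text \<open>\<open>deriv\<close> is a choice operator, so \<open>partial\<close> means a derivative
  only where one exists; this is why the rules for sums and products carry \<open>is_poly\<close>
  premises.\<close>

lemma has_derivative_partial: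
  assumes "is_poly n p"
  shows "((\<lambda>t. p (x(i := t))) has_real_derivative partial i p x) (at (x i))"
  using is_poly_differentiable[OF assms] unfolding partial_def
  by (simp add: DERIV_deriv_iff_real_differentiable)

lemma partial_eqI:
  assumes "((\<lambda>t. p (x(i := t))) has_real_derivative D) (at (x i))"
  shows "partial i p x = D"
  unfolding partial_def using assms by (rule DERIV_imp_deriv)

lemma partial_const [simp]: "partial i (\<lambda>x. c) = (\<lambda>x. 0)"
  by (rule ext, rule partial_eqI) simp

lemma partial_coord: "partial i (\<lambda>x. x j) = (\<lambda>x. if i = j then 1 else 0)"
  by (rule ext, rule partial_eqI) auto

lemma partial_add:
  assumes "is_poly n p" "is_poly n q"
  shows "partial i (\<lambda>x. p x + q x) = (\<lambda>x. partial i p x + partial i q x)"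
  by (rule ext, rule partial_eqI) (intro DERIV_add has_derivative_partial[OF assms(1)] has_derivative_partial[OF assms(2)])

lemma partial_mult:
  assumes "is_poly n p" "is_poly n q"
  shows "partial i (\<lambda>x. p x * q x) = (\<lambda>x. partial i p x * q x + p x * partial i q x)"
proof (rule ext, rule partial_eqI)
  fix x
  show "((\<lambda>t. p (x(i := t)) * q (x(i := t))) has_real_derivative
      partial i p x * q x + p x * partial i q x) (at (x i))"
    using DERIV_mult[OF has_derivative_partial[OF assms(1), of x i] has_derivative_partial[OF assms(2), of x i]]
    by (simp add: algebra_simps)
qed

lemma partial_cmult:
  assumes "is_poly n p"
  shows "partial i (\<lambda>x. c * p x) = (\<lambda>x. c * partial i p x)"
  using partial_mult[OF is_poly_const assms] by simp

lemma partial_coord_mult: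
  assumes "is_poly n p" "j < n"
  shows "partial i (\<lambda>x. x j * p x) = (\<lambda>x. (if i = j then p x else 0) + x j * partial i p x)"
  using partial_mult[OF is_poly_coord[OF assms(2)] assms(1)] by (auto simp: partial_coord fun_eq_iff)

lemma partial_sum:
  assumes "finite I" "\<And>k. k \<in> I \<Longrightarrow> is_poly n (p k)"
  shows "partial i (\<lambda>x. \<Sum>k\<in>I. p k x) = (\<lambda>x. \<Sum>k\<in>I. partial i (p k) x)"
  using assms
proof (induction I rule: finite_induct)
  case (insert a F)
  then show ?case
    using partial_add[of n "p a" "\<lambda>x. \<Sum>k\<in>F. p k x" i] by (simp add: is_poly_sum)
qed simp

lemma is_form_0_partial:
  assumes "is_form n 0 p" shows "partial i p = (\<lambda>x. 0)"
  using assms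
proof (induction "0::nat" p rule: is_form_induct)
  case (add p q)
  then show ?case using partial_add[OF is_form_is_poly is_form_is_poly] by simp
qed auto

lemma is_form_partial: "is_form n d p \<Longrightarrow> is_form n (d - 1) (partial i p)"
proof (induction rule: is_form_induct)
  case (zero d)
  then show ?case by (simp add: is_form_zero)
next
  case (const c)
  then show ?case by (simp add: is_form_zero)
next
  case (add d p q)
  then show ?case by (simp add: is_form_add partial_add[OF is_form_is_poly is_form_is_poly])
next
  case (coord d p j)
  have "is_form n d (\<lambda>x. x j * partial i p x)"
  proof (cases d)
    \<comment> \<open>Truncated subtraction gives the derivative degree \<open>0 - 1 = 0\<close>, so
      the factor \<open>x j\<close> would raise it to 1; what saves the claim is that the derivative
      vanishes.\<close>
    case 0
    then have "partial i p = (\<lambda>x. 0)" using coord(1) is_form_0_partial by simp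
    then show ?thesis by (simp add: is_form_zero)
  next
    case (Suc e)
    then show ?thesis using is_form_coord_mult coord by fastforce
  qed
  moreover have "is_form n d (\<lambda>x. if i = j then p x else 0)"
    using coord(1) by (cases "i = j") (auto simp: is_form_zero)
  ultimately show ?case
    using coord by (simp add: is_form_add partial_coord_mult[OF is_form_is_poly])
qed

lemma is_poly_partial: "is_poly n p \<Longrightarrow> is_poly n (partial i p)"
proof (induction rule: is_poly_induct)
  case (coord p j)
  then show ?case
    by (cases "i = j") (auto simp: partial_coord_mult[of n] intro!: is_poly_intros)
qed (auto simp: partial_add[of n] intro: is_poly_intros)

text \<open>Schwarz's theorem by algebra: the second derivative of \<open>x k * p x\<close> expands
  to an expression that is symmetric in \<open>i\<close> and \<open>j\<close> by the induction
  hypothesis.\<close>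

lemma partial_commute:
  assumes "is_poly n p"
  shows "partial i (partial j p) = partial j (partial i p)"
  using assms
proof (induction rule: is_poly_induct)
  case (add p q)
  then show ?case by (simp add: partial_add[of n] is_poly_partial)
next
  case (coord p k)
  have *: "partial i (partial j (\<lambda>x. x k * p x)) =
     (\<lambda>x. (if j = k then partial i p x else 0) + ((if i = k then partial j p x else 0) + x k * partial i (partial j p) x))" for i j
  proof (cases "j = k")
    case True
    then have "partial j (\<lambda>x. x k * p x) = (\<lambda>x. p x + x k * partial j p x)"
      using coord.hyps by (simp add: partial_coord_mult[of n])
    then show ?thesis
      using coord.hyps unfolding True
      by (simp add: partial_add[of n] partial_coord_mult[of n] is_poly_partial is_poly_coord_mult)
  next
    case False
    then have "partial j (\<lambda>x. x k * p x) = (\<lambda>x. x k * partial j p x)"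
      using coord.hyps by (simp add: partial_coord_mult[of n])
    then show ?thesis
      using coord.hyps False by (simp add: partial_coord_mult[of n] is_poly_partial)
  qed
  show ?case
    unfolding * using coord.IH by (auto simp: fun_eq_iff)
qed simp

section \<open>Derivatives along lines\<close>

lemma has_derivative_line:
  assumes "is_poly n p"
  shows "((\<lambda>t. p (\<lambda>i. x i + t * v i)) has_real_derivative
      (\<Sum>i<n. v i * partial i p (\<lambda>i. x i + t * v i))) (at t)"
  using assms
proof (induction rule: is_poly_induct)
  case (const c)
  then show ?case by simp
next
  case (add p q)
  then show ?case using DERIV_add[OF add.IH] add.hyps by (simp add: partial_add[of n] distrib_left sum.distrib)
next
  case (coord p j)
  let ?z = "\<lambda>i. x i + t * v i"
  have "((\<lambda>t. x j + t * v j) has_real_derivative v j) (at t)"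
    by (auto intro!: derivative_eq_intros)
  from DERIV_mult[OF this coord.IH]
  have "((\<lambda>t. (x j + t * v j) * p (\<lambda>i. x i + t * v i)) has_real_derivative
     v j * p ?z + (\<Sum>i<n. v i * partial i p ?z) * ?z j) (at t)" by simp
  moreover have "(\<Sum>i<n. v i * partial i (\<lambda>x. x j * p x) ?z)
      = v j * p ?z + (\<Sum>i<n. v i * partial i p ?z) * ?z j"
  proof -
    have "(\<Sum>i<n. v i * partial i (\<lambda>x. x j * p x) ?z)
        = (\<Sum>i<n. (if i = j then v i * p ?z else 0) + v i * partial i p ?z * ?z j)"
      using coord by (intro sum.cong) (auto simp: partial_coord_mult[of n] algebra_simps)
    also have "\<dots> = v j * p ?z + (\<Sum>i<n. v i * partial i p ?z) * ?z j"
      using coord.hyps by (simp add: sum.distrib sum_distrib_right)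
    finally show ?thesis .
  qed
  ultimately show ?case by simp
qed

lemma has_derivative_line2:
  assumes "is_poly n p"
  shows "((\<lambda>t. \<Sum>i<n. v i * partial i p (\<lambda>i. x i + t * v i)) has_real_derivative
      hess_quad n p (\<lambda>i. x i + t * v i) v) (at t)"
proof -
  have "((\<lambda>t. \<Sum>i<n. v i * partial i p (\<lambda>i. x i + t * v i)) has_real_derivative
     (\<Sum>i<n. v i * (\<Sum>j<n. v j * partial j (partial i p) (\<lambda>i. x i + t * v i)))) (at t)"
    by (intro DERIV_sum DERIV_cmult has_derivative_line is_poly_partial assms)
  moreover have "(\<Sum>i<n. v i * (\<Sum>j<n. v j * partial j (partial i p) (\<lambda>i. x i + t * v i)))
     = hess_quad n p (\<lambda>i. x i + t * v i) v"
    unfolding hess_quad_def by (simp add: sum_distrib_left mult.assoc partial_commute[OF assms])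
  ultimately show ?thesis by simp
qed

text \<open>Second-order Taylor term along a line. Later values of the Hessian form are obtained
  this way, as a coefficient of a univariate polynomial.\<close>

lemma hess_quad_eq_coeff:
  assumes "is_poly n p" and "\<And>t. p (\<lambda>i. x i + t * v i) = poly q t"
  shows "hess_quad n p x v = 2 * coeff q 2"
proof -
  have d: "(poly q has_real_derivative (\<Sum>i<n. v i * partial i p (\<lambda>i. x i + t * v i))) (at t)" for t
    using has_derivative_line[OF assms(1), of x v t] by (simp add: assms(2))
  have 1: "(\<Sum>i<n. v i * partial i p (\<lambda>i. x i + t * v i)) = poly (pderiv q) t" for t
    by (rule DERIV_unique[OF d poly_DERIV])
  have "(poly (pderiv q) has_real_derivative hess_quad n p (\<lambda>i. x i + 0 * v i) v) (at 0)"
    using has_derivative_line2[OF assms(1), of v x 0] unfolding 1 .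
  from DERIV_unique[OF this poly_DERIV]
  have "hess_quad n p x v = poly (pderiv (pderiv q)) 0" by simp
  also have "\<dots> = coeff (pderiv (pderiv q)) 0" by (simp add: poly_0_coeff_0)
  also have "\<dots> = 2 * coeff q 2" by (simp add: coeff_pderiv numeral_2_eq_2)
  finally show ?thesis .
qed

section \<open>The Laplacian and its powers\<close>

definition lap :: "nat \<Rightarrow> ((nat \<Rightarrow> real) \<Rightarrow> real) \<Rightarrow> (nat \<Rightarrow> real) \<Rightarrow> real" where
  "lap n p x = (\<Sum>i<n. partial i (partial i p) x)"

lemma is_poly_lap: "is_poly n p \<Longrightarrow> is_poly n (lap n p)"
  unfolding lap_def[abs_def] by (intro is_poly_intros is_poly_partial)

lemma is_form_lap: "is_form n d p \<Longrightarrow> is_form n (d - 2) (lap n p)"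
  unfolding lap_def[abs_def] using is_form_partial[OF is_form_partial]
  by (intro is_form_sum) (simp add: numeral_2_eq_2)

lemma lap_lowdeg:
  assumes "is_form n d p" "d < 2" shows "lap n p = (\<lambda>x. 0)"
proof -
  have "is_form n 0 (partial i p)" for i using is_form_partial[OF assms(1), of i] assms(2) by (simp add: less_2_cases_iff split: if_splits)
  then have "partial i (partial i p) = (\<lambda>x. 0)" for i by (rule is_form_0_partial)
  then show ?thesis unfolding lap_def[abs_def] by simp
qed

lemma is_poly_lap_pow: "is_poly n p \<Longrightarrow> is_poly n ((lap n ^^ j) p)"
  by (induction j) (auto intro: is_poly_lap)

lemma is_form_lap_pow: "is_form n d p \<Longrightarrow> is_form n (d - 2 * j) ((lap n ^^ j) p)"
proof (induction j)
  case (Suc j)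
  then show ?case using is_form_lap[OF Suc.IH] by (simp add: diff_diff_left add.commute)
qed simp

lemma lap_zero: "lap n (\<lambda>x. 0) = (\<lambda>x. 0)"
  by (simp add: lap_def[abs_def])

lemma lap_pow_zero: "(lap n ^^ j) (\<lambda>x. 0) = (\<lambda>x. 0)"
  by (induction j) (simp_all add: lap_zero)

lemma lap_pow_eq_0:
  assumes "is_form n d p" "d < 2 * j" shows "(lap n ^^ j) p = (\<lambda>x. 0)"
proof -
  obtain i where j: "j = Suc i" using assms(2) by (cases j) auto
  have "d - 2 * i < 2" using assms(2) j by linarith
  then show ?thesis unfolding j using lap_lowdeg[OF is_form_lap_pow[OF assms(1)]] by simp
qed

lemma lap_add:
  assumes "is_poly n p" "is_poly n q"
  shows "lap n (\<lambda>x. p x + q x) = (\<lambda>x. lap n p x + lap n q x)"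
  using assms by (simp add: lap_def[abs_def] partial_add[of n] is_poly_partial sum.distrib)

lemma lap_cmult:
  assumes "is_poly n p"
  shows "lap n (\<lambda>x. c * p x) = (\<lambda>x. c * lap n p x)"
  using assms by (simp add: lap_def[abs_def] partial_cmult[of n] is_poly_partial sum_distrib_left)

lemma lap_pow_add:
  assumes "is_poly n p" "is_poly n q"
  shows "(lap n ^^ j) (\<lambda>x. p x + q x) = (\<lambda>x. (lap n ^^ j) p x + (lap n ^^ j) q x)"
  using assms by (induction j) (simp_all add: lap_add[of n] is_poly_lap_pow)

lemma lap_pow_cmult:
  assumes "is_poly n p"
  shows "(lap n ^^ j) (\<lambda>x. c * p x) = (\<lambda>x. c * (lap n ^^ j) p x)"
  using assms by (induction j) (simp_all add: lap_cmult[of n] is_poly_lap_pow)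

lemma lap_pow_sum:
  assumes "finite I" "\<And>k. k \<in> I \<Longrightarrow> is_poly n (p k)"
  shows "(lap n ^^ j) (\<lambda>x. \<Sum>k\<in>I. p k x) = (\<lambda>x. \<Sum>k\<in>I. (lap n ^^ j) (p k) x)"
  using assms
proof (induction I rule: finite_induct)
  case empty
  then show ?case by (simp add: lap_pow_zero)
next
  case (insert a F)
  then show ?case
    using lap_pow_add[of n "p a" "\<lambda>x. \<Sum>k\<in>F. p k x" j] by (simp add: is_poly_sum)
qed

lemma lap_coord_mult:
  assumes "is_poly n p" "i < n"
  shows "lap n (\<lambda>x. x i * p x) = (\<lambda>x. x i * lap n p x + 2 * partial i p x)"
proof
  fix x
  have 2: "partial j (partial j (\<lambda>x. x i * p x)) x
      = (if j = i then 2 * partial j p x else 0) + x i * partial j (partial j p) x" for j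
  proof -
    have "partial j (\<lambda>x. x i * p x) = (\<lambda>x. (if j = i then 1 else 0) * p x + x i * partial j p x)"
      using assms by (simp add: partial_coord_mult[of n] fun_eq_iff)
    then have "partial j (partial j (\<lambda>x. x i * p x)) x
      = (if j = i then 1 else 0) * partial j p x + ((if j = i then partial j p x else 0) + x i * partial j (partial j p) x)"
      using assms by (simp only:) (subst partial_add[of n], auto intro!: is_poly_intros simp: is_poly_partial partial_coord_mult[of n] partial_cmult[of n])
    then show ?thesis by simp
  qed
  show "lap n (\<lambda>x. x i * p x) x = x i * lap n p x + 2 * partial i p x"
    using assms(2) by (simp add: lap_def 2 sum.distrib sum_distrib_left)
qed

lemma partial_lap:
  assumes "is_poly n p"
  shows "partial i (lap n p) = lap n (partial i p)"
proof -
  have "partial i (\<lambda>x. \<Sum>k<n. partial k (partial k p) x) = (\<lambda>x. \<Sum>k<n. partial i (partial k (partial k p)) x)"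
    by (rule partial_sum[where n = n]) (auto intro: is_poly_partial assms)
  also have "\<dots> = (\<lambda>x. \<Sum>k<n. partial k (partial k (partial i p)) x)"
    using partial_commute[OF assms, of i] partial_commute[OF is_poly_partial[OF assms], of i] by simp
  finally show ?thesis by (simp add: lap_def[abs_def])
qed

text \<open>The commutator of the \<open>j\<close>-th power of the Laplacian with multiplication by
  \<open>x i\<close>; each Laplacian contributes \<open>2 * partial i\<close>, and derivatives
  commute with the rest. At \<open>j = 0\<close> the factor \<open>real j\<close> cancels the term
  with the truncated \<open>j - 1\<close>.\<close>

lemma lap_pow_coord_mult:
  assumes "is_poly n p" "i < n"
  shows "(lap n ^^ j) (\<lambda>x. x i * p x) = (\<lambda>x. x i * (lap n ^^ j) p x + 2 * real j * partial i ((lap n ^^ (j - 1)) p) x)"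
proof (induction j)
  case (Suc j)
  note P = is_poly_lap_pow[OF assms(1)]
  have "(lap n ^^ Suc j) (\<lambda>x. x i * p x)
    = lap n (\<lambda>x. x i * (lap n ^^ j) p x + 2 * real j * partial i ((lap n ^^ (j - 1)) p) x)"
    using Suc by simp
  also have "\<dots> = (\<lambda>x. (x i * lap n ((lap n ^^ j) p) x + 2 * partial i ((lap n ^^ j) p) x)
     + 2 * real j * lap n (partial i ((lap n ^^ (j - 1)) p)) x)"
    using assms P by (subst lap_add) (auto intro!: is_poly_intros is_poly_partial simp: lap_coord_mult lap_cmult[of n] is_poly_partial)
  also have "\<dots> = (\<lambda>x. x i * (lap n ^^ Suc j) p x + 2 * real (Suc j) * partial i ((lap n ^^ (Suc j - 1)) p) x)"
  proof (cases j)
    case 0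
    then show ?thesis by simp
  next
    case (Suc k)
    have "lap n (partial i ((lap n ^^ k) p)) = partial i (lap n ((lap n ^^ k) p))"
      using partial_lap[OF P] by simp
    then show ?thesis using Suc by (simp add: fun_eq_iff algebra_simps)
  qed
  finally show ?case .
qed simp

lemma euler_homogeneous:
  assumes "is_form n d p"
  shows "(\<Sum>i<n. x i * partial i p x) = real d * p x"
  using assms
proof (induction arbitrary: x rule: is_form_induct)
  case (add d p q)
  then show ?case by (simp add: partial_add[OF is_form_is_poly is_form_is_poly] distrib_left sum.distrib)
next
  case (coord d p j)
  have "(\<Sum>i<n. x i * partial i (\<lambda>x. x j * p x) x)
     = (\<Sum>i<n. (if i = j then x i * p x else 0) + x j * (x i * partial i p x))"
    using coord by (intro sum.cong) (auto simp: partial_coord_mult[OF is_form_is_poly] algebra_simps)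
  also have "\<dots> = x j * p x + x j * (real d * p x)"
    using coord by (simp add: sum.distrib flip: sum_distrib_left)
  finally show ?case by (simp add: algebra_simps)
qed auto

section \<open>Gaussian averages and the Hilbert identity\<close>

definition std_normal :: "real measure" where
  "std_normal = density lborel std_normal_density"

definition gauss :: "nat \<Rightarrow> (nat \<Rightarrow> real) measure" where
  "gauss n = (\<Pi>\<^sub>M i\<in>{..<n}. std_normal)"

definition expect :: "nat \<Rightarrow> ((nat \<Rightarrow> real) \<Rightarrow> real) \<Rightarrow> real" where
  "expect n p = (\<integral>x. p x \<partial>gauss n)"

definition normal_moment :: "nat \<Rightarrow> real" where
  "normal_moment k = (\<integral>x. x ^ k \<partial>std_normal)"

lemma prob_space_std_normal: "prob_space std_normal"
  unfolding std_normal_def by (rule prob_space_normal_density) simp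

lemma product_sigma_finite_std_normal: "product_sigma_finite (\<lambda>i. std_normal)"
proof -
  interpret prob_space std_normal by (rule prob_space_std_normal)
  show ?thesis by unfold_locales
qed

lemma integrable_std_normal_power: "integrable std_normal (\<lambda>x. x ^ k)"
  unfolding std_normal_def
  by (subst integrable_density) (auto simp: integrable_std_normal_moment)

lemma normal_moment_eq: "normal_moment k = (\<integral>x. std_normal_density x * x ^ k \<partial>lborel)"
  unfolding normal_moment_def std_normal_def by (subst integral_density) auto

lemma normal_moment_even: "normal_moment (2 * k) = fact (2 * k) / (2 ^ k * fact k)"
  unfolding normal_moment_eq by (rule integral_std_normal_moment_even)

lemma normal_moment_odd: "normal_moment (2 * k + 1) = 0"
  unfolding normal_moment_eq by (rule integral_std_normal_moment_odd)

lemma normal_moment_0: "normal_moment 0 = 1"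
  using normal_moment_even[of 0] by simp

text \<open>Integration by parts in one variable, read off from the closed formula for the moments.
  At \<open>k = 0\<close> it says that the mean is zero.\<close>

lemma normal_moment_rec: "normal_moment (Suc k) = real k * normal_moment (k - 1)"
proof (cases "even k")
  case True
  then obtain j where k: "k = 2 * j" by (elim evenE)
  have "normal_moment (Suc k) = 0" using normal_moment_odd[of j] k by simp
  moreover have "real k * normal_moment (k - 1) = 0"
  proof (cases j)
    case (Suc i)
    then show ?thesis using normal_moment_odd[of i] k by simp
  qed (use k in simp)
  ultimately show ?thesis by simp
next
  case False
  then obtain j where k: "k = 2 * j + 1" by (elim oddE)
  have "normal_moment (Suc k) = normal_moment (2 * Suc j)" using k by simp
  also have "\<dots> = fact (2 * Suc j) / (2 ^ Suc j * fact (Suc j))" by (rule normal_moment_even)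
  also have "fact (2 * Suc j) = (2 * real j + 2) * (real k * fact (2 * j))"
    using k by (simp add: algebra_simps)
  also have "2 ^ Suc j * fact (Suc j) = (2 * real j + 2) * (2 ^ j * fact j)"
    by (simp add: algebra_simps)
  also have "(2 * real j + 2) * (real k * fact (2 * j)) / ((2 * real j + 2) * (2 ^ j * fact j))
      = real k * (fact (2 * j) / (2 ^ j * fact j))" by simp
  also have "\<dots> = real k * normal_moment (k - 1)" using normal_moment_even[of j] k by simp
  finally show ?thesis .
qed

lemma integrable_gauss_mono: "integrable (gauss n) (mono_eval n \<alpha>)"
proof -
  interpret product_sigma_finite "\<lambda>i. std_normal" by (rule product_sigma_finite_std_normal)
  show ?thesis unfolding gauss_def mono_eval_def[abs_def]
    by (rule product_integrable_prod) (auto simp: integrable_std_normal_power)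
qed

lemma expect_mono: "expect n (mono_eval n \<alpha>) = (\<Prod>i<n. normal_moment (\<alpha> i))"
proof -
  interpret product_sigma_finite "\<lambda>i. std_normal" by (rule product_sigma_finite_std_normal)
  show ?thesis unfolding expect_def gauss_def mono_eval_def[abs_def] normal_moment_def
    by (rule product_integral_prod) (auto simp: integrable_std_normal_power)
qed

lemma integrable_gauss:
  assumes "is_poly n p" shows "integrable (gauss n) p"
proof -
  obtain A c where "finite A" and p: "\<And>x. p x = (\<Sum>\<alpha>\<in>A. c \<alpha> * mono_eval n \<alpha> x)"
    using assms unfolding is_poly_def by auto
  have "integrable (gauss n) (\<lambda>x. \<Sum>\<alpha>\<in>A. c \<alpha> * mono_eval n \<alpha> x)"
    by (intro Bochner_Integration.integrable_sum integrable_mult_right integrable_gauss_mono)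
  moreover have "p = (\<lambda>x. \<Sum>\<alpha>\<in>A. c \<alpha> * mono_eval n \<alpha> x)" using p by (rule ext)
  ultimately show ?thesis by simp
qed

lemma expect_nonneg: "(\<And>x. p x \<ge> 0) \<Longrightarrow> expect n p \<ge> 0"
  unfolding expect_def by (rule Bochner_Integration.integral_nonneg)

lemma expect_add: "is_poly n p \<Longrightarrow> is_poly n q \<Longrightarrow> expect n (\<lambda>x. p x + q x) = expect n p + expect n q"
  unfolding expect_def by (intro Bochner_Integration.integral_add integrable_gauss)

lemma expect_diff: "is_poly n p \<Longrightarrow> is_poly n q \<Longrightarrow> expect n (\<lambda>x. p x - q x) = expect n p - expect n q"
  unfolding expect_def by (intro Bochner_Integration.integral_diff integrable_gauss)

lemma expect_cmult: "expect n (\<lambda>x. c * p x) = c * expect n p"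
  unfolding expect_def by simp

lemma expect_zero: "expect n (\<lambda>x. 0) = 0"
  unfolding expect_def by simp

lemma expect_sum:
  "(\<And>i. i \<in> I \<Longrightarrow> is_poly n (p i)) \<Longrightarrow> expect n (\<lambda>x. \<Sum>i\<in>I. p i x) = (\<Sum>i\<in>I. expect n (p i))"
  unfolding expect_def by (intro Bochner_Integration.integral_sum integrable_gauss)

lemma expect_lincomb:
  assumes "\<And>i. i \<in> I \<Longrightarrow> is_poly n (p i)"
  shows "expect n (\<lambda>x. \<Sum>i\<in>I. c i * p i x) = (\<Sum>i\<in>I. c i * expect n (p i))"
  using assms by (subst expect_sum) (auto intro: is_poly_cmult simp: expect_cmult)

lemma expect_const: "expect n (\<lambda>x. c) = c"
  using expect_mono[of n "\<lambda>_. 0"] expect_cmult[of n c "\<lambda>_. 1"]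
  by (simp add: mono_eval_def[abs_def] normal_moment_0)

lemma partial_mono_eval:
  assumes "i < n"
  shows "partial i (mono_eval n \<alpha>) x = real (\<alpha> i) * mono_eval n (\<alpha>(i := \<alpha> i - 1)) x"
proof (rule partial_eqI)
  let ?P = "\<Prod>j\<in>{..<n}-{i}. x j ^ \<alpha> j"
  have e: "mono_eval n (\<alpha>(i := k)) (x(i := t)) = t ^ k * ?P" for t k
  proof -
    have "(\<Prod>j\<in>{..<n}-{i}. (x(i := t)) j ^ (\<alpha>(i := k)) j) = ?P" by (intro prod.cong) auto
    then show ?thesis unfolding mono_eval_def using assms by (subst prod.remove[of _ i]) auto
  qed
  have "((\<lambda>t. t ^ \<alpha> i * ?P) has_real_derivative real (\<alpha> i) * (x i ^ (\<alpha> i - 1) * ?P)) (at (x i))"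
    by (auto intro!: derivative_eq_intros)
  then show "((\<lambda>t. mono_eval n \<alpha> (x(i := t))) has_real_derivative
      real (\<alpha> i) * mono_eval n (\<alpha>(i := \<alpha> i - 1)) x) (at (x i))"
    using e[of "\<alpha> i"] e[of "\<alpha> i - 1" "x i"] by simp
qed

lemma is_poly_mono_eval: "is_poly n (mono_eval n \<alpha>)"
  unfolding mono_eval_def[abs_def] by (intro is_poly_intros) auto

text \<open>Gaussian integration by parts. Independence reduces a monomial to the moment recursion
  in the \<open>i\<close>-th coordinate; linearity does the rest.\<close>

lemma stein_identity:
  assumes "is_poly n p" "i < n"
  shows "expect n (\<lambda>x. x i * p x) = expect n (partial i p)"
proof -
  have m: "expect n (\<lambda>x. x i * mono_eval n \<alpha> x) = expect n (partial i (mono_eval n \<alpha>))" for \<alpha>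
  proof -
    let ?P = "\<Prod>j\<in>{..<n}-{i}. normal_moment (\<alpha> j)"
    have e: "expect n (mono_eval n (\<alpha>(i := k))) = normal_moment k * ?P" for k
    proof -
      have "(\<Prod>j\<in>{..<n}-{i}. normal_moment ((\<alpha>(i := k)) j)) = ?P" by (intro prod.cong) auto
      then show ?thesis unfolding expect_mono using assms(2) by (subst prod.remove[of _ i]) auto
    qed
    have "expect n (\<lambda>x. x i * mono_eval n \<alpha> x) = expect n (mono_eval n (\<alpha>(i := Suc (\<alpha> i))))"
      by (simp only: mono_eval_shift[OF assms(2), symmetric, abs_def])
    also have "\<dots> = real (\<alpha> i) * (normal_moment (\<alpha> i - 1) * ?P)"
      unfolding e normal_moment_rec by simp
    also have "\<dots> = real (\<alpha> i) * expect n (mono_eval n (\<alpha>(i := \<alpha> i - 1)))" unfolding e ..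
    also have "\<dots> = expect n (partial i (mono_eval n \<alpha>))"
      unfolding expect_cmult[symmetric]
      by (intro arg_cong[where f = "expect n"] ext partial_mono_eval[OF assms(2), symmetric])
    finally show ?thesis .
  qed
  obtain A c where A: "finite A" and p: "\<And>x. p x = (\<Sum>\<alpha>\<in>A. c \<alpha> * mono_eval n \<alpha> x)"
    using assms unfolding is_poly_def by auto
  have p': "p = (\<lambda>x. \<Sum>\<alpha>\<in>A. c \<alpha> * mono_eval n \<alpha> x)" using p by (rule ext)
  have "expect n (\<lambda>x. x i * p x) = expect n (\<lambda>x. \<Sum>\<alpha>\<in>A. c \<alpha> * (x i * mono_eval n \<alpha> x))"
    unfolding p by (simp add: sum_distrib_left mult_ac)
  also have "\<dots> = (\<Sum>\<alpha>\<in>A. c \<alpha> * expect n (\<lambda>x. x i * mono_eval n \<alpha> x))"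
    using assms(2) by (subst expect_sum) (auto intro!: is_poly_intros is_poly_mono_eval simp: expect_cmult)
  also have "\<dots> = (\<Sum>\<alpha>\<in>A. c \<alpha> * expect n (partial i (mono_eval n \<alpha>)))"
    unfolding m ..
  also have "\<dots> = expect n (\<lambda>x. \<Sum>\<alpha>\<in>A. c \<alpha> * partial i (mono_eval n \<alpha>) x)"
    by (subst expect_sum) (auto intro!: is_poly_intros is_poly_partial is_poly_mono_eval simp: expect_cmult)
  also have "(\<lambda>x. \<Sum>\<alpha>\<in>A. c \<alpha> * partial i (mono_eval n \<alpha>) x) = partial i p"
    unfolding p' using A
    by (subst partial_sum[of _ n]) (auto intro!: is_poly_intros is_poly_mono_eval simp: partial_cmult[of n] is_poly_mono_eval)
  finally show ?thesis .
qed

section \<open>Powers of linear forms\<close>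

definition dot :: "nat \<Rightarrow> (nat \<Rightarrow> real) \<Rightarrow> (nat \<Rightarrow> real) \<Rightarrow> real" where
  "dot n x u = (\<Sum>i<n. x i * u i)"

lemma is_poly_dot: "is_poly n (dot n x)"
  unfolding dot_def[abs_def] by (intro is_poly_intros) auto

lemma is_form_dot_power: "is_form n k (\<lambda>u. dot n x u ^ k)"
proof (induction k)
  case 0
  then show ?case using is_form_const[of n 1] by simp
next
  case (Suc k)
  have "is_form n (Suc k) (\<lambda>u. \<Sum>i<n. x i * (u i * dot n x u ^ k))"
    by (intro is_form_sum is_form_cmult is_form_coord_mult Suc) simp
  then show ?case by (simp add: dot_def sum_distrib_right mult_ac)
qed

lemma partial_dot: "i < n \<Longrightarrow> partial i (dot n x) = (\<lambda>u. x i)"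
proof -
  assume i: "i < n"
  have "partial i (\<lambda>u. \<Sum>j<n. x j * u j) = (\<lambda>u. \<Sum>j<n. x j * (if i = j then 1 else 0))"
    by (subst partial_sum[of _ n]) (auto intro!: is_poly_intros simp: partial_cmult[of n] is_poly_coord partial_coord)
  then show ?thesis using i by (simp add: dot_def[abs_def] if_distrib cong: if_cong)
qed

lemma partial_power:
  assumes "is_poly n p"
  shows "partial i (\<lambda>x. p x ^ k) = (\<lambda>x. real k * partial i p x * p x ^ (k - 1))"
proof (induction k)
  case (Suc k)
  have "partial i (\<lambda>x. p x * p x ^ k) = (\<lambda>x. partial i p x * p x ^ k + p x * partial i (\<lambda>x. p x ^ k) x)"
    using assms by (intro partial_mult is_poly_intros)
  also have "\<dots> = (\<lambda>x. real (Suc k) * partial i p x * p x ^ k)"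
    unfolding Suc by (cases k) (auto simp: fun_eq_iff algebra_simps)
  finally show ?case by simp
qed simp

lemma partial_dot_power:
  "i < n \<Longrightarrow> partial i (\<lambda>u. dot n x u ^ k) = (\<lambda>u. real k * x i * dot n x u ^ (k - 1))"
  by (simp add: partial_power[OF is_poly_dot] partial_dot)

text \<open>Truncation of the generalized Hermite polynomial \<open>exp (- \<Delta> / 2) q\<close>.\<close>

definition hermite :: "nat \<Rightarrow> nat \<Rightarrow> ((nat \<Rightarrow> real) \<Rightarrow> real) \<Rightarrow> (nat \<Rightarrow> real) \<Rightarrow> real" where
  "hermite n J q x = (\<Sum>j\<le>J. (-1) ^ j / (2 ^ j * fact j) * (lap n ^^ j) q x)"

lemma is_poly_hermite: "is_poly n q \<Longrightarrow> is_poly n (hermite n J q)"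
  unfolding hermite_def[abs_def] by (intro is_poly_intros is_poly_lap_pow)

text \<open>The operator exp (- Delta / 2) turns multiplication by \<open>x i\<close> into the
  creation operator \<open>x i\<close> minus \<open>partial i\<close>. The commutator terms collapse
  because the coefficients satisfy 2 (j + 1) a_(j+1) = - a_j; \<open>m < J\<close> makes the term
  left over at the end of the truncated sum vanish.\<close>

lemma hermite_coord_mult:
  assumes q: "is_form n m q" and i: "i < n" and J: "m < J"
  shows "hermite n J (\<lambda>x. x i * q x) x = x i * hermite n J q x - partial i (hermite n J q) x"
proof -
  note qp = is_form_is_poly[OF q]
  define a :: "nat \<Rightarrow> real" where "a j = (-1) ^ j / (2 ^ j * fact j)" for j
  define g where "g j = partial i ((lap n ^^ j) q) x" for j
  have gJ: "g J = 0"
    unfolding g_def using lap_pow_eq_0[OF q, of J] J by simp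
  have rec: "a (Suc j) * (2 * real (Suc j)) = - a j" for j
    unfolding a_def fact_Suc power_Suc by (simp add: field_simps del: of_nat_Suc)
  have "hermite n J (\<lambda>x. x i * q x) x
     = (\<Sum>j\<le>J. a j * (x i * (lap n ^^ j) q x + 2 * real j * g (j - 1)))"
    unfolding hermite_def a_def[symmetric] g_def lap_pow_coord_mult[OF qp i] ..
  also have "\<dots> = x i * hermite n J q x + (\<Sum>j\<le>J. a j * (2 * real j) * g (j - 1))"
    unfolding hermite_def a_def[symmetric]
    by (simp add: sum.distrib distrib_left sum_distrib_left mult_ac)
  also have "(\<Sum>j\<le>J. a j * (2 * real j) * g (j - 1)) = - (\<Sum>j\<le>J. a j * g j)"
  proof -
    obtain K where K: "J = Suc K" using J by (cases J) auto
    have "(\<Sum>j\<le>J. a j * (2 * real j) * g (j - 1)) = (\<Sum>j\<le>K. a (Suc j) * (2 * real (Suc j)) * g j)"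
      unfolding K by (subst sum.atMost_Suc_shift) simp
    also have "\<dots> = - (\<Sum>j\<le>K. a j * g j)" unfolding rec by (simp add: sum_negf)
    also have "\<dots> = - (\<Sum>j\<le>J. a j * g j)" using gJ K by simp
    finally show ?thesis .
  qed
  also have "(\<Sum>j\<le>J. a j * g j) = partial i (hermite n J q) x"
    unfolding hermite_def[abs_def] a_def[symmetric] g_def
    by (subst partial_sum[of _ n]) (auto intro!: is_poly_intros is_poly_lap_pow qp simp: partial_cmult[of n] is_poly_lap_pow qp)
  finally show ?thesis by simp
qed

lemma hermite_add:
  assumes "is_poly n p" "is_poly n q"
  shows "hermite n J (\<lambda>x. p x + q x) x = hermite n J p x + hermite n J q x"
  unfolding hermite_def lap_pow_add[OF assms] by (simp add: distrib_left sum.distrib)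

lemma hermite_const: "hermite n J (\<lambda>x. c) = (\<lambda>x. c)"
proof
  fix x
  have "(lap n ^^ j) (\<lambda>x. c) x = (if j = 0 then c else 0)" for j
    using lap_pow_eq_0[OF is_form_const, of j n c] by auto
  then have "hermite n J (\<lambda>x. c) x = (\<Sum>j\<le>J. if j = 0 then c else 0)"
    unfolding hermite_def by (intro sum.cong) auto
  then show "hermite n J (\<lambda>x. c) x = c" by (simp add: sum.delta')
qed

text \<open>Stein's identity cancels the derivative in the creation operator, and only the
  derivative of the power of \<open>dot n x u\<close> survives. So each coordinate factor of
  \<open>q\<close> comes out as \<open>x i\<close> and lowers the exponent by one. The bound
  \<open>J\<close> is kept apart from \<open>m\<close> because the degree varies in the
  induction.\<close>

lemma expect_hermite_dot:
  assumes "is_form n m q" "m \<le> J"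
  shows "expect n (\<lambda>u. hermite n J q u * dot n x u ^ (m + N))
     = fact (m + N) / fact N * q x * expect n (\<lambda>u. dot n x u ^ N)"
  using assms
proof (induction rule: is_form_induct)
  case (zero d)
  then show ?case by (simp add: hermite_const expect_zero)
next
  case (const c)
  then show ?case by (simp add: hermite_const expect_cmult)
next
  case (add d p q)
  note P = is_form_is_poly[OF add(1)] is_form_is_poly[OF add(2)]
  have "expect n (\<lambda>u. hermite n J (\<lambda>x. p x + q x) u * dot n x u ^ (d + N))
      = expect n (\<lambda>u. hermite n J p u * dot n x u ^ (d + N) + hermite n J q u * dot n x u ^ (d + N))"
    using P by (simp add: hermite_add distrib_right)
  also have "\<dots> = expect n (\<lambda>u. hermite n J p u * dot n x u ^ (d + N))
     + expect n (\<lambda>u. hermite n J q u * dot n x u ^ (d + N))"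
    using P by (intro expect_add is_poly_intros is_poly_hermite is_poly_dot)
  finally show ?case using add by (simp add: algebra_simps add_divide_distrib)
next
  case (coord d p i)
  note P = is_form_is_poly[OF coord.hyps(1)]
  note PH = is_poly_hermite[OF P]
  let ?H = "hermite n J p" and ?N = "Suc d + N"
  have w: "is_poly n (\<lambda>u. dot n x u ^ ?N)" by (intro is_poly_intros is_poly_dot)
  have "expect n (\<lambda>u. hermite n J (\<lambda>x. x i * p x) u * dot n x u ^ ?N)
     = expect n (\<lambda>u. u i * (?H u * dot n x u ^ ?N) - partial i ?H u * dot n x u ^ ?N)"
  proof (intro arg_cong[where f = "expect n"] ext)
    fix u
    have "hermite n J (\<lambda>x. x i * p x) u = u i * ?H u - partial i ?H u"
      using hermite_coord_mult[OF coord.hyps(1,2), of J] coord.prems by simp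
    then show "hermite n J (\<lambda>x. x i * p x) u * dot n x u ^ ?N
        = u i * (?H u * dot n x u ^ ?N) - partial i ?H u * dot n x u ^ ?N"
      by (simp add: left_diff_distrib mult.assoc)
  qed
  also have "\<dots> = expect n (\<lambda>u. u i * (?H u * dot n x u ^ ?N)) - expect n (\<lambda>u. partial i ?H u * dot n x u ^ ?N)"
    using w PH coord.hyps(2) by (intro expect_diff is_poly_mult is_poly_coord is_poly_partial)
  also have "expect n (\<lambda>u. u i * (?H u * dot n x u ^ ?N)) = expect n (partial i (\<lambda>u. ?H u * dot n x u ^ ?N))"
    using w PH coord.hyps(2) by (intro stein_identity is_poly_mult)
  also have "\<dots> = expect n (\<lambda>u. partial i ?H u * dot n x u ^ ?N + ?H u * (real ?N * x i * dot n x u ^ (?N - 1)))"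
    using partial_mult[OF PH w, of i] partial_dot_power[OF coord.hyps(2), of x ?N] by simp
  also have "\<dots> = expect n (\<lambda>u. partial i ?H u * dot n x u ^ ?N)
       + expect n (\<lambda>u. ?H u * (real ?N * x i * dot n x u ^ (?N - 1)))"
    using w PH by (intro expect_add is_poly_mult is_poly_partial is_poly_const is_poly_power is_poly_dot)
  also have "expect n (\<lambda>u. ?H u * (real ?N * x i * dot n x u ^ (?N - 1)))
      = real ?N * x i * expect n (\<lambda>u. ?H u * dot n x u ^ (d + N))"
    unfolding expect_cmult[symmetric] by (simp add: mult_ac)
  finally show ?case using coord.IH coord.prems by (simp add: algebra_simps add_divide_distrib)
qed

section \<open>Averages with powers of the squared norm\<close>

definition normsq :: "nat \<Rightarrow> (nat \<Rightarrow> real) \<Rightarrow> real" where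
  "normsq n x = (\<Sum>i<n. (x i)\<^sup>2)"

lemma is_poly_normsq: "is_poly n (normsq n)"
  unfolding normsq_def[abs_def] by (intro is_poly_intros) auto

lemma is_form_normsq_mult:
  assumes "is_form n k w" shows "is_form n (Suc (Suc k)) (\<lambda>x. normsq n x * w x)"
proof -
  have "is_form n (Suc (Suc k)) (\<lambda>x. \<Sum>i<n. x i * (x i * w x))"
    by (intro is_form_sum is_form_coord_mult assms) auto
  then show ?thesis by (simp add: normsq_def sum_distrib_right power2_eq_square mult.assoc)
qed

lemma is_form_normsq_power_mult:
  assumes "is_form n k w" shows "is_form n (k + 2 * j) (\<lambda>x. normsq n x ^ j * w x)"
proof (induction j)
  case (Suc j)
  then show ?case using is_form_normsq_mult[OF Suc] by (simp add: mult.assoc)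
qed (use assms in simp)

text \<open>Stein's identity in each coordinate followed by Euler's identity; this takes the place
  of integration in polar coordinates.\<close>

lemma expect_normsq_mult:
  assumes "is_form n k w"
  shows "expect n (\<lambda>x. normsq n x * w x) = (real n + real k) * expect n w"
proof -
  note W = is_form_is_poly[OF assms]
  have "expect n (\<lambda>x. normsq n x * w x) = expect n (\<lambda>x. \<Sum>i<n. x i * (x i * w x))"
    by (simp add: normsq_def sum_distrib_right power2_eq_square mult.assoc)
  also have "\<dots> = (\<Sum>i<n. expect n (\<lambda>x. x i * (x i * w x)))"
    using W by (intro expect_sum is_poly_intros) auto
  also have "\<dots> = (\<Sum>i<n. expect n (\<lambda>x. w x + x i * partial i w x))"
    using W by (intro sum.cong refl) (auto simp: stein_identity partial_coord_mult[of n] is_poly_intros)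
  also have "\<dots> = expect n (\<lambda>x. \<Sum>i<n. w x + x i * partial i w x)"
    using W by (intro expect_sum[symmetric] is_poly_intros is_poly_partial) auto
  also have "\<dots> = expect n (\<lambda>x. (real n + real k) * w x)"
    using euler_homogeneous[OF assms] by (simp add: sum.distrib algebra_simps)
  finally show ?thesis by (simp add: expect_cmult)
qed

lemma expect_normsq_power_mult:
  assumes "is_form n k w"
  shows "expect n (\<lambda>x. normsq n x ^ j * w x) = (\<Prod>i<j. real n + real k + 2 * real i) * expect n w"
proof (induction j)
  case (Suc j)
  have "expect n (\<lambda>x. normsq n x ^ Suc j * w x) = expect n (\<lambda>x. normsq n x * (normsq n x ^ j * w x))"
    by (simp add: mult.assoc)
  also have "\<dots> = (real n + real (k + 2 * j)) * expect n (\<lambda>x. normsq n x ^ j * w x)"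
    by (rule expect_normsq_mult[OF is_form_normsq_power_mult[OF assms]])
  finally show ?case unfolding Suc by (simp add: algebra_simps)
qed simp

text \<open>A linear form of a standard Gaussian vector is normal with variance
  \<open>normsq n x\<close>; the constant is the product of the odd numbers below
  \<open>2 * r\<close>.\<close>

lemma expect_dot_even_power:
  "\<exists>C>0. \<forall>x. expect n (\<lambda>u. dot n x u ^ (2 * r)) = C * normsq n x ^ r"
proof (induction r)
  case 0
  then show ?case using expect_const[of n 1] by (intro exI[of _ 1]) simp
next
  case (Suc r)
  then obtain C where C: "C > 0" "\<And>x. expect n (\<lambda>u. dot n x u ^ (2 * r)) = C * normsq n x ^ r" by auto
  have "expect n (\<lambda>u. dot n x u ^ (2 * Suc r)) = (2 * real r + 1) * C * normsq n x ^ Suc r" for x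
  proof -
    have "expect n (\<lambda>u. dot n x u ^ (2 * Suc r)) = expect n (\<lambda>u. \<Sum>i<n. x i * (u i * dot n x u ^ (2 * r + 1)))"
      by (simp add: dot_def sum_distrib_right mult_ac)
    also have "\<dots> = (\<Sum>i<n. expect n (\<lambda>u. x i * (u i * dot n x u ^ (2 * r + 1))))"
      by (intro expect_sum is_poly_intros is_poly_dot) auto
    also have "\<dots> = (\<Sum>i<n. x i * expect n (\<lambda>u. (2 * real r + 1) * x i * dot n x u ^ (2 * r)))"
    proof (intro sum.cong refl)
      fix i assume i: "i \<in> {..<n}"
      have "expect n (\<lambda>u. u i * dot n x u ^ (2 * r + 1)) = expect n (partial i (\<lambda>u. dot n x u ^ (2 * r + 1)))"
        using i by (intro stein_identity is_poly_intros is_poly_dot) auto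
      also have "partial i (\<lambda>u. dot n x u ^ (2 * r + 1)) = (\<lambda>u. (2 * real r + 1) * x i * dot n x u ^ (2 * r))"
        using i partial_dot_power[of i n x "2 * r + 1"] by (simp add: add.commute)
      finally show "expect n (\<lambda>u. x i * (u i * dot n x u ^ (2 * r + 1)))
          = x i * expect n (\<lambda>u. (2 * real r + 1) * x i * dot n x u ^ (2 * r))"
        unfolding expect_cmult by simp
    qed
    also have "\<dots> = (\<Sum>i<n. (x i)\<^sup>2) * ((2 * real r + 1) * (C * normsq n x ^ r))"
      unfolding expect_cmult C(2) by (simp add: sum_distrib_right sum_distrib_left power2_eq_square mult_ac)
    finally show ?thesis by (simp add: normsq_def mult_ac)
  qed
  then show ?case using C(1) by (intro exI[of _ "(2 * real r + 1) * C"]) auto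
qed

text \<open>The inverse of the map sending \<open>q\<close> to the average of \<open>q u\<close> times the
  \<open>(m + 2 r)\<close>-th power of \<open>dot x u\<close>, up to the factor \<open>normsq x ^ r\<close> and a positive constant.\<close>

definition kappa :: "nat \<Rightarrow> nat \<Rightarrow> nat \<Rightarrow> ((nat \<Rightarrow> real) \<Rightarrow> real) \<Rightarrow> (nat \<Rightarrow> real) \<Rightarrow> real" where
  "kappa n m r q u = (\<Sum>j\<le>m div 2. (-1) ^ j / (2 ^ j * fact j *
      (\<Prod>i<j. real n + 2 * real m + 2 * real r - 2 * real j + 2 * real i)) *
      (normsq n u ^ j * (lap n ^^ j) q u))"

lemma is_poly_kappa: "is_poly n q \<Longrightarrow> is_poly n (kappa n m r q)"
  unfolding kappa_def[abs_def] by (intro is_poly_intros is_poly_lap_pow is_poly_normsq)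

lemma kappa_sum:
  assumes "finite I" "\<And>k. k \<in> I \<Longrightarrow> is_poly n (q k)"
  shows "kappa n m r (\<lambda>x. \<Sum>k\<in>I. c k * q k x) u = (\<Sum>k\<in>I. c k * kappa n m r (q k) u)"
proof -
  have "(lap n ^^ j) (\<lambda>x. \<Sum>k\<in>I. c k * q k x) = (\<lambda>x. \<Sum>k\<in>I. c k * (lap n ^^ j) (q k) x)" for j
    using assms by (subst lap_pow_sum) (auto intro!: is_poly_intros sum.cong simp: lap_pow_cmult)
  then show ?thesis unfolding kappa_def sum_distrib_left
    by (subst sum.swap) (simp add: mult_ac sum_distrib_left sum_divide_distrib)
qed

text \<open>The \<open>j\<close>-th Laplacian of \<open>q\<close> times the power of
  \<open>dot n x u\<close> has degree 2 m + 2 r - 2 j, so the weight \<open>normsq n u ^ j\<close>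
  multiplies its average by exactly the product in the denominator of \<open>kappa\<close>. Hence
  \<open>kappa\<close> and \<open>hermite\<close> have the same average. One constant serves all
  \<open>q\<close>, which later allows \<open>q\<close> to depend on the parameter
  \<open>y\<close>.\<close>

lemma expect_kappa_dot:
  assumes "n > 0"
  shows "\<exists>C>0. \<forall>q x. is_form n m q \<longrightarrow>
    expect n (\<lambda>u. kappa n m r q u * dot n x u ^ (m + 2 * r)) = C * normsq n x ^ r * q x"
proof -
  obtain C where C: "C > 0" "\<And>x. expect n (\<lambda>u. dot n x u ^ (2 * r)) = C * normsq n x ^ r"
    using expect_dot_even_power by blast
  have "expect n (\<lambda>u. kappa n m r q u * dot n x u ^ (m + 2 * r))
     = (fact (m + 2 * r) / fact (2 * r) * C) * normsq n x ^ r * q x"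
    if q: "is_form n m q" for q x
  proof -
    let ?w = "\<lambda>u. dot n x u ^ (m + 2 * r)"
    let ?J = "m div 2"
    define b :: "nat \<Rightarrow> real" where
      "b j = (\<Prod>i<j. real n + 2 * real m + 2 * real r - 2 * real j + 2 * real i)" for j
    note qp = is_form_is_poly[OF q]
    have Lw: "is_form n (m - 2 * j + (m + 2 * r)) (\<lambda>u. (lap n ^^ j) q u * ?w u)" for j
    proof -
      have "is_form n (k + (m + 2 * r)) (\<lambda>u. p u * ?w u)" if "is_form n k p" for k p
        using that
      proof (induction rule: is_form_induct)
        case (zero d)
        then show ?case by (simp add: is_form_zero)
      next
        case (const c)
        then show ?case by (simp add: is_form_cmult is_form_dot_power)
      next
        case (add d p q)
        then show ?case by (simp add: is_form_add distrib_right)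
      next
        case (coord d p i)
        then show ?case using is_form_coord_mult[OF coord.IH coord.hyps(2)] by (simp add: mult_ac)
      qed
      from this[OF is_form_lap_pow[OF q, of j]] show ?thesis .
    qed
    have bpos: "b j > 0" if "j \<le> ?J" for j
      unfolding b_def using that assms by (intro prod_pos) auto
    have term_eq: "expect n (\<lambda>u. normsq n u ^ j * ((lap n ^^ j) q u * ?w u))
       = b j * expect n (\<lambda>u. (lap n ^^ j) q u * ?w u)" if "j \<le> ?J" for j
    proof -
      have "(\<Prod>i<j. real n + real (m - 2 * j + (m + 2 * r)) + 2 * real i) = b j"
        unfolding b_def using that by (intro prod.cong) (auto simp: of_nat_diff)
      then show ?thesis using expect_normsq_power_mult[OF Lw, of j j] by simp
    qed
    have "expect n (\<lambda>u. kappa n m r q u * ?w u)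
       = expect n (\<lambda>u. \<Sum>j\<le>?J. (-1) ^ j / (2 ^ j * fact j * b j) * (normsq n u ^ j * ((lap n ^^ j) q u * ?w u)))"
      unfolding kappa_def b_def sum_distrib_right by (simp only: mult.assoc)
    also have "\<dots> = (\<Sum>j\<le>?J. (-1) ^ j / (2 ^ j * fact j * b j) * expect n (\<lambda>u. normsq n u ^ j * ((lap n ^^ j) q u * ?w u)))"
      by (rule expect_lincomb) (intro is_poly_intros is_poly_lap_pow is_poly_normsq is_poly_dot qp)
    also have "\<dots> = (\<Sum>j\<le>?J. (-1) ^ j / (2 ^ j * fact j) * expect n (\<lambda>u. (lap n ^^ j) q u * ?w u))"
    proof (intro sum.cong refl)
      fix j assume j: "j \<in> {..?J}"
      then show "(-1) ^ j / (2 ^ j * fact j * b j) * expect n (\<lambda>u. normsq n u ^ j * ((lap n ^^ j) q u * ?w u))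
        = (-1) ^ j / (2 ^ j * fact j) * expect n (\<lambda>u. (lap n ^^ j) q u * ?w u)"
        using term_eq[of j] bpos[of j] by simp
    qed
    also have "\<dots> = (\<Sum>j\<le>m. (-1) ^ j / (2 ^ j * fact j) * expect n (\<lambda>u. (lap n ^^ j) q u * ?w u))"
    proof (intro sum.mono_neutral_left ballI)
      fix j assume "j \<in> {..m} - {..?J}"
      then have "m < 2 * j" by auto
      then show "(-1) ^ j / (2 ^ j * fact j) * expect n (\<lambda>u. (lap n ^^ j) q u * ?w u) = 0"
        using lap_pow_eq_0[OF q] by (simp add: expect_zero)
    qed auto
    also have "\<dots> = expect n (\<lambda>u. \<Sum>j\<le>m. (-1) ^ j / (2 ^ j * fact j) * ((lap n ^^ j) q u * ?w u))"
      by (rule expect_lincomb[symmetric]) (intro is_poly_intros is_poly_lap_pow is_poly_dot qp)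
    also have "\<dots> = expect n (\<lambda>u. hermite n m q u * ?w u)"
      unfolding hermite_def sum_distrib_right by (simp only: mult.assoc)
    also have "\<dots> = fact (m + 2 * r) / fact (2 * r) * q x * expect n (\<lambda>u. dot n x u ^ (2 * r))"
      by (rule expect_hermite_dot[OF q order_refl])
    finally show ?thesis unfolding C(2) by (simp add: mult_ac)
  qed
  then show ?thesis using C(1)
    by (intro exI[of _ "fact (m + 2 * r) / fact (2 * r) * C"]) simp
qed

section \<open>Sums of squares from nonnegative kernels\<close>

text \<open>Completing the square one variable at a time. \<open>G\<close> may be asymmetric, so the
  cross terms enter through \<open>S\<close>. A zero pivot forces the cross terms to vanish; a
  positive one is split off and leaves the Schur complement \<open>G'\<close>.\<close>

lemma psd_sum_squares:
  fixes G :: "'a \<Rightarrow> 'a \<Rightarrow> real"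
  assumes "finite I" "\<And>c. 0 \<le> (\<Sum>a\<in>I. \<Sum>b\<in>I. c a * c b * G a b)"
  shows "\<exists>L. \<forall>z. (\<Sum>a\<in>I. \<Sum>b\<in>I. z a * z b * G a b) = (\<Sum>l\<leftarrow>L. (\<Sum>a\<in>I. l a * z a)\<^sup>2)"
  using assms
proof (induction I arbitrary: G rule: finite_induct)
  case empty
  show ?case by (rule exI[of _ "[]"]) simp
next
  case (insert a I)
  define g where "g = G a a"
  define S where "S b = (G a b + G b a) / 2" for b
  have dec: "(\<Sum>b\<in>insert a I. \<Sum>b'\<in>insert a I. c b * c b' * G b b')
      = g * (c a)\<^sup>2 + 2 * c a * (\<Sum>b\<in>I. S b * c b) + (\<Sum>b\<in>I. \<Sum>b'\<in>I. c b * c b' * G b b')" for c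
  proof -
    have "2 * c a * (\<Sum>b\<in>I. S b * c b) = (\<Sum>b\<in>I. c a * c b * G a b) + (\<Sum>b\<in>I. c b * c a * G b a)"
      unfolding S_def sum_distrib_left sum.distrib[symmetric]
      by (intro sum.cong) (auto simp: field_simps)
    then show ?thesis using insert.hyps
      by (simp add: sum.distrib g_def power2_eq_square)
  qed
  have psd: "0 \<le> g * (c a)\<^sup>2 + 2 * c a * (\<Sum>b\<in>I. S b * c b) + (\<Sum>b\<in>I. \<Sum>b'\<in>I. c b * c b' * G b b')" for c
    using insert.prems[of c] unfolding dec .
  have extend: "(\<Sum>b\<in>insert a I. (l(a := 0)) b * z b) = (\<Sum>b\<in>I. l b * z b)" for l z :: "'a \<Rightarrow> real"
    using insert.hyps by (simp, intro sum.cong) auto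
  have "g \<ge> 0"
  proof -
    have "(\<Sum>b\<in>I. S b * (if b = a then 1 else 0)) = 0"
      using insert.hyps by (intro sum.neutral) auto
    moreover have "(\<Sum>b\<in>I. \<Sum>b'\<in>I. (if b = a then 1 else 0) * (if b' = a then 1 else 0) * G b b') = 0"
      using insert.hyps by (intro sum.neutral) (auto intro!: sum.neutral)
    ultimately show ?thesis using psd[of "\<lambda>b. if b = a then 1 else 0"] by simp
  qed
  show ?case
  proof (cases "g = 0")
    case True
    have S0: "S b = 0" if b: "b \<in> I" for b
    proof (rule ccontr)
      assume nz: "S b \<noteq> 0"
      have ne: "b \<noteq> a" using b insert.hyps by auto
      \<comment> \<open>Chosen so that \<open>2 * t * S b + G b b\<close> equals -1.\<close>
      define t where "t = - (G b b + 1) / (2 * S b)"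
      define c where "c x = (if x = a then t else if x = b then 1 else 0)" for x
      have "(\<Sum>x\<in>I. S x * c x) = S b"
        using insert.hyps b ne by (subst sum.remove[of _ b]) (auto simp: c_def intro!: sum.neutral split: if_splits)
      moreover have "(\<Sum>x\<in>I. \<Sum>y\<in>I. c x * c y * G x y) = G b b"
      proof -
        have "(\<Sum>y\<in>I. c x * c y * G x y) = c x * G x b" for x
          using insert.hyps b ne by (subst sum.remove[of _ b]) (auto simp: c_def intro!: sum.neutral split: if_splits)
        then have "(\<Sum>x\<in>I. \<Sum>y\<in>I. c x * c y * G x y) = (\<Sum>x\<in>I. c x * G x b)" by simp
        also have "\<dots> = G b b"
          using insert.hyps b ne by (subst sum.remove[of _ b]) (auto simp: c_def intro!: sum.neutral split: if_splits)
        finally show ?thesis .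
      qed
      ultimately have "0 \<le> 2 * t * S b + G b b" using psd[of c] True by (simp add: c_def)
      then show False using nz by (simp add: t_def field_simps)
    qed
    have eq: "(\<Sum>b\<in>insert a I. \<Sum>b'\<in>insert a I. c b * c b' * G b b') = (\<Sum>b\<in>I. \<Sum>b'\<in>I. c b * c b' * G b b')" for c
      unfolding dec using True S0 by simp
    obtain L where "\<And>z. (\<Sum>b\<in>I. \<Sum>b'\<in>I. z b * z b' * G b b') = (\<Sum>l\<leftarrow>L. (\<Sum>b\<in>I. l b * z b)\<^sup>2)"
      using insert.IH[of G] insert.prems unfolding eq by auto
    then show ?thesis unfolding eq
      by (intro exI[of _ "map (\<lambda>l. l(a := 0)) L"]) (simp add: comp_def extend del: fun_upd_apply sum.insert sum.insert_if)
  next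
    case False
    with \<open>g \<ge> 0\<close> have g: "g > 0" by simp
    define G' where "G' b b' = G b b' - S b * S b' / g" for b b'
    have G': "(\<Sum>b\<in>I. \<Sum>b'\<in>I. c b * c b' * G' b b')
        = (\<Sum>b\<in>I. \<Sum>b'\<in>I. c b * c b' * G b b') - (\<Sum>b\<in>I. S b * c b)\<^sup>2 / g" for c
    proof -
      have "(\<Sum>b\<in>I. S b * c b)\<^sup>2 / g = (\<Sum>b\<in>I. \<Sum>b'\<in>I. c b * c b' * (S b * S b' / g))"
        unfolding power2_eq_square sum_product sum_divide_distrib by (simp add: mult_ac)
      then show ?thesis unfolding G'_def by (simp add: right_diff_distrib sum_subtractf)
    qed
    have "0 \<le> (\<Sum>b\<in>I. \<Sum>b'\<in>I. c b * c b' * G' b b')" for c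
    proof -
      define s where "s = (\<Sum>b\<in>I. S b * c b)"
      \<comment> \<open>The coefficient at \<open>a\<close> that minimises the form; the minimum is
        the form of the Schur complement.\<close>
      define e where "e = c(a := - s / g)"
      have 1: "(\<Sum>b\<in>I. S b * e b) = s" unfolding s_def
        using insert.hyps by (intro sum.cong) (auto simp: e_def)
      have 2: "(\<Sum>b\<in>I. \<Sum>b'\<in>I. e b * e b' * G b b') = (\<Sum>b\<in>I. \<Sum>b'\<in>I. c b * c b' * G b b')"
        using insert.hyps by (intro sum.cong) (auto simp: e_def)
      have ea: "e a = - s / g" by (simp add: e_def)
      have "g * (e a)\<^sup>2 + 2 * e a * s = - s\<^sup>2 / g"
        unfolding ea using g by (simp add: field_simps power2_eq_square)
      then show ?thesis using psd[of e] unfolding 1 2 G' s_def[symmetric] by simp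
    qed
    from insert.IH[OF this] obtain L where
      L: "\<And>z. (\<Sum>b\<in>I. \<Sum>b'\<in>I. z b * z b' * G' b b') = (\<Sum>l\<leftarrow>L. (\<Sum>b\<in>I. l b * z b)\<^sup>2)" by auto
    define l0 where "l0 b = (if b = a then sqrt g else S b / sqrt g)" for b
    have l0: "(\<Sum>b\<in>insert a I. l0 b * z b)\<^sup>2 = g * (z a)\<^sup>2 + 2 * z a * (\<Sum>b\<in>I. S b * z b) + (\<Sum>b\<in>I. S b * z b)\<^sup>2 / g" for z
    proof -
      have "(\<Sum>b\<in>I. l0 b * z b) = (\<Sum>b\<in>I. S b * z b) / sqrt g"
        unfolding sum_divide_distrib using insert.hyps by (intro sum.cong) (auto simp: l0_def)
      then have "(\<Sum>b\<in>insert a I. l0 b * z b) = sqrt g * z a + (\<Sum>b\<in>I. S b * z b) / sqrt g"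
        using insert.hyps by (simp add: l0_def)
      then show ?thesis using g by (simp add: power2_sum power_mult_distrib power_divide)
    qed
    have "(\<Sum>b\<in>insert a I. \<Sum>b'\<in>insert a I. z b * z b' * G b b')
       = (\<Sum>l\<leftarrow>l0 # map (\<lambda>l. l(a := 0)) L. (\<Sum>b\<in>insert a I. l b * z b)\<^sup>2)" for z
      using L[of z] unfolding G' dec
      by (simp add: comp_def extend l0 del: fun_upd_apply sum.insert sum.insert_if)
    then show ?thesis by blast
  qed
qed

text \<open>Averaging matrices that are positive semidefinite at every \<open>u\<close> gives one
  constant positive semidefinite matrix, which \<open>psd_sum_squares\<close> splits into squares of
  combinations of the \<open>\<phi> a\<close>.\<close>

lemma is_sos_expect:
  assumes I: "finite I"
    and F: "\<And>a b. is_poly n (F a b)"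
    and psd: "\<And>c u. 0 \<le> (\<Sum>a\<in>I. \<Sum>b\<in>I. c a * c b * F a b u)"
    and \<phi>: "\<And>a. a \<in> I \<Longrightarrow> is_poly N (\<phi> a)"
  shows "is_sos N (\<lambda>z. expect n (\<lambda>u. \<Sum>a\<in>I. \<Sum>b\<in>I. \<phi> a z * \<phi> b z * F a b u))"
proof -
  have E: "expect n (\<lambda>u. \<Sum>a\<in>I. \<Sum>b\<in>I. c a * c b * F a b u) = (\<Sum>a\<in>I. \<Sum>b\<in>I. c a * c b * expect n (F a b))" for c
  proof -
    have "expect n (\<lambda>u. \<Sum>a\<in>I. \<Sum>b\<in>I. c a * c b * F a b u) = (\<Sum>a\<in>I. expect n (\<lambda>u. \<Sum>b\<in>I. c a * c b * F a b u))"
      using F by (intro expect_sum is_poly_intros)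
    also have "\<dots> = (\<Sum>a\<in>I. \<Sum>b\<in>I. c a * c b * expect n (F a b))"
      using F by (intro sum.cong refl expect_lincomb)
    finally show ?thesis .
  qed
  have "0 \<le> (\<Sum>a\<in>I. \<Sum>b\<in>I. c a * c b * expect n (F a b))" for c
    unfolding E[symmetric] by (rule expect_nonneg) (rule psd)
  from psd_sum_squares[OF I this] obtain L where
    L: "\<And>z. (\<Sum>a\<in>I. \<Sum>b\<in>I. z a * z b * expect n (F a b)) = (\<Sum>l\<leftarrow>L. (\<Sum>a\<in>I. l a * z a)\<^sup>2)" by auto
  show ?thesis unfolding is_sos_def E L
    by (intro exI[of _ "map (\<lambda>l z. \<Sum>a\<in>I. l a * \<phi> a z) L"])
       (auto simp: comp_def intro!: is_poly_sum is_poly_cmult \<phi>)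
qed

section \<open>From a nonnegative kernel to sos-convexity\<close>

lemma is_form_hess_quad:
  assumes "is_form n d f" shows "is_form n (d - 2) (\<lambda>x. hess_quad n f x y)"
  unfolding hess_quad_def using is_form_partial[OF is_form_partial[OF assms]]
  by (intro is_form_sum is_form_cmult) (simp add: numeral_2_eq_2)

lemma hess_quad_scale: "hess_quad n f x (\<lambda>i. c * y i) = c\<^sup>2 * hess_quad n f x y"
  unfolding hess_quad_def sum_distrib_left by (simp add: power2_eq_square mult_ac)

lemma kappa_hess_quad:
  assumes "is_poly n f"
  shows "kappa n m r (\<lambda>x. hess_quad n f x y) u
     = (\<Sum>i<n. \<Sum>j<n. y i * y j * kappa n m r (partial i (partial j f)) u)"
proof -
  note P = is_poly_partial[OF is_poly_partial[OF assms]]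
  have "kappa n m r (\<lambda>x. hess_quad n f x y) u
     = kappa n m r (\<lambda>x. \<Sum>p\<in>{..<n}\<times>{..<n}. (y (fst p) * y (snd p)) * partial (fst p) (partial (snd p) f) x) u"
    unfolding hess_quad_def by (simp add: sum.cartesian_product case_prod_beta)
  also have "\<dots> = (\<Sum>p\<in>{..<n}\<times>{..<n}. (y (fst p) * y (snd p)) * kappa n m r (partial (fst p) (partial (snd p) f)) u)"
    by (rule kappa_sum) (auto intro: P)
  finally show ?thesis by (simp add: sum.cartesian_product case_prod_beta)
qed

text \<open>Summing over words of indices instead of monomials avoids multinomial coefficients and
  splits the power into products in \<open>x\<close> and in \<open>u\<close>.\<close>

lemma dot_power_expand:
  "dot n x u ^ s = (\<Sum>g\<in>PiE {..<s} (\<lambda>_. {..<n}). (\<Prod>k<s. x (g k)) * (\<Prod>k<s. u (g k)))"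
proof -
  have "dot n x u ^ s = (\<Prod>k<s. \<Sum>i<n. x i * u i)" by (simp add: dot_def)
  also have "\<dots> = (\<Sum>g\<in>PiE {..<s} (\<lambda>_. {..<n}). \<Prod>k<s. x (g k) * u (g k))"
    by (rule prod_sum_PiE) auto
  finally show ?thesis by (simp add: prod.distrib)
qed

text \<open>Since the degree is even, the exponent m + 2 r is 2 s, and the average is a quadratic
  form in the products of some \<open>y i\<close> with a word of length \<open>s\<close> in
  \<open>x\<close>. These products form the Gram vector.\<close>

theorem r_sos_convex_if_kappa_nonneg:
  assumes n: "n > 0" and d: "even d" "d \<ge> 2" and f: "is_form n d f"
    and pos: "\<And>u y. 0 \<le> kappa n (d - 2) r (\<lambda>x. hess_quad n f x y) u"
  shows "r_sos_convex n r f"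
proof -
  define m where "m = d - 2"
  note fp = is_form_is_poly[OF f]
  obtain C where C: "C > 0" "\<And>q x. is_form n m q \<Longrightarrow>
      expect n (\<lambda>u. kappa n m r q u * dot n x u ^ (m + 2 * r)) = C * normsq n x ^ r * q x"
    using expect_kappa_dot[OF n] by blast
  define s where "s = m div 2 + r"
  have "2 * (m div 2) = m" using d unfolding m_def by (intro dvd_mult_div_cancel) simp
  then have s: "m + 2 * r = s + s" unfolding s_def by linarith
  define W where "W = PiE {..<s} (\<lambda>_. {..<n})"
  define I where "I = {..<n} \<times> W"
  define mon where "mon g u = (\<Prod>k<s. u (g k))" for g :: "nat \<Rightarrow> nat" and u :: "nat \<Rightarrow> real"
  define K where "K i j u = (1 / C) * kappa n m r (partial i (partial j f)) u" for i j u
  \<comment> \<open>The value 0 outside \<open>I\<close> makes \<open>F\<close> polynomial for all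
    indices, as \<open>is_sos_expect\<close> demands; \<open>mon\<close> is known to be polynomial
    in the \<open>n\<close> variables only for words in \<open>W\<close>.\<close>
  define F where "F p q u = (if p \<in> I \<and> q \<in> I then K (fst p) (fst q) u * (mon (snd p) u * mon (snd q) u) else 0)" for p q u
  define \<phi> where "\<phi> p z = z (n + fst p) * mon (snd p) z" for p z
  have finW: "finite W" unfolding W_def by (intro finite_PiE) auto
  have monp: "is_poly N (mon g)" if "g \<in> W" "n \<le> N" for g N
    unfolding mon_def[abs_def] using that by (intro is_poly_prod is_poly_coord) (fastforce simp: W_def PiE_def Pi_def)
  have Kp: "is_poly n (K i j)" for i j
    unfolding K_def[abs_def] by (intro is_poly_intros is_poly_kappa is_poly_partial fp)
  have FS: "(\<Sum>p\<in>I. \<Sum>q\<in>I. c p * c q * F p q u)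
     = (\<Sum>i<n. \<Sum>j<n. (\<Sum>g\<in>W. c (i, g) * mon g u) * (\<Sum>g\<in>W. c (j, g) * mon g u) * K i j u)" for c u
  proof -
    have "(\<Sum>p\<in>I. \<Sum>q\<in>I. c p * c q * F p q u)
       = (\<Sum>p\<in>I. \<Sum>q\<in>I. c p * c q * (K (fst p) (fst q) u * (mon (snd p) u * mon (snd q) u)))"
      by (intro sum.cong) (auto simp: F_def)
    also have "\<dots> = (\<Sum>i<n. \<Sum>g\<in>W. \<Sum>j<n. \<Sum>h\<in>W. c (i, g) * c (j, h) * (K i j u * (mon g u * mon h u)))"
    proof -
      have "(\<Sum>p\<in>I. h p) = (\<Sum>i<n. \<Sum>g\<in>W. h (i, g))" for h :: "nat \<times> (nat \<Rightarrow> nat) \<Rightarrow> real"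
        unfolding I_def by (simp add: sum.cartesian_product)
      then show ?thesis by simp
    qed
    also have "\<dots> = (\<Sum>i<n. \<Sum>j<n. \<Sum>g\<in>W. \<Sum>h\<in>W. c (i, g) * c (j, h) * (K i j u * (mon g u * mon h u)))"
      by (intro sum.cong refl sum.swap)
    also have "\<dots> = (\<Sum>i<n. \<Sum>j<n. (\<Sum>g\<in>W. c (i, g) * mon g u) * (\<Sum>g\<in>W. c (j, g) * mon g u) * K i j u)"
      unfolding sum_product by (simp add: sum_distrib_right sum_distrib_left mult_ac)
    finally show ?thesis .
  qed
  have "is_sos (2 * n) (\<lambda>z. expect n (\<lambda>u. \<Sum>p\<in>I. \<Sum>q\<in>I. \<phi> p z * \<phi> q z * F p q u))"
  proof (rule is_sos_expect)
    show "finite I" unfolding I_def using finW by simp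
    show "is_poly n (F p q)" for p q
      unfolding F_def[abs_def] I_def using Kp monp
      by (cases "p \<in> {..<n} \<times> W \<and> q \<in> {..<n} \<times> W") (auto intro!: is_poly_mult is_poly_const)
    show "is_poly (2 * n) (\<phi> p)" if "p \<in> I" for p
      unfolding \<phi>_def[abs_def] using that monp by (auto simp: I_def intro!: is_poly_mult is_poly_coord)
    fix c :: "nat \<times> (nat \<Rightarrow> nat) \<Rightarrow> real" and u
    \<comment> \<open>At a fixed \<open>u\<close> the Gram form in \<open>c\<close> is the kernel of
      the Hessian form in this direction, which is where \<open>pos\<close> enters.\<close>
    let ?y = "\<lambda>i. \<Sum>g\<in>W. c (i, g) * mon g u"
    have "(\<Sum>p\<in>I. \<Sum>q\<in>I. c p * c q * F p q u) = (1 / C) * kappa n m r (\<lambda>x. hess_quad n f x ?y) u"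
      unfolding FS kappa_hess_quad[OF fp] K_def sum_distrib_left by (simp add: mult_ac)
    then show "0 \<le> (\<Sum>p\<in>I. \<Sum>q\<in>I. c p * c q * F p q u)"
      using pos[of ?y u] C(1) unfolding m_def by simp
  qed
  moreover have "expect n (\<lambda>u. \<Sum>p\<in>I. \<Sum>q\<in>I. \<phi> p z * \<phi> q z * F p q u)
     = hess_quad n f (\<lambda>i. if i < n then z i else 0) (\<lambda>i. if i < n then z (n + i) else 0) * (\<Sum>i<n. (z i)^2) ^ r" for z
  proof -
    let ?x = "\<lambda>i. if i < n then z i else 0" and ?y = "\<lambda>i. if i < n then z (n + i) else 0"
    have dotx: "(\<Sum>g\<in>W. \<phi> (i, g) z * mon g u) = ?y i * dot n ?x u ^ s" if "i < n" for i u
    proof -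
      have "dot n ?x u ^ s = dot n z u ^ s" by (simp add: dot_def)
      also have "\<dots> = (\<Sum>g\<in>W. mon g z * mon g u)" unfolding dot_power_expand W_def mon_def ..
      finally show ?thesis using that by (simp add: \<phi>_def sum_distrib_left mult.assoc)
    qed
    have "(\<Sum>p\<in>I. \<Sum>q\<in>I. \<phi> p z * \<phi> q z * F p q u)
       = (1 / C) * (kappa n m r (\<lambda>x. hess_quad n f x ?y) u * dot n ?x u ^ (m + 2 * r))" for u
    proof -
      have "(\<Sum>p\<in>I. \<Sum>q\<in>I. \<phi> p z * \<phi> q z * F p q u)
         = (\<Sum>i<n. \<Sum>j<n. (?y i * dot n ?x u ^ s) * (?y j * dot n ?x u ^ s) * K i j u)"
        unfolding FS using dotx by simp
      then show ?thesis unfolding s power_add kappa_hess_quad[OF fp] K_def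
        by (simp only: sum_distrib_left sum_distrib_right mult_ac)
    qed
    then have "expect n (\<lambda>u. \<Sum>p\<in>I. \<Sum>q\<in>I. \<phi> p z * \<phi> q z * F p q u)
       = (1 / C) * expect n (\<lambda>u. kappa n m r (\<lambda>x. hess_quad n f x ?y) u * dot n ?x u ^ (m + 2 * r))"
      by (simp only: expect_cmult)
    also have "\<dots> = normsq n ?x ^ r * hess_quad n f ?x ?y"
      using C(1) by (subst C(2)) (simp_all add: m_def is_form_hess_quad[OF f])
    also have "normsq n ?x = (\<Sum>i<n. (z i)^2)" by (simp add: normsq_def)
    finally show ?thesis by (simp add: mult.commute)
  qed
  ultimately show ?thesis unfolding r_sos_convex_def by simp
qed

section \<open>Operations on sums of squares\<close>

lemma is_sos_mult_square:
  assumes "is_sos N p" "is_poly N q" shows "is_sos N (\<lambda>z. p z * (q z)\<^sup>2)"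
proof -
  obtain qs where qs: "\<forall>q\<in>set qs. is_poly N q" "\<And>x. p x = (\<Sum>q\<leftarrow>qs. (q x)^2)"
    using assms(1) unfolding is_sos_def by auto
  show ?thesis unfolding is_sos_def
    using qs(1) assms(2)
    by (intro exI[of _ "map (\<lambda>q' z. q' z * q z) qs"])
       (auto simp: qs(2) comp_def power_mult_distrib sum_list_mult_const intro: is_poly_mult)
qed

lemma is_sos_add:
  assumes "is_sos N p" "is_sos N q" shows "is_sos N (\<lambda>z. p z + q z)"
proof -
  obtain ps qs where "\<forall>q\<in>set ps. is_poly N q" "\<And>x. p x = (\<Sum>q\<leftarrow>ps. (q x)^2)"
     "\<forall>q\<in>set qs. is_poly N q" "\<And>x. q x = (\<Sum>q\<leftarrow>qs. (q x)^2)"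
    using assms unfolding is_sos_def by auto
  then show ?thesis unfolding is_sos_def by (intro exI[of _ "ps @ qs"]) auto
qed

lemma is_sos_zero: "is_sos N (\<lambda>z. 0)"
  unfolding is_sos_def by (intro exI[of _ "[]"]) simp

lemma is_sos_mult_normsq_power:
  assumes "is_sos N p" "n \<le> N" shows "is_sos N (\<lambda>z. p z * (\<Sum>i<n. (z i)\<^sup>2) ^ r)"
proof (induction r)
  case (Suc r)
  let ?p = "\<lambda>z. p z * (\<Sum>i<n. (z i)\<^sup>2) ^ r"
  have "is_sos N (\<lambda>z. \<Sum>i<k. ?p z * (z i)\<^sup>2)" if "k \<le> n" for k
    using that
  proof (induction k)
    case (Suc k)
    then show ?case using is_sos_mult_square[OF \<open>is_sos N ?p\<close> is_poly_coord, of k] assms(2)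
      by (auto intro: is_sos_add)
  qed (simp add: is_sos_zero)
  from this[of n] show ?case by (simp add: sum_distrib_left[symmetric] sum_distrib_right[symmetric] mult_ac)
qed (use assms in simp)

text \<open>Multiplying by the squares of coordinates preserves sums of squares. This serves the
  binary quartics, which are settled at \<open>r = 0\<close>.\<close>

lemma r_sos_convex_mono:
  assumes "r_sos_convex n 0 f" shows "r_sos_convex n r f"
  using is_sos_mult_normsq_power[of "2 * n" _ n r] assms unfolding r_sos_convex_def by simp

section \<open>Bounds for iterated Laplacians\<close>

lemma sum_even_odd:
  fixes g :: "nat \<Rightarrow> 'a :: comm_monoid_add"
  shows "(\<Sum>j\<le>2*k. g j) = (\<Sum>i\<le>k. g (2*i)) + (\<Sum>i<k. g (2*i+1))"
  by (induction k) (simp_all add: ac_simps)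

lemma increasing_chain:
  fixes t :: "nat \<Rightarrow> real"
  assumes "\<And>j. Suc j < k \<Longrightarrow> t j < t (Suc j)"
  shows "i < j \<Longrightarrow> j < k \<Longrightarrow> t i < t j"
proof (induction j)
  case (Suc j)
  show ?case
  proof (cases "i = j")
    case False
    then have "t i < t j" using Suc by auto
    then show ?thesis using assms[of j] Suc.prems by simp
  qed (use assms[of j] Suc.prems in simp)
qed simp

text \<open>By Rolle, the zeros of the derivative between the sign changes together with the one at 0
  are too many.\<close>

lemma alternating_poly_coeff_1:
  fixes Q :: "real poly" and s :: "nat \<Rightarrow> real"
  assumes k: "k \<ge> 1" and deg: "degree Q \<le> k" and s0: "s 0 \<ge> 0"
    and inc: "\<And>j. j < k \<Longrightarrow> s j < s (Suc j)"
    and alt: "\<And>j. j \<le> k \<Longrightarrow> (-1) ^ j * poly Q (s j) > 0"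
  shows "coeff Q 1 \<noteq> 0"
proof
  assume c1: "coeff Q 1 = 0"
  have "\<exists>x. s j < x \<and> x < s (Suc j) \<and> poly Q x = 0" if "j < k" for j
  proof -
    have "(-1 :: real) ^ j = 1 \<or> (-1 :: real) ^ j = -1"
      by (metis neg_one_even_power neg_one_odd_power)
    then have "poly Q (s j) * poly Q (s (Suc j)) < 0"
      using that alt[of j] alt[of "Suc j"] by (auto simp: mult_less_0_iff)
    then show ?thesis using poly_IVT[OF inc[OF that]] by auto
  qed
  then obtain r where r: "\<And>j. j < k \<Longrightarrow> s j < r j \<and> r j < s (Suc j) \<and> poly Q (r j) = 0" by metis
  have "\<exists>x. r j < x \<and> x < r (Suc j) \<and> poly (pderiv Q) x = 0" if j: "Suc j < k" for j
  proof -
    have lt: "r j < r (Suc j)" using r[of j] r[of "Suc j"] j by force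
    from poly_MVT[OF lt, of Q] obtain x where "r j < x" "x < r (Suc j)"
      "poly Q (r (Suc j)) - poly Q (r j) = (r (Suc j) - r j) * poly (pderiv Q) x" by auto
    then show ?thesis using r[of j] r[of "Suc j"] j lt by (intro exI[of _ x]) auto
  qed
  then obtain x where x: "\<And>j. Suc j < k \<Longrightarrow> r j < x j \<and> x j < r (Suc j) \<and> poly (pderiv Q) (x j) = 0" by metis
  \<comment> \<open>The \<open>k\<close> zeros of \<open>Q\<close> give \<open>k - 1\<close> zeros
    of the derivative by Rolle. The additional zero at 0 lies below them because
    \<open>s 0 \<ge> 0\<close>; this makes \<open>k\<close>, one more than the degree of the
    derivative permits.\<close>
  define t where "t j = (case j of 0 \<Rightarrow> 0 | Suc i \<Rightarrow> x i)" for j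
  have "poly (pderiv Q) (t j) = 0" if "j < k" for j
  proof (cases j)
    case 0
    then show ?thesis using c1 by (simp add: t_def poly_0_coeff_0 coeff_pderiv)
  next
    case (Suc i)
    then show ?thesis using x[of i] that by (simp add: t_def)
  qed
  then have sub: "t ` {..<k} \<subseteq> {y. poly (pderiv Q) y = 0}" by auto
  have step: "t j < t (Suc j)" if "Suc j < k" for j
  proof (cases j)
    case 0
    then show ?thesis using x[of 0] r[of 0] s0 that by (auto simp: t_def)
  next
    case (Suc i)
    then show ?thesis using x[of i] x[of "Suc i"] that by (simp add: t_def)
  qed
  have "inj_on t {..<k}"
    by (rule linorder_inj_onI) (use increasing_chain[of k t, OF step] in force)+
  then have card: "card (t ` {..<k}) = k" by (simp add: card_image)
  have nz: "pderiv Q \<noteq> 0"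
  proof
    assume "pderiv Q = 0"
    then have "degree Q = 0" by (simp add: pderiv_eq_0_iff)
    then obtain a where "Q = [:a:]" by (rule degree_eq_zeroE)
    then show False using alt[of 0] alt[of 1] k by simp
  qed
  have "k \<le> card {y. poly (pderiv Q) y = 0}"
    using card_mono[OF poly_roots_finite[OF nz] sub] card by simp
  also have "\<dots> \<le> degree (pderiv Q)" by (rule card_poly_roots_bound[OF nz])
  also have "\<dots> < k" using deg k by (simp add: degree_pderiv)
  finally show False by simp
qed

text \<open>The extremal form at a = 1, b = t: taking real parts keeps the even powers, so it is a
  polynomial in the square of \<open>t\<close>.\<close>

lemma binomial_tan_poly:
  "(\<Sum>i\<le>k. (-1) ^ i * real (2 * k choose (2 * i)) * (t ^ 2) ^ i) = Re ((1 + \<i> * complex_of_real t) ^ (2 * k))"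
proof -
  have pw: "(\<i> * complex_of_real t) ^ (2*i) = complex_of_real ((-1) ^ i * (t ^ 2) ^ i)" for i
  proof -
    have "(\<i> * complex_of_real t) ^ 2 = complex_of_real ((-1) * t ^ 2)" by (simp add: power_mult_distrib)
    then have "(\<i> * complex_of_real t) ^ (2*i) = complex_of_real (((-1) * t ^ 2) ^ i)"
      by (simp only: power_mult of_real_power)
    then show ?thesis by (simp only: power_mult_distrib)
  qed
  have "(1 + \<i> * complex_of_real t) ^ (2 * k)
     = (\<Sum>j\<le>2*k. of_nat (2 * k choose j) * (\<i> * complex_of_real t) ^ j * 1 ^ (2 * k - j))"
    unfolding binomial_ring[symmetric] by (simp add: add.commute)
  also have "Re \<dots> = (\<Sum>j\<le>2*k. Re (of_nat (2 * k choose j) * (\<i> * complex_of_real t) ^ j))" by simp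
  also have "\<dots> = (\<Sum>i\<le>k. Re (of_nat (2 * k choose (2*i)) * (\<i> * complex_of_real t) ^ (2*i)))
     + (\<Sum>i<k. Re (of_nat (2 * k choose (2*i+1)) * (\<i> * complex_of_real t) ^ (2*i+1)))"
    by (rule sum_even_odd)
  also have "(\<Sum>i\<le>k. Re (of_nat (2 * k choose (2*i)) * (\<i> * complex_of_real t) ^ (2*i)))
     = (\<Sum>i\<le>k. (-1) ^ i * real (2 * k choose (2 * i)) * (t ^ 2) ^ i)"
  proof (intro sum.cong refl)
    fix i
    have "of_nat (2 * k choose (2*i)) * (\<i> * complex_of_real t) ^ (2*i)
       = complex_of_real (real (2 * k choose (2*i)) * ((-1) ^ i * (t ^ 2) ^ i))"
      unfolding pw by simp
    then show "Re (of_nat (2 * k choose (2*i)) * (\<i> * complex_of_real t) ^ (2*i))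
       = (-1) ^ i * real (2 * k choose (2 * i)) * (t ^ 2) ^ i"
      by (simp only: Re_complex_of_real mult_ac)
  qed
  also have "(\<Sum>i<k. Re (of_nat (2 * k choose (2*i+1)) * (\<i> * complex_of_real t) ^ (2*i+1))) = 0"
  proof (intro sum.neutral ballI)
    fix i
    have "(\<i> * complex_of_real t) ^ (2*i+1) = \<i> * complex_of_real ((-1) ^ i * (t ^ 2) ^ i * t)"
      by (simp only: power_add pw power_one_right) simp
    then have "of_nat (2 * k choose (2*i+1)) * (\<i> * complex_of_real t) ^ (2*i+1)
        = \<i> * complex_of_real (real (2 * k choose (2*i+1)) * ((-1) ^ i * (t ^ 2) ^ i * t))"
      by simp
    then show "Re (of_nat (2 * k choose (2*i+1)) * (\<i> * complex_of_real t) ^ (2*i+1)) = 0"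
      by (simp only: Re_i_times Im_complex_of_real)
  qed
  finally show ?thesis by simp
qed

text \<open>\<open>1 + \<i> * tan \<theta>\<close> is \<open>cis \<theta> / cos \<theta>\<close>, so
  de Moivre applies. It shows where the extremal form meets its bound: at the angles where the
  cosine is 1 or -1.\<close>

lemma Re_power_tan:
  assumes "cos \<theta> \<noteq> 0"
  shows "Re ((1 + \<i> * complex_of_real (tan \<theta>)) ^ (2 * k)) = (1 + tan \<theta> ^ 2) ^ k * cos (2 * real k * \<theta>)"
proof -
  have "1 + \<i> * complex_of_real (tan \<theta>) = cis \<theta> / complex_of_real (cos \<theta>)"
    using assms by (simp add: complex_eq_iff tan_def)
  then have "(1 + \<i> * complex_of_real (tan \<theta>)) ^ (2 * k) = cis (real (2 * k) * \<theta>) / complex_of_real (cos \<theta> ^ (2 * k))"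
    by (simp only: power_divide Complex.DeMoivre of_real_power)
  then have "Re ((1 + \<i> * complex_of_real (tan \<theta>)) ^ (2 * k)) = cos (2 * real k * \<theta>) / (cos \<theta> ^ 2) ^ k"
    by (simp add: Re_divide_of_real power_mult)
  also have "\<dots> = cos (2 * real k * \<theta>) * (inverse (cos \<theta> ^ 2)) ^ k"
    by (simp add: divide_inverse power_inverse)
  also have "inverse (cos \<theta> ^ 2) = 1 + tan \<theta> ^ 2"
    using tan_sec[OF assms] by (simp add: power_inverse)
  finally show ?thesis by (simp add: mult.commute)
qed

lemma two_choose_2: "real (2 * k choose 2) = real k * (2 * real k - 1)"
proof (cases k)
  case (Suc j)
  have "2 * k choose 2 = k * (2 * k - 1)" by (simp add: choose_two)
  then show ?thesis using Suc by (simp add: of_nat_diff algebra_simps)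
qed simp

text \<open>The extremal form is the real part of \<open>(a + \<i> b) ^ (2 * k)\<close>; a form with larger coefficient
  would, after scaling, differ from it by one that alternates at its extremal points.\<close>

lemma binary_form_coeff_2_lower:
  fixes c :: "nat \<Rightarrow> real"
  assumes k: "k \<ge> 1"
    and bnd: "\<And>a b. \<bar>\<Sum>j\<le>2*k. c j * a ^ (2*k - j) * b ^ j\<bar> \<le> (a\<^sup>2 + b\<^sup>2) ^ k"
  shows "- c 2 \<le> real k * (2 * real k - 1)"
proof (rule ccontr)
  define B where "B = real k * (2 * real k - 1)"
  have B: "B > 0" unfolding B_def using k by (intro mult_pos_pos) auto
  assume "\<not> ?thesis"
  then have "- c 2 > B" unfolding B_def by simp
  \<comment> \<open>Dividing by \<open>\<beta>\<close> gives the form the same second coefficient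
    \<open>- B\<close> as the extremal one, and makes its bound strict since
    \<open>\<beta> > 1\<close>.\<close>
  define \<beta> where "\<beta> = - c 2 / B"
  have \<beta>: "\<beta> > 1" unfolding \<beta>_def using \<open>- c 2 > B\<close> B by (simp add: field_simps)
  \<comment> \<open>The even part of the form: averaging over the sign of \<open>b\<close> keeps
    both the bound and the coefficient \<open>c 2\<close>.\<close>
  define P where "P x = (\<Sum>i\<le>k. c (2 * i) * x ^ i)" for x
  have Pb: "\<bar>P (t\<^sup>2)\<bar> \<le> (1 + t\<^sup>2) ^ k" for t
  proof -
    define \<phi> where "\<phi> t = (\<Sum>j\<le>2*k. c j * t ^ j)" for t
    have \<phi>: "\<bar>\<phi> t\<bar> \<le> (1 + t\<^sup>2) ^ k" for t using bnd[of 1 t] by (simp add: \<phi>_def)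
    have "\<phi> t + \<phi> (- t) = 2 * P (t\<^sup>2)"
      unfolding \<phi>_def P_def sum_even_odd by (simp add: power_mult sum_negf)
    then show ?thesis using \<phi>[of t] \<phi>[of "-t"] by simp
  qed
  have lead: "\<bar>c (2 * k)\<bar> \<le> 1"
  proof -
    have "(\<Sum>j\<le>2*k. c j * 0 ^ (2*k - j) * 1 ^ j) = (\<Sum>j\<le>2*k. if j = 2 * k then c j else 0)"
      by (intro sum.cong) auto
    then show ?thesis using bnd[of 0 1] by simp
  qed
  define q where "q i = (-1) ^ i * real (2 * k choose (2 * i)) - c (2 * i) / \<beta>" for i
  define Q where "Q = (\<Sum>i\<le>k. monom (q i) i)"
  have coeffQ: "coeff Q i = (if i \<le> k then q i else 0)" for i
    unfolding Q_def coeff_sum by (simp add: coeff_monom)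
  have degQ: "degree Q \<le> k" by (rule degree_le) (simp add: coeffQ)
  have polyQ: "poly Q (t\<^sup>2) = Re ((1 + \<i> * complex_of_real t) ^ (2 * k)) - P (t\<^sup>2) / \<beta>" for t
    unfolding Q_def poly_sum poly_monom q_def binomial_tan_poly[symmetric] P_def sum_divide_distrib
    by (simp add: left_diff_distrib sum_subtractf)
  have q1: "coeff Q 1 = 0"
    using k B \<open>- c 2 > B\<close> unfolding coeffQ q_def \<beta>_def by (auto simp add: two_choose_2 B_def[symmetric])
  \<comment> \<open>At these angles the cosine of \<open>2 * k * \<theta> j\<close> is
    \<open>(-1) ^ j\<close>. The index \<open>j = k\<close> would give a right angle, whose tangent
    is infinite; a large number \<open>X\<close> replaces it.\<close>
  define \<theta> where "\<theta> j = pi * real j / (2 * real k)" for j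
  have \<theta>: "0 \<le> \<theta> j" "\<theta> j < pi / 2" "cos (\<theta> j) > 0" if "j < k" for j
  proof -
    show 1: "0 \<le> \<theta> j" unfolding \<theta>_def by simp
    show 2: "\<theta> j < pi / 2" unfolding \<theta>_def using that by (simp add: field_simps)
    show "cos (\<theta> j) > 0" using 1 2 by (intro cos_gt_zero_pi) auto
  qed
  have altQ: "(-1) ^ j * poly Q ((tan (\<theta> j))\<^sup>2) > 0" if j: "j < k" for j
  proof -
    let ?N = "(1 + (tan (\<theta> j))\<^sup>2) ^ k"
    have N: "?N > 0" by (intro zero_less_power) (simp add: add_pos_nonneg)
    have "2 * real k * \<theta> j = real j * pi" unfolding \<theta>_def using k by simp
    then have "poly Q ((tan (\<theta> j))\<^sup>2) = ?N * (-1) ^ j - P ((tan (\<theta> j))\<^sup>2) / \<beta>"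
      unfolding polyQ using \<theta>(3)[OF j] by (subst Re_power_tan) auto
    then have "(-1) ^ j * poly Q ((tan (\<theta> j))\<^sup>2) = ?N - (-1) ^ j * P ((tan (\<theta> j))\<^sup>2) / \<beta>"
      by (cases "even j") auto
    moreover have "\<bar>(-1) ^ j * P ((tan (\<theta> j))\<^sup>2) / \<beta>\<bar> < ?N"
    proof -
      have "\<bar>(-1) ^ j * P ((tan (\<theta> j))\<^sup>2) / \<beta>\<bar> = \<bar>P ((tan (\<theta> j))\<^sup>2)\<bar> / \<beta>"
        using \<beta> by (simp add: abs_mult power_abs)
      also have "\<dots> \<le> ?N / \<beta>" using Pb \<beta> by (intro divide_right_mono) auto
      also have "\<dots> < ?N" using N \<beta> by (simp add: field_simps)
      finally show ?thesis .
    qed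
    ultimately show ?thesis by linarith
  qed
  \<comment> \<open>The alternation point at infinity: the leading coefficient of \<open>Q\<close>
    has the sign of \<open>(-1) ^ k\<close>, because
    \<open>\<bar>c (2 * k)\<bar> \<le> 1 < \<beta>\<close>.\<close>
  obtain X where X: "\<And>x. x \<ge> X \<Longrightarrow> (-1) ^ k * poly Q x > 0"
  proof -
    have "\<bar>c (2 * k) / \<beta>\<bar> < 1" using lead \<beta> by (simp add: field_simps)
    then have "c (2 * k) / \<beta> < 1" "-1 < c (2 * k) / \<beta>" by linarith+
    then have qk: "(-1) ^ k * q k > 0"
      unfolding q_def by (cases "even k") auto
    let ?R = "smult ((-1) ^ k) Q"
    have "coeff Q k \<noteq> 0" using qk by (auto simp: coeffQ)
    then have "degree Q = k" using degQ le_degree[of Q k] by simp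
    then have "lead_coeff ?R > 0" using qk by (simp add: coeffQ)
    from poly_pinfty_gt_lc[OF this] obtain X where "\<forall>x\<ge>X. lead_coeff ?R \<le> poly ?R x" by auto
    then show ?thesis using \<open>lead_coeff ?R > 0\<close> that[of X] by force
  qed
  define s where "s j = (if j < k then (tan (\<theta> j))\<^sup>2 else max X ((tan (\<theta> (k - 1)))\<^sup>2 + 1))" for j
  have "coeff Q 1 \<noteq> 0"
  proof (rule alternating_poly_coeff_1[OF k degQ, of s])
    show "s 0 \<ge> 0" using k by (simp add: s_def)
    show "s j < s (Suc j)" if "j < k" for j
    proof (cases "Suc j < k")
      case True
      have "\<theta> j < \<theta> (Suc j)" unfolding \<theta>_def using k by (simp add: field_simps)
      then have "tan (\<theta> j) < tan (\<theta> (Suc j))"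
        using \<theta>[of j] \<theta>[of "Suc j"] True by (intro tan_monotone) auto
      moreover have "0 \<le> tan (\<theta> j)"
        using \<theta>[of j] that by (cases "\<theta> j = 0") (auto intro!: less_imp_le tan_gt_zero)
      ultimately show ?thesis using True by (simp add: s_def power_strict_mono)
    next
      case False
      then have "j = k - 1" "Suc j = k" using that by auto
      then show ?thesis using that by (simp add: s_def less_max_iff_disj)
    qed
    show "(-1) ^ j * poly Q (s j) > 0" if "j \<le> k" for j
      using that altQ[of j] X[of "s k"] by (cases "j < k") (auto simp: s_def)
  qed
  then show False using q1 by simp
qed

text \<open>The one-sided bound is applied to both signs of \<open>c\<close>, divided by some
  \<open>N > M\<close>. Letting \<open>N\<close> approach \<open>M\<close> covers
  \<open>M = 0\<close>, where dividing by \<open>M\<close> is impossible.\<close>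

lemma binary_form_coeff_2_bound:
  fixes c :: "nat \<Rightarrow> real"
  assumes k: "k \<ge> 1"
    and bnd: "\<And>a b. \<bar>\<Sum>j\<le>2*k. c j * a ^ (2*k - j) * b ^ j\<bar> \<le> M * (a\<^sup>2 + b\<^sup>2) ^ k"
  shows "\<bar>c 2\<bar> \<le> M * (real k * (2 * real k - 1))"
proof -
  have "M \<ge> 0" using bnd[of 1 0] by simp
  have *: "- e * c 2 \<le> N * (real k * (2 * real k - 1))" if e: "\<bar>e\<bar> = 1" and N: "N > 0" "M \<le> N" for e N
  proof -
    have "\<bar>\<Sum>j\<le>2*k. (e * c j / N) * a ^ (2*k - j) * b ^ j\<bar> \<le> (a\<^sup>2 + b\<^sup>2) ^ k" for a b
    proof -
      have "(\<Sum>j\<le>2*k. (e * c j / N) * a ^ (2*k - j) * b ^ j) = (e / N) * (\<Sum>j\<le>2*k. c j * a ^ (2*k - j) * b ^ j)"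
        unfolding sum_distrib_left by (simp add: mult_ac)
      then have "\<bar>\<Sum>j\<le>2*k. (e * c j / N) * a ^ (2*k - j) * b ^ j\<bar>
          = \<bar>\<Sum>j\<le>2*k. c j * a ^ (2*k - j) * b ^ j\<bar> / N"
        using e N by (simp add: abs_mult)
      also have "\<dots> \<le> N * (a\<^sup>2 + b\<^sup>2) ^ k / N"
        using bnd[of a b] N by (intro divide_right_mono order_trans[OF bnd] mult_right_mono) auto
      finally show ?thesis using N by simp
    qed
    from binary_form_coeff_2_lower[OF k this] show ?thesis using N by (simp add: field_simps)
  qed
  have ub: "\<bar>c 2\<bar> \<le> N * (real k * (2 * real k - 1))" if "N > M" for N
    using *[of 1 N] *[of "-1" N] that \<open>M \<ge> 0\<close> by (auto simp: abs_le_iff)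
  define B where "B = real k * (2 * real k - 1)"
  have B: "B > 0" unfolding B_def using k by (intro mult_pos_pos) auto
  show ?thesis unfolding B_def[symmetric]
  proof (rule field_le_epsilon)
    fix e :: real assume e: "e > 0"
    have "\<bar>c 2\<bar> \<le> (M + e / B) * B"
      unfolding B_def by (rule ub) (use e B in \<open>simp add: B_def\<close>)
    then show "\<bar>c 2\<bar> \<le> M * B + e" using B by (simp add: distrib_right)
  qed
qed

section \<open>Restriction of forms to planes\<close>

lemma is_form_binary:
  assumes "is_form n d p"
  shows "\<exists>e. \<forall>a b. p (\<lambda>i. a * u i + b * v i) = (\<Sum>k\<le>d. e k * a ^ (d - k) * b ^ k)"
  using assms
proof (induction rule: is_form_induct)
  case (zero d)
  show ?case by (rule exI[of _ "\<lambda>_. 0"]) simp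
next
  case (const c)
  show ?case by (rule exI[of _ "\<lambda>_. c"]) simp
next
  case (add d p q)
  then obtain e e' where "\<And>a b. p (\<lambda>i. a * u i + b * v i) = (\<Sum>k\<le>d. e k * a ^ (d - k) * b ^ k)"
     "\<And>a b. q (\<lambda>i. a * u i + b * v i) = (\<Sum>k\<le>d. e' k * a ^ (d - k) * b ^ k)" by auto
  then show ?case by (intro exI[of _ "\<lambda>k. e k + e' k"]) (simp add: distrib_right sum.distrib)
next
  case (coord d p i)
  then obtain e where e: "\<And>a b. p (\<lambda>i. a * u i + b * v i) = (\<Sum>k\<le>d. e k * a ^ (d - k) * b ^ k)" by auto
  define e' where "e' k = (if k \<le> d then u i * e k else 0) + (if k \<ge> 1 then v i * e (k - 1) else 0)" for k
  have "(a * u i + b * v i) * p (\<lambda>i. a * u i + b * v i) = (\<Sum>k\<le>Suc d. e' k * a ^ (Suc d - k) * b ^ k)" for a b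
  proof -
    have 1: "(\<Sum>k\<le>Suc d. (if k \<le> d then u i * e k else 0) * a ^ (Suc d - k) * b ^ k)
       = a * u i * (\<Sum>k\<le>d. e k * a ^ (d - k) * b ^ k)"
      unfolding sum_distrib_left by (simp add: Suc_diff_le mult_ac)
    have 2: "(\<Sum>k\<le>Suc d. (if k \<ge> 1 then v i * e (k - 1) else 0) * a ^ (Suc d - k) * b ^ k)
       = b * v i * (\<Sum>k\<le>d. e k * a ^ (d - k) * b ^ k)"
      unfolding sum_distrib_left by (subst sum.atMost_Suc_shift) (simp add: mult_ac)
    show ?thesis unfolding e e'_def distrib_right sum.distrib 1 2 by simp
  qed
  then show ?case by blast
qed

lemma hess_quad_binary:
  assumes p: "is_poly n p" and d: "d \<ge> 2"
    and e: "\<And>a b. p (\<lambda>i. a * u i + b * v i) = (\<Sum>k\<le>d. e k * a ^ (d - k) * b ^ k)"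
  shows "hess_quad n p u v = 2 * e 2" "hess_quad n p v u = 2 * e (d - 2)"
proof -
  have "hess_quad n p u v = 2 * coeff (\<Sum>k\<le>d. monom (e k) k) 2"
    by (rule hess_quad_eq_coeff[OF p]) (use e[of 1] in \<open>simp add: poly_sum poly_monom\<close>)
  also have "coeff (\<Sum>k\<le>d. monom (e k) k) 2 = e 2" using d by (simp add: coeff_sum coeff_monom)
  finally show "hess_quad n p u v = 2 * e 2" .
  have "hess_quad n p v u = 2 * coeff (\<Sum>k\<le>d. monom (e k) (d - k)) 2"
    by (rule hess_quad_eq_coeff[OF p]) (use e[of _ 1] in \<open>simp add: poly_sum poly_monom add.commute\<close>)
  also have "coeff (\<Sum>k\<le>d. monom (e k) (d - k)) 2 = (\<Sum>k\<le>d. if k = d - 2 then e k else 0)"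
    unfolding coeff_sum coeff_monom using d by (intro sum.cong) auto
  finally show "hess_quad n p v u = 2 * e (d - 2)" by simp
qed

text \<open>Euler's identity twice, for the derivatives of \<open>p\<close> and for \<open>p\<close>
  itself.\<close>

lemma hess_quad_radial:
  assumes "is_form n d p"
  shows "hess_quad n p x x = real d * (real d - 1) * p x"
proof -
  have "hess_quad n p x x = (\<Sum>j<n. x j * (\<Sum>i<n. x i * partial i (partial j p) x))"
    unfolding hess_quad_def sum_distrib_left by (subst sum.swap) (simp add: mult_ac)
  also have "\<dots> = (\<Sum>j<n. x j * (real (d - 1) * partial j p x))"
    using euler_homogeneous[OF is_form_partial[OF assms]] by simp
  also have "\<dots> = real (d - 1) * (\<Sum>j<n. x j * partial j p x)"
    unfolding sum_distrib_left by (simp add: mult_ac)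
  also have "\<dots> = real (d - 1) * (real d * p x)" by (simp add: euler_homogeneous[OF assms])
  finally show ?thesis by (cases d) auto
qed

section \<open>Scaling to the sphere and orthonormal frames\<close>

lemma unit_vector_scaling:
  assumes "n \<ge> 1"
  obtains w where "w \<in> sphere_n n" "\<And>i. i < n \<Longrightarrow> x i = sqrt (normsq n x) * w i"
proof (cases "normsq n x = 0")
  case True
  \<comment> \<open>The zero vector is zero times any unit vector, here the first basis vector; this
    spares later uses a case distinction.\<close>
  have "(\<Sum>i<n. (if i = 0 then 1 else 0 :: real)\<^sup>2) = (\<Sum>i<n. if i = 0 then 1 else 0)"
    by (intro sum.cong) auto
  then have "(\<lambda>i. if i = 0 then 1 else 0) \<in> sphere_n n"
    using assms by (simp add: sphere_n_def)
  moreover have "x i = 0" if "i < n" for i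
    using True that unfolding normsq_def by (simp add: sum_nonneg_eq_0_iff)
  ultimately show ?thesis using that True by auto
next
  case False
  define c where "c = sqrt (normsq n x)"
  have "normsq n x \<ge> 0" unfolding normsq_def by (intro sum_nonneg) auto
  then have c: "c > 0" "c\<^sup>2 = normsq n x" using False unfolding c_def by auto
  define w where "w i = (if i < n then x i / c else 0)" for i
  have "(\<Sum>i<n. (w i)\<^sup>2) = normsq n x / c\<^sup>2"
    unfolding w_def normsq_def sum_divide_distrib by (intro sum.cong) (auto simp: power_divide)
  then have "w \<in> sphere_n n" using c False by (simp add: sphere_n_def w_def)
  then show ?thesis using that[of w] c by (auto simp: c_def[symmetric] w_def)
qed

lemma is_form_sphere_scaling:
  assumes "is_form n d p" "n \<ge> 1"
  obtains w where "w \<in> sphere_n n" "p x = sqrt (normsq n x) ^ d * p w"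
proof -
  obtain w where w: "w \<in> sphere_n n" "\<And>i. i < n \<Longrightarrow> x i = sqrt (normsq n x) * w i"
    using unit_vector_scaling[OF assms(2)] by blast
  have "p x = p (\<lambda>i. sqrt (normsq n x) * w i)"
    by (rule is_poly_cong_coords[OF is_form_is_poly[OF assms(1)] w(2)])
  also have "\<dots> = sqrt (normsq n x) ^ d * p w" by (rule is_form_homogeneous[OF assms(1)])
  finally show ?thesis using that w(1) by blast
qed

lemma normsq_nonneg: "normsq n x \<ge> 0"
  unfolding normsq_def by (intro sum_nonneg) auto

lemma is_form_nonneg:
  assumes "is_form n d p" "n \<ge> 1" "\<And>w. w \<in> sphere_n n \<Longrightarrow> p w \<ge> 0"
  shows "p x \<ge> 0"
proof -
  obtain w where "w \<in> sphere_n n" "p x = sqrt (normsq n x) ^ d * p w"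
    using is_form_sphere_scaling[OF assms(1,2)] by blast
  then show ?thesis using assms(3) normsq_nonneg[of n x] by simp
qed

lemma is_form_even_bound:
  assumes "is_form n (2 * k) p" "n \<ge> 1" "\<And>w. w \<in> sphere_n n \<Longrightarrow> \<bar>p w\<bar> \<le> M"
  shows "\<bar>p x\<bar> \<le> M * normsq n x ^ k"
proof -
  obtain w where w: "w \<in> sphere_n n" "p x = sqrt (normsq n x) ^ (2 * k) * p w"
    using is_form_sphere_scaling[OF assms(1,2)] by blast
  have "sqrt (normsq n x) ^ (2 * k) = normsq n x ^ k" using normsq_nonneg[of n x] by (simp add: power_mult)
  then show ?thesis using w assms(3)[OF w(1)] normsq_nonneg[of n x]
    by (simp add: abs_mult mult.commute mult_right_mono)
qed

text \<open>Householder reflection exchanging \<open>u\<close> with the first basis vector; for \<open>N = 0\<close> it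
  degenerates to the identity because division by zero gives zero.\<close>

lemma orthonormal_basis:
  assumes n: "n \<ge> 1" and u: "u \<in> sphere_n n"
  obtains R where "R 0 = u" "\<And>k. k < n \<Longrightarrow> R k \<in> sphere_n n"
    "\<And>k. 0 < k \<Longrightarrow> k < n \<Longrightarrow> dot n u (R k) = 0"
    "\<And>i j. i < n \<Longrightarrow> j < n \<Longrightarrow> (\<Sum>k<n. R k i * R k j) = (if i = j then 1 else 0)"
proof -
  define \<delta> :: "nat \<Rightarrow> nat \<Rightarrow> real" where "\<delta> i j = (if i = j then 1 else 0)" for i j
  have \<delta>s: "(\<Sum>k<n. \<delta> k i * g k) = g i" "(\<Sum>k<n. g k * \<delta> k i) = g i" if "i < n" for g i
    using that unfolding \<delta>_def by (simp_all add: if_distrib if_distribR cong: if_cong)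
  have \<delta>sym: "\<delta> i j = \<delta> j i" for i j by (simp add: \<delta>_def)
  define a where "a i = (if i < n then u i - \<delta> i 0 else 0)" for i
  define N where "N = (\<Sum>i<n. (a i)\<^sup>2)"
  define c where "c = 2 / N"
  define R where "R k i = (if i < n then \<delta> k i - c * a k * a i else 0)" for k i
  have uu: "(\<Sum>i<n. (u i)\<^sup>2) = 1" "\<And>i. n \<le> i \<Longrightarrow> u i = 0" using u by (auto simp: sphere_n_def)
  have ai: "a i = u i - \<delta> i 0" for i using n uu(2)[of i] unfolding a_def \<delta>_def by auto
  have "N = (\<Sum>i<n. (u i)\<^sup>2) - 2 * (\<Sum>i<n. u i * \<delta> i 0) + (\<Sum>i<n. \<delta> i 0 * \<delta> i 0)"
    unfolding N_def ai sum_distrib_left sum.distrib[symmetric] sum_subtractf[symmetric]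
    by (intro sum.cong) (auto simp: power2_eq_square algebra_simps)
  also have "\<dots> = 1 - 2 * u 0 + 1" using n by (simp only: uu(1) \<delta>s) (simp add: \<delta>_def)
  finally have N: "N = - 2 * a 0" using n by (simp add: ai \<delta>_def)
  have cN: "c * c * N = 2 * c" unfolding c_def by simp
  have orth: "(\<Sum>k<n. R k i * R k j) = \<delta> i j" if "i < n" "j < n" for i j
  proof -
    have "(\<Sum>k<n. R k i * R k j)
       = (\<Sum>k<n. \<delta> k i * \<delta> k j) - c * a j * (\<Sum>k<n. \<delta> k i * a k) - c * a i * (\<Sum>k<n. \<delta> k j * a k)
         + c * c * a i * a j * (\<Sum>k<n. (a k)\<^sup>2)"
      unfolding sum_distrib_left sum.distrib[symmetric] sum_subtractf[symmetric]
      using that by (intro sum.cong) (auto simp: R_def power2_eq_square algebra_simps)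
    also have "\<dots> = \<delta> i j - c * a j * a i - c * a i * a j + (c * c * N) * a i * a j"
      unfolding \<delta>s[OF that(1)] \<delta>s[OF that(2)] N_def by simp
    finally show ?thesis unfolding cN by simp
  qed
  have Rsym: "R k i = R i k" if "k < n" "i < n" for k i
    using that by (simp add: R_def \<delta>sym mult_ac)
  have orth': "(\<Sum>i<n. R k i * R l i) = \<delta> k l" if "k < n" "l < n" for k l
    using orth[OF that] that by (simp add: Rsym)
  have R0: "R 0 = u"
  proof
    fix i
    have "- c * a 0 * a i = a i"
    proof (cases "N = 0")
      case True
      then have "a i = 0" unfolding N_def by (cases "i < n") (auto simp: sum_nonneg_eq_0_iff a_def)
      then show ?thesis by simp
    next
      case False
      then have "- c * a 0 = 1" unfolding c_def using N by (simp add: field_simps)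
      then show ?thesis by simp
    qed
    then show "R 0 i = u i" using uu(2)[of i] unfolding R_def by (auto simp: ai \<delta>sym[of i 0])
  qed
  show ?thesis
  proof (rule that[of R])
    show "R 0 = u" by (rule R0)
    show "R k \<in> sphere_n n" if "k < n" for k
      using orth'[OF that that] unfolding sphere_n_def by (simp add: R_def \<delta>_def power2_eq_square)
    show "dot n u (R k) = 0" if "0 < k" "k < n" for k
      using orth'[of 0 k] that n unfolding R0[symmetric] dot_def by (simp add: \<delta>_def)
    show "(\<Sum>k<n. R k i * R k j) = (if i = j then 1 else 0)" if "i < n" "j < n" for i j
      using orth[OF that] unfolding \<delta>_def .
  qed
qed

section \<open>Second derivatives and Laplacians on the sphere\<close>

lemma lap_orthonormal:
  assumes "\<And>i j. i < n \<Longrightarrow> j < n \<Longrightarrow> (\<Sum>k<n. R k i * R k j) = (if i = j then 1 else 0)"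
  shows "lap n p x = (\<Sum>k<n. hess_quad n p x (R k))"
proof -
  have "(\<Sum>k<n. hess_quad n p x (R k)) = (\<Sum>i<n. \<Sum>k<n. \<Sum>j<n. R k i * R k j * partial i (partial j p) x)"
    unfolding hess_quad_def by (rule sum.swap)
  also have "\<dots> = (\<Sum>i<n. \<Sum>j<n. (\<Sum>k<n. R k i * R k j) * partial i (partial j p) x)"
    unfolding sum_distrib_right by (intro sum.cong refl sum.swap)
  also have "\<dots> = (\<Sum>i<n. \<Sum>j<n. if i = j then partial i (partial j p) x else 0)"
    using assms by (intro sum.cong) auto
  finally show ?thesis unfolding lap_def by simp
qed

lemma normsq_orthonormal:
  assumes "u \<in> sphere_n n" "v \<in> sphere_n n" "dot n u v = 0"
  shows "normsq n (\<lambda>i. a * u i + b * v i) = a\<^sup>2 + b\<^sup>2"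
proof -
  have "normsq n (\<lambda>i. a * u i + b * v i)
     = a\<^sup>2 * (\<Sum>i<n. (u i)\<^sup>2) + b\<^sup>2 * (\<Sum>i<n. (v i)\<^sup>2) + 2 * a * b * dot n u v"
    unfolding normsq_def dot_def sum_distrib_left sum.distrib[symmetric]
    by (intro sum.cong) (auto simp: power2_eq_square algebra_simps)
  then show ?thesis using assms by (simp add: sphere_n_def)
qed

text \<open>In the plane of \<open>u\<close> and \<open>v\<close> the form is a binary form
  dominated by \<open>M\<close> times a power of the squared norm, so the sharp coefficient bound
  applies. It yields the same constant as the radial direction.\<close>

lemma hess_quad_orthogonal_bound:
  assumes p: "is_form n (2 * k) p" and k: "k \<ge> 1" and n: "n \<ge> 1"
    and uv: "u \<in> sphere_n n" "v \<in> sphere_n n" "dot n u v = 0"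
    and M: "\<And>w. w \<in> sphere_n n \<Longrightarrow> \<bar>p w\<bar> \<le> M"
  shows "\<bar>hess_quad n p u v\<bar> \<le> real (2 * k) * (real (2 * k) - 1) * M"
proof -
  obtain e where e: "\<And>a b. p (\<lambda>i. a * u i + b * v i) = (\<Sum>j\<le>2*k. e j * a ^ (2*k - j) * b ^ j)"
    using is_form_binary[OF p] by blast
  have "\<bar>\<Sum>j\<le>2*k. e j * a ^ (2*k - j) * b ^ j\<bar> \<le> M * (a\<^sup>2 + b\<^sup>2) ^ k" for a b
    using is_form_even_bound[OF p n M, of "\<lambda>i. a * u i + b * v i"]
    unfolding e normsq_orthonormal[OF uv] by simp
  from binary_form_coeff_2_bound[OF k this] have "\<bar>e 2\<bar> \<le> M * (real k * (2 * real k - 1))" .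
  moreover have "hess_quad n p u v = 2 * e 2"
    using k by (intro hess_quad_binary(1)[OF is_form_is_poly[OF p] _ e]) simp
  ultimately show ?thesis by (simp add: abs_mult algebra_simps)
qed

text \<open>In a frame starting with \<open>u\<close> the trace has one radial term, given by
  Euler's identity, and \<open>n - 1\<close> orthogonal ones, all with the same bound.\<close>

lemma lap_bound:
  assumes p: "is_form n (2 * k) p" and k: "k \<ge> 1" and n: "n \<ge> 1" and u: "u \<in> sphere_n n"
    and M: "\<And>w. w \<in> sphere_n n \<Longrightarrow> \<bar>p w\<bar> \<le> M"
  shows "\<bar>lap n p u\<bar> \<le> real n * (real (2 * k) * (real (2 * k) - 1)) * M"
proof -
  obtain R where R: "R 0 = u" "\<And>k. k < n \<Longrightarrow> R k \<in> sphere_n n"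
    "\<And>k. 0 < k \<Longrightarrow> k < n \<Longrightarrow> dot n u (R k) = 0"
    "\<And>i j. i < n \<Longrightarrow> j < n \<Longrightarrow> (\<Sum>k<n. R k i * R k j) = (if i = j then 1 else 0)"
    using orthonormal_basis[OF n u] by blast
  let ?B = "real (2 * k) * (real (2 * k) - 1) * M"
  have "\<bar>hess_quad n p u (R l)\<bar> \<le> ?B" if "l < n" for l
  proof (cases "l = 0")
    case True
    have "real (2 * k) * (real (2 * k) - 1) \<ge> 0" using k by simp
    then have "real (2 * k) * (real (2 * k) - 1) * \<bar>p u\<bar> \<le> ?B"
      using M[OF u] by (intro mult_left_mono) auto
    moreover have "\<bar>real (2 * k) * (real (2 * k) - 1) * p u\<bar> = real (2 * k) * (real (2 * k) - 1) * \<bar>p u\<bar>"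
      using \<open>real (2 * k) * (real (2 * k) - 1) \<ge> 0\<close> by (simp only: abs_mult[of "_ * _"] abs_of_nonneg)
    ultimately show ?thesis unfolding True R(1) hess_quad_radial[OF p] by linarith
  next
    case False
    then show ?thesis using that R by (intro hess_quad_orthogonal_bound[OF p k n u _ _ M]) auto
  qed
  then have "\<bar>\<Sum>l<n. hess_quad n p u (R l)\<bar> \<le> (\<Sum>l<n. ?B)"
    by (intro order_trans[OF sum_abs] sum_mono) auto
  moreover have "lap n p u = (\<Sum>l<n. hess_quad n p u (R l))" by (rule lap_orthonormal) (rule R(4))
  ultimately show ?thesis by (simp add: mult_ac)
qed

text \<open>Each Laplacian lowers the degree, so the constant for degree \<open>2 * k\<close> bounds
  every step; once the degree is exhausted the power of the Laplacian is zero.\<close>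

lemma lap_pow_bound:
  assumes p: "is_form n (2 * k) p" and n: "n \<ge> 1"
    and M: "\<And>w. w \<in> sphere_n n \<Longrightarrow> \<bar>p w\<bar> \<le> M"
  shows "u \<in> sphere_n n \<Longrightarrow> \<bar>(lap n ^^ j) p u\<bar> \<le> (real n * (real (2 * k) * (real (2 * k) - 1))) ^ j * M"
proof (induction j arbitrary: u)
  case 0
  then show ?case using M by simp
next
  case (Suc j)
  let ?c = "real n * (real (2 * k) * (real (2 * k) - 1))"
  have M0: "M \<ge> 0" using M[OF Suc.prems] by linarith
  show ?case
  proof (cases "j < k")
    case True
    have c: "?c \<ge> 0" using True by (intro mult_nonneg_nonneg) auto
    define l where "l = k - j"
    have f: "is_form n (2 * l) ((lap n ^^ j) p)"
      using is_form_lap_pow[OF p, of j] by (simp add: l_def right_diff_distrib')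
    have "\<bar>lap n ((lap n ^^ j) p) u\<bar> \<le> real n * (real (2 * l) * (real (2 * l) - 1)) * (?c ^ j * M)"
      using True by (intro lap_bound[OF f _ n Suc.prems Suc.IH]) (simp add: l_def)
    also have "\<dots> \<le> ?c * (?c ^ j * M)"
      using True c M0 by (intro mult_right_mono mult_left_mono mult_mono) (auto simp: l_def)
    finally show ?thesis by (simp add: mult.assoc)
  next
    case False
    then have z: "(lap n ^^ Suc j) p = (\<lambda>x. 0)" by (intro lap_pow_eq_0[OF p]) simp
    have "?c \<ge> 0" by (cases k) auto
    then show ?thesis unfolding z using M0 by (simp del: power_Suc)
  qed
qed

section \<open>Nonnegativity of the kernel\<close>

lemma is_form_kappa:
  assumes "is_form n m q" shows "is_form n m (kappa n m r q)"
  unfolding kappa_def[abs_def]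
proof (intro is_form_sum is_form_cmult)
  fix j assume "j \<in> {..m div 2}"
  then have "m - 2 * j + 2 * j = m" by auto
  then show "is_form n m (\<lambda>u. normsq n u ^ j * (lap n ^^ j) q u)"
    using is_form_normsq_power_mult[OF is_form_lap_pow[OF assms, of j], of j] by simp
qed

lemma kappa_cmult:
  assumes "is_poly n q"
  shows "kappa n m r (\<lambda>x. c * q x) u = c * kappa n m r q u"
  unfolding kappa_def lap_pow_cmult[OF assms] by (simp add: sum_distrib_left mult_ac)

text \<open>On the sphere the term \<open>j = 0\<close> is \<open>p u\<close>, at least
  \<open>\<mu>\<close>. The others are dominated by \<open>M\<close> times the tail of the
  exponential series, which \<open>ex\<close> bounds by \<open>\<mu> / M\<close>.\<close>

lemma kappa_nonneg_if_exp_bound: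
  fixes D :: real
  assumes p: "is_form n (2 * k) p" and n: "n \<ge> 1"
    and lo: "\<And>w. w \<in> sphere_n n \<Longrightarrow> \<mu> \<le> p w" and hi: "\<And>w. w \<in> sphere_n n \<Longrightarrow> p w \<le> M"
    and \<mu>: "\<mu> > 0"
    and D: "D = real r + (real n + real (2 * k)) / 2"
    and ex: "exp (real n * (real (2 * k) * (real (2 * k) - 1)) / (4 * D)) \<le> 1 + \<mu> / M"
  shows "kappa n (2 * k) r p u \<ge> 0"
proof (rule is_form_nonneg[OF is_form_kappa[OF p] n])
  fix u assume u: "u \<in> sphere_n n"
  let ?c = "real n * (real (2 * k) * (real (2 * k) - 1))"
  define y where "y = ?c / (4 * D)"
  have M: "M > 0" using lo[OF u] hi[OF u] \<mu> by simp
  have D0: "D > 0" unfolding D using n by (intro add_nonneg_pos divide_pos_pos add_pos_nonneg) auto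
  have c0: "?c \<ge> 0" by (cases k) auto
  have y0: "y \<ge> 0" unfolding y_def using c0 D0 by simp
  define b where "b j = (\<Prod>i<j. real n + 2 * real (2 * k) + 2 * real r - 2 * real j + 2 * real i)" for j
  define T where "T j = (-1) ^ j / (2 ^ j * fact j * b j) * (normsq n u ^ j * (lap n ^^ j) p u)" for j
  have nu: "normsq n u = 1" using u by (simp add: normsq_def sphere_n_def)
  have T: "\<bar>T j\<bar> \<le> M * (y ^ j / fact j)" if "j \<le> k" for j
  proof -
    \<comment> \<open>From \<open>j \<le> k\<close> each factor is at least n + 2 k + 2 r, which is
      \<open>2 * D\<close>.\<close>
    have "b j \<ge> (\<Prod>i<j. 2 * D)"
      unfolding b_def using that n by (intro prod_mono) (auto simp: D)
    then have bj: "b j \<ge> (2 * D) ^ j" by simp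
    have DD: "(2 * D) ^ j > 0" using D0 by simp
    have "\<bar>T j\<bar> = \<bar>(lap n ^^ j) p u\<bar> / (2 ^ j * fact j * b j)"
      unfolding T_def nu using bj DD by (simp add: abs_mult power_abs)
    also have "\<dots> \<le> (?c ^ j * M) / (2 ^ j * fact j * (2 * D) ^ j)"
    proof (rule frac_le)
      show "\<bar>(lap n ^^ j) p u\<bar> \<le> ?c ^ j * M"
      proof (rule lap_pow_bound[OF p n _ u])
        fix w assume "w \<in> sphere_n n"
        then show "\<bar>p w\<bar> \<le> M" using lo[of w] hi[of w] \<mu> by linarith
      qed
      show "2 ^ j * fact j * (2 * D) ^ j \<le> 2 ^ j * fact j * b j"
        using bj by (intro mult_left_mono) auto
      show "0 \<le> ?c ^ j * M" by (rule mult_nonneg_nonneg[OF zero_le_power[OF c0] less_imp_le[OF M]])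
      show "0 < 2 ^ j * fact j * (2 * D) ^ j" using DD by (intro mult_pos_pos) simp_all
    qed
    also have "\<dots> = M * (y ^ j / fact j)"
    proof -
      have "(4 * D) ^ j = 2 ^ j * (2 * D) ^ j" by (subst power_mult_distrib[symmetric]) simp
      then have "y ^ j = ?c ^ j / (2 ^ j * (2 * D) ^ j)" unfolding y_def by (simp only: power_divide)
      then show ?thesis by (simp only: times_divide_eq_right divide_divide_eq_left mult_ac)
    qed
    finally show ?thesis .
  qed
  have "kappa n (2 * k) r p u = (\<Sum>j\<le>k. T j)"
    unfolding kappa_def T_def b_def by simp
  also have "\<dots> = T 0 + (\<Sum>j=1..k. T j)"
  proof -
    have "{..k} = insert 0 {1..k}" by auto
    then show ?thesis by simp
  qed
  also have "T 0 = p u" unfolding T_def b_def by simp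
  finally have K: "kappa n (2 * k) r p u = p u + (\<Sum>j=1..k. T j)" .
  have "\<bar>\<Sum>j=1..k. T j\<bar> \<le> (\<Sum>j=1..k. M * (y ^ j / fact j))"
    by (intro order_trans[OF sum_abs] sum_mono T) auto
  also have "\<dots> = M * (\<Sum>j=1..k. y ^ j / fact j)" by (simp add: sum_distrib_left)
  also have "(\<Sum>j=1..k. y ^ j / fact j) \<le> exp y - 1"
  proof -
    have "(\<Sum>j\<in>insert 0 {1..k}. y ^ j /\<^sub>R fact j) \<le> (\<Sum>j. y ^ j /\<^sub>R fact j)"
      using y0 by (intro sum_le_suminf summable_exp_generic) auto
    then show ?thesis by (simp add: exp_def divide_inverse mult.commute)
  qed
  also have "exp y - 1 \<le> \<mu> / M" using ex unfolding y_def by simp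
  finally have "\<bar>\<Sum>j=1..k. T j\<bar> \<le> \<mu>" using M by (simp add: mult_left_mono)
  then show "kappa n (2 * k) r p u \<ge> 0" unfolding K using lo[OF u] by linarith
qed

section \<open>Degree at least six\<close>

text \<open>The ambient space is a product of infinitely many lines; the sphere is a closed subset
  of a cube that is compact by Tychonoff.\<close>

lemma compact_sphere_n: "compact (sphere_n n)"
proof -
  have "compactin (product_topology (\<lambda>i::nat. euclidean :: real topology) UNIV) (PiE UNIV (\<lambda>i. {-1..1}))"
    by (subst compactin_PiE) auto
  then have box: "compact (PiE UNIV (\<lambda>i::nat. {-1..1 :: real}))"
    by (simp add: euclidean_product_topology)
  have "closed {x :: nat \<Rightarrow> real. (\<forall>i. n \<le> i \<longrightarrow> x i = 0) \<and> (\<Sum>i<n. (x i)^2) = 1}"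
    by (intro closed_Collect_conj closed_Collect_all closed_Collect_imp open_Collect_const closed_Collect_eq
      continuous_intros continuous_on_product_coordinates)
  then have cl: "closed (sphere_n n)" by (simp add: sphere_n_def)
  have "sphere_n n \<subseteq> PiE UNIV (\<lambda>i::nat. {-1..1 :: real})"
  proof
    fix x assume x: "x \<in> sphere_n n"
    have "\<bar>x i\<bar> \<le> 1" for i
    proof (cases "i < n")
      case True
      have "(x i)\<^sup>2 \<le> (\<Sum>i<n. (x i)\<^sup>2)" using True by (intro member_le_sum) auto
      then have "(x i)\<^sup>2 \<le> 1" using x by (simp add: sphere_n_def)
      then show ?thesis by (simp add: abs_square_le_1)
    next
      case False
      then show ?thesis using x by (simp add: sphere_n_def)
    qed
    then show "x \<in> PiE UNIV (\<lambda>i::nat. {-1..1 :: real})" by (auto simp: abs_le_iff minus_le_iff)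
  qed
  then have "sphere_n n = PiE UNIV (\<lambda>i::nat. {-1..1 :: real}) \<inter> sphere_n n" by blast
  then show ?thesis using compact_Int_closed[OF box cl] by metis
qed

lemma sphere_n_nonempty: "n \<ge> 1 \<Longrightarrow> sphere_n n \<noteq> {}"
  using unit_vector_scaling[of n] by blast

lemma continuous_hess_quad:
  assumes "is_poly n f"
  shows "continuous_on S (\<lambda>p. hess_quad n f (fst p) (snd p))"
proof -
  have "continuous_on S (\<lambda>p :: (nat \<Rightarrow> real) \<times> (nat \<Rightarrow> real). snd p i)" for i
    by (rule continuous_on_compose2[of UNIV "\<lambda>x. x i"]) (auto intro: continuous_intros)
  moreover have "continuous_on S (\<lambda>p. partial i (partial j f) (fst p))" for i j
    by (rule continuous_on_compose2[OF continuous_on_is_poly[OF is_poly_partial[OF is_poly_partial[OF assms]], of UNIV]])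
       (auto intro: continuous_intros)
  ultimately show ?thesis unfolding hess_quad_def by (intro continuous_on_sum continuous_on_mult)
qed

text \<open>Compactness makes the infimum an attained value, so strict positivity passes to it, and
  makes the set bounded, so \<open>Inf\<close> and \<open>Sup\<close> are genuine bounds.\<close>

lemma hess_values_bounds:
  assumes f: "is_poly n f" and n: "n \<ge> 1"
    and pos: "\<And>x y. x \<in> sphere_n n \<Longrightarrow> y \<in> sphere_n n \<Longrightarrow> hess_quad n f x y > 0"
  shows "Inf (hess_values n f) > 0"
    and "x \<in> sphere_n n \<Longrightarrow> y \<in> sphere_n n \<Longrightarrow> Inf (hess_values n f) \<le> hess_quad n f x y"
    and "x \<in> sphere_n n \<Longrightarrow> y \<in> sphere_n n \<Longrightarrow> hess_quad n f x y \<le> Sup (hess_values n f)"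
proof -
  have img: "hess_values n f = (\<lambda>p. hess_quad n f (fst p) (snd p)) ` (sphere_n n \<times> sphere_n n)"
    by (force simp: hess_values_def)
  have cpt: "compact (hess_values n f)"
    unfolding img by (intro compact_continuous_image continuous_hess_quad[OF f] compact_Times compact_sphere_n)
  have ne: "hess_values n f \<noteq> {}" unfolding img using sphere_n_nonempty[OF n] by simp
  obtain m where m: "m \<in> hess_values n f" "\<And>t. t \<in> hess_values n f \<Longrightarrow> m \<le> t"
    using compact_attains_inf[OF cpt ne] by blast
  then have "Inf (hess_values n f) = m" by (intro cInf_eq_minimum) auto
  then show "Inf (hess_values n f) > 0" using m(1) pos by (auto simp: hess_values_def)
  have bdd: "bdd_below (hess_values n f)" "bdd_above (hess_values n f)"
    using compact_imp_bounded[OF cpt] by (simp_all add: bounded_imp_bdd_below bounded_imp_bdd_above)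
  show "Inf (hess_values n f) \<le> hess_quad n f x y" if "x \<in> sphere_n n" "y \<in> sphere_n n"
    using that by (intro cInf_lower bdd) (auto simp: hess_values_def)
  show "hess_quad n f x y \<le> Sup (hess_values n f)" if "x \<in> sphere_n n" "y \<in> sphere_n n"
    using that by (intro cSup_upper bdd) (auto simp: hess_values_def)
qed

text \<open>A zero at a minimum is double: the one-sided limits of \<open>poly p t / t\<close> have
  opposite signs, so the linear coefficient vanishes, and what remains after dividing by the square
  of \<open>t\<close> is nonnegative.\<close>

lemma poly_nonneg_coeff_2:
  fixes p :: "real poly"
  assumes nn: "\<And>t. poly p t \<ge> 0" and p0: "poly p 0 = 0"
  shows "coeff p 2 \<ge> 0"
proof -
  have lim: "(poly q \<longlongrightarrow> poly q 0) (at 0 within S)" for q :: "real poly" and S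
    by (intro tendsto_intros)
  obtain p1 where p1: "p = pCons 0 p1"
    using p0 by (cases p) auto
  have p1t: "t > 0 \<Longrightarrow> poly p1 t \<ge> 0" "t < 0 \<Longrightarrow> poly p1 t \<le> 0" for t
    using nn[of t] by (simp_all add: p1 zero_le_mult_iff)
  have "0 \<le> poly p1 0"
    by (rule tendsto_lowerbound[OF lim[of p1 "{0<..}"]]) (simp_all add: eventually_at_filter p1t)
  moreover have "poly p1 0 \<le> 0"
    by (rule tendsto_upperbound[OF lim[of p1 "{..<0}"]]) (simp_all add: eventually_at_filter p1t)
  ultimately obtain p2 where p2: "p1 = pCons 0 p2" by (cases p1) auto
  have "poly p2 t \<ge> 0" if "t \<noteq> 0" for t
  proof -
    have "0 \<le> t\<^sup>2 * poly p2 t" using nn[of t] by (simp add: p1 p2 power2_eq_square mult.assoc)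
    then show ?thesis using that by (simp add: zero_le_mult_iff)
  qed
  then have "0 \<le> poly p2 0"
    by (intro tendsto_lowerbound[OF lim[of p2 "{0<..}"]]) (auto simp: eventually_at_filter)
  then show ?thesis by (simp add: p1 p2 poly_0_coeff_0 numeral_2_eq_2)
qed

lemma coeff_one_plus_square_power:
  "coeff ([:1, 0, 1 :: real:] ^ k) 0 = 1" "coeff ([:1, 0, 1 :: real:] ^ k) 2 = real k"
  by (induction k) (simp_all add: coeff_pCons numeral_2_eq_2 split: nat.splits)

text \<open>Second-order condition for \<open>f\<close> at a maximum point of \<open>f\<close> on the sphere.\<close>

lemma hess_pinching:
  assumes f: "is_form n (2 * k) f" and k: "k \<ge> 1" and n: "n \<ge> 2"
    and lo: "\<And>x y. x \<in> sphere_n n \<Longrightarrow> y \<in> sphere_n n \<Longrightarrow> \<mu> \<le> hess_quad n f x y"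
    and hi: "\<And>x y. x \<in> sphere_n n \<Longrightarrow> y \<in> sphere_n n \<Longrightarrow> hess_quad n f x y \<le> M"
  shows "(real (2 * k) - 1) * \<mu> \<le> M"
proof -
  have n1: "n \<ge> 1" using n by simp
  note fp = is_form_is_poly[OF f]
  obtain u where u: "u \<in> sphere_n n" "\<And>x. x \<in> sphere_n n \<Longrightarrow> f x \<le> f u"
    using continuous_attains_sup[OF compact_sphere_n sphere_n_nonempty[OF n1] continuous_on_is_poly[OF fp]] by blast
  obtain R where R: "R 0 = u" "\<And>k. k < n \<Longrightarrow> R k \<in> sphere_n n"
    "\<And>k. 0 < k \<Longrightarrow> k < n \<Longrightarrow> dot n u (R k) = 0"
    using orthonormal_basis[OF n1 u(1)] by blast
  define v where "v = R 1"
  have v: "v \<in> sphere_n n" "dot n u v = 0" using R n by (auto simp: v_def)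
  obtain e where e: "\<And>a b. f (\<lambda>i. a * u i + b * v i) = (\<Sum>j\<le>2*k. e j * a ^ (2*k - j) * b ^ j)"
    using is_form_binary[OF f] by blast
  \<comment> \<open>The maximum property in homogeneous form: \<open>f u\<close> times the
    \<open>k\<close>-th power of the squared norm dominates \<open>f\<close>, with equality at
    \<open>t = 0\<close>.\<close>
  define q where "q = smult (f u) ([:1, 0, 1:] ^ k) - (\<Sum>j\<le>2*k. monom (e j) j)"
  have q: "poly q t = f u * (1 + t\<^sup>2) ^ k - f (\<lambda>i. 1 * u i + t * v i)" for t
    unfolding e q_def by (simp add: poly_sum poly_monom power2_eq_square)
  have "coeff q 2 \<ge> 0"
  proof (rule poly_nonneg_coeff_2)
    show "poly q 0 = 0" unfolding q by simp
    fix t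
    obtain w where w: "w \<in> sphere_n n"
      "f (\<lambda>i. 1 * u i + t * v i) = sqrt (normsq n (\<lambda>i. 1 * u i + t * v i)) ^ (2 * k) * f w"
      using is_form_sphere_scaling[OF f n1] by blast
    have "f (\<lambda>i. 1 * u i + t * v i) = (1 + t\<^sup>2) ^ k * f w"
      unfolding w(2) normsq_orthonormal[OF u(1) v] by (simp add: power_mult add_nonneg_nonneg)
    also have "\<dots> \<le> (1 + t\<^sup>2) ^ k * f u"
      using u(2)[OF w(1)] by (intro mult_left_mono) (auto intro: add_nonneg_nonneg)
    finally show "poly q t \<ge> 0" unfolding q by (simp add: mult.commute)
  qed
  moreover have "coeff (\<Sum>j\<le>2*k. monom (e j) j) 2 = e 2"
    using k by (simp add: coeff_sum coeff_monom)
  ultimately have "e 2 \<le> f u * real k"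
    by (simp add: q_def coeff_one_plus_square_power)
  moreover have "hess_quad n f u v = 2 * e 2"
    using k by (intro hess_quad_binary(1)[OF fp _ e]) simp
  ultimately have "hess_quad n f u v \<le> 2 * real k * f u" by (simp add: mult_ac)
  then have "\<mu> \<le> 2 * real k * f u" using lo[OF u(1) v(1)] by linarith
  then have "(real (2 * k) - 1) * \<mu> \<le> (real (2 * k) - 1) * (2 * real k * f u)"
    using k by (intro mult_left_mono) auto
  also have "\<dots> = hess_quad n f u u" unfolding hess_quad_radial[OF f] by simp
  also have "\<dots> \<le> M" by (rule hi[OF u(1) u(1)])
  finally show ?thesis .
qed

lemma kappa_hess_nonneg_if_unit:
  assumes f: "is_form n d f" and n: "n \<ge> 1"
    and unit: "\<And>u y. u \<in> sphere_n n \<Longrightarrow> y \<in> sphere_n n \<Longrightarrow> 0 \<le> kappa n (d - 2) r (\<lambda>x. hess_quad n f x y) u"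
  shows "0 \<le> kappa n (d - 2) r (\<lambda>x. hess_quad n f x y) u"
proof -
  note fp = is_form_is_poly[OF f]
  obtain w where w: "w \<in> sphere_n n" "\<And>i. i < n \<Longrightarrow> y i = sqrt (normsq n y) * w i"
    using unit_vector_scaling[OF n] by blast
  have "0 \<le> kappa n (d - 2) r (\<lambda>x. hess_quad n f x w) u"
    by (rule is_form_nonneg[OF is_form_kappa[OF is_form_hess_quad[OF f]] n]) (rule unit[OF _ w(1)])
  moreover have "(\<lambda>x. hess_quad n f x y) = (\<lambda>x. (sqrt (normsq n y))\<^sup>2 * hess_quad n f x w)"
    unfolding hess_quad_scale[symmetric] using w(2) by (simp add: hess_quad_def)
  ultimately show ?thesis
    by (simp add: kappa_cmult[OF is_form_is_poly[OF is_form_hess_quad[OF f]]])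
qed

text \<open>Here \<open>m\<close> stands for d - 2. Small \<open>\<eta>\<close> leaves room between
  exp y and 1 + y that pays for the subtracted \<open>m + 2\<close>; the rational constants are one
  workable choice.\<close>

lemma exp_le_one_plus:
  fixes n m \<eta> r D :: real
  assumes n: "n \<ge> 2" and m: "m \<ge> 4" and \<eta>: "0 < \<eta>" "(m + 1) * \<eta> \<le> 1"
    and r: "r \<ge> n * m * (m - 1) / (4 * ln 2 * \<eta>) - (n + m) / 2 - (m + 2)"
    and D: "D = r + (n + m) / 2"
  shows "exp (n * (m * (m - 1)) / (4 * D)) \<le> 1 + \<eta>"
proof -
  define A where "A = n * (m * (m - 1)) / 4"
  \<comment> \<open>Here degree at least six is used: the subtracted \<open>m + 2\<close> is at most
    \<open>A\<close>.\<close>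
  have "0 \<le> (m - 4) * (m + 1)" using m by simp
  then have "m + 2 \<le> 2 * (m * (m - 1)) / 4" by (simp add: algebra_simps)
  also have "\<dots> \<le> A" unfolding A_def using n m by (intro divide_right_mono mult_right_mono) auto
  finally have A: "m + 2 \<le> A" .
  then have A0: "A > 0" using m by simp
  have \<eta>5: "\<eta> \<le> 1 / 5"
  proof -
    have "5 * \<eta> \<le> (m + 1) * \<eta>" using m \<eta> by (intro mult_right_mono) auto
    then show ?thesis using \<eta> by linarith
  qed
  have ln: "ln 2 \<le> (25 / 36 :: real)" by (rule ln2_le_25_over_36)
  have "A * (36 / (25 * \<eta>)) \<le> A * (1 / (ln 2 * \<eta>))"
    using A0 ln \<eta> by (intro mult_left_mono) (auto simp: field_simps)
  also have "\<dots> = n * m * (m - 1) / (4 * ln 2 * \<eta>)" unfolding A_def by simp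
  also have "\<dots> \<le> D + (m + 2)" using r D by simp
  finally have "A * (36 / (25 * \<eta>)) - A \<le> D" using A by linarith
  then have D1: "A * (31 / (25 * \<eta>)) \<le> D"
  proof -
    \<comment> \<open>As \<open>\<eta> \<le> 1 / 5\<close>, the subtracted 1 is at most 1 / (5 eta),
      and 36/25 - 1/5 = 31/25.\<close>
    have "31 / (25 * \<eta>) \<le> 36 / (25 * \<eta>) - 1" using \<eta> \<eta>5 by (simp add: field_simps)
    then have "A * (31 / (25 * \<eta>)) \<le> A * (36 / (25 * \<eta>) - 1)" using A0 by (intro mult_left_mono) auto
    then show ?thesis using \<open>A * (36 / (25 * \<eta>)) - A \<le> D\<close> by (simp add: right_diff_distrib)
  qed
  have D0: "D > 0" using D1 A0 \<eta> by (smt (verit) divide_pos_pos mult_pos_pos)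
  define y where "y = A / D"
  have "A * 31 \<le> D * (25 * \<eta>)" using D1 \<eta> by (simp add: field_simps)
  then have y: "0 \<le> y" "y \<le> 25 / 31 * \<eta>" unfolding y_def using A0 D0 by (auto simp: field_simps)
  \<comment> \<open>It suffices that 25/31 + (25/31)^2 / 5, about 0.94, is below 1.\<close>
  have "exp y \<le> 1 + y + y\<^sup>2" using y \<eta>5 by (intro exp_bound) auto
  also have "\<dots> \<le> 1 + 25 / 31 * \<eta> + (25 / 31 * \<eta>)\<^sup>2"
    using y by (intro add_mono power_mono) auto
  also have "(25 / 31 * \<eta>)\<^sup>2 \<le> (25 / 31) * (25 / 31) * (1 / 5) * \<eta>"
    using \<eta> \<eta>5 mult_mono[of \<eta> "1/5" \<eta> \<eta>] by (simp add: power2_eq_square)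
  also have "1 + 25 / 31 * \<eta> + (25 / 31) * (25 / 31) * (1 / 5) * \<eta> \<le> 1 + \<eta>"
    using \<eta> by simp
  finally have "exp y \<le> 1 + \<eta>" by simp
  moreover have "y = n * (m * (m - 1)) / (4 * D)" by (simp add: y_def A_def)
  ultimately show ?thesis by simp
qed

lemma r_sos_convex_high_degree:
  assumes f: "is_form n (2 * k) f" and k: "k \<ge> 3" and n: "n \<ge> 2"
    and \<mu>: "\<mu> > 0"
    and lo: "\<And>x y. x \<in> sphere_n n \<Longrightarrow> y \<in> sphere_n n \<Longrightarrow> \<mu> \<le> hess_quad n f x y"
    and hi: "\<And>x y. x \<in> sphere_n n \<Longrightarrow> y \<in> sphere_n n \<Longrightarrow> hess_quad n f x y \<le> M"
    and r: "real r \<ge> real n * (real (2 * k) - 2) * (real (2 * k) - 3) / (4 * ln 2 * (\<mu> / M))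
                   - (real n + real (2 * k) - 2) / 2 - real (2 * k)"
  shows "r_sos_convex n r f"
proof (rule r_sos_convex_if_kappa_nonneg[OF _ _ _ f])
  fix u y
  have n1: "n \<ge> 1" using n by simp
  define l where "l = k - 1"
  have l: "2 * k - 2 = 2 * l" "real (2 * l) = real (2 * k) - 2" "l \<ge> 2" using k by (auto simp: l_def)
  have pinch: "(real (2 * k) - 1) * \<mu> \<le> M"
    using k by (intro hess_pinching[OF f _ n lo hi]) auto
  have M: "M > 0"
  proof -
    have "0 < (real (2 * k) - 1) * \<mu>" using \<mu> k by (intro mult_pos_pos) auto
    then show ?thesis using pinch by linarith
  qed
  show "0 \<le> kappa n (2 * k - 2) r (\<lambda>x. hess_quad n f x y) u"
  proof (rule kappa_hess_nonneg_if_unit[OF f n1])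
    fix u y assume uy: "u \<in> sphere_n n" "y \<in> sphere_n n"
    show "0 \<le> kappa n (2 * k - 2) r (\<lambda>x. hess_quad n f x y) u"
      unfolding l(1)
    proof (rule kappa_nonneg_if_exp_bound[OF _ n1 lo[OF _ uy(2)] hi[OF _ uy(2)] \<mu> refl])
      show "is_form n (2 * l) (\<lambda>x. hess_quad n f x y)" using is_form_hess_quad[OF f, of y] l by simp
      show "exp (real n * (real (2 * l) * (real (2 * l) - 1)) / (4 * (real r + (real n + real (2 * l)) / 2))) \<le> 1 + \<mu> / M"
      proof (rule exp_le_one_plus)
        show "0 < \<mu> / M" using \<mu> M by simp
        show "(real (2 * l) + 1) * (\<mu> / M) \<le> 1" unfolding l(2) using pinch M by (simp add: field_simps)
        show "real r \<ge> real n * real (2 * l) * (real (2 * l) - 1) / (4 * ln 2 * (\<mu> / M))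
           - (real n + real (2 * l)) / 2 - (real (2 * l) + 2)"
          unfolding l(2) using r by (simp add: algebra_simps)
      qed (use n l in auto)
    qed
  qed
qed (use n k in auto)

section \<open>Quartic forms and the theorem\<close>

lemma kappa_degree_0: "kappa n 0 r q u = q u"
  by (simp add: kappa_def)

lemma quadratic_form_hess:
  assumes "is_form n 2 p" shows "hess_quad n p x v = 2 * p v"
proof -
  obtain e where e: "\<And>a b. p (\<lambda>i. a * x i + b * v i) = (\<Sum>j\<le>2. e j * a ^ (2 - j) * b ^ j)"
    using is_form_binary[OF assms] by blast
  have "p v = e 2" using e[of 0 1] by (simp add: numeral_2_eq_2)
  then show ?thesis using hess_quad_binary(1)[OF is_form_is_poly[OF assms] _ e] by simp
qed

text \<open>Rotating the pair by 45 degrees gives another orthonormal pair, and the bounds at both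
  pairs are linear inequalities in the five coefficients of the binary restriction.\<close>

lemma quartic_orthogonal_bounds:
  assumes f: "is_form n 4 f"
    and uv: "u \<in> sphere_n n" "v \<in> sphere_n n" "dot n u v = 0"
    and lo: "\<And>x y. x \<in> sphere_n n \<Longrightarrow> y \<in> sphere_n n \<Longrightarrow> \<mu> \<le> hess_quad n f x y"
    and hi: "\<And>x y. x \<in> sphere_n n \<Longrightarrow> y \<in> sphere_n n \<Longrightarrow> hess_quad n f x y \<le> M"
  shows "hess_quad n f u v \<le> (M - \<mu>) / 2" and "6 * \<mu> - M \<le> hess_quad n f u u"
proof -
  note fp = is_form_is_poly[OF f]
  have four: "{..4::nat} = {0, 1, 2, 3, 4}" by auto
  obtain e where e: "\<And>a b. f (\<lambda>i. a * u i + b * v i) = (\<Sum>j\<le>4. e j * a ^ (4 - j) * b ^ j)"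
    using is_form_binary[OF f] by blast
  have rad: "hess_quad n f x x = 12 * f x" for x using hess_quad_radial[OF f, of x] by simp
  have fu: "f u = e 0" using e[of 1 0] by (simp add: four)
  have fv: "f v = e 4" using e[of 0 1] by (simp add: four)
  have huv: "hess_quad n f u v = 2 * e 2" by (rule hess_quad_binary(1)[OF fp _ e]) simp
  define s :: real where "s = 1 / sqrt 2"
  have s2: "s\<^sup>2 = 1 / 2" by (simp add: s_def power_divide)
  have s4: "s ^ 4 = 1 / 4" using arg_cong[OF s2, of "\<lambda>x. x ^ 2"] by (simp add: power_mult[symmetric] power_divide)
  define w w' where "w = (\<lambda>i. s * u i + s * v i)" and "w' = (\<lambda>i. s * u i + (- s) * v i)"
  have unit: "(\<lambda>i. a * u i + b * v i) \<in> sphere_n n" if "a\<^sup>2 + b\<^sup>2 = 1" for a b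
    using normsq_orthonormal[OF uv, of a b] that uv by (auto simp: sphere_n_def normsq_def)
  have ww: "w \<in> sphere_n n" "w' \<in> sphere_n n"
    unfolding w_def w'_def by (intro unit; simp add: s2)+
  have fw4: "f w = s ^ 4 * (e 0 + e 1 + e 2 + e 3 + e 4)" "f w' = s ^ 4 * (e 0 - e 1 + e 2 - e 3 + e 4)"
    unfolding w_def w'_def e four by (simp_all add: eval_nat_numeral algebra_simps)
  have fw: "f w = (e 0 + e 1 + e 2 + e 3 + e 4) / 4" "f w' = (e 0 - e 1 + e 2 - e 3 + e 4) / 4"
    unfolding fw4 s4 by simp_all
  have "hess_quad n f w w' = 2 * coeff [:(e 0 + e 1 + e 2 + e 3 + e 4) / 4, (4 * e 0 + 2 * e 1 - 2 * e 3 - 4 * e 4) / 4,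
      (6 * e 0 - 2 * e 2 + 6 * e 4) / 4, (4 * e 0 - 2 * e 1 + 2 * e 3 - 4 * e 4) / 4, (e 0 - e 1 + e 2 - e 3 + e 4) / 4:] 2"
  proof (rule hess_quad_eq_coeff[OF fp])
    fix t
    have "f (\<lambda>i. w i + t * w' i) = f (\<lambda>i. (s * (1 + t)) * u i + (s * (1 - t)) * v i)"
      by (simp add: w_def w'_def algebra_simps)
    also have "\<dots> = s ^ 4 * (e 0 * (1 + t) ^ 4 + e 1 * (1 + t) ^ 3 * (1 - t) + e 2 * (1 + t)\<^sup>2 * (1 - t)\<^sup>2
        + e 3 * (1 + t) * (1 - t) ^ 3 + e 4 * (1 - t) ^ 4)"
      unfolding e four power_mult_distrib by (simp add: eval_nat_numeral algebra_simps)
    also have "\<dots> = poly [:(e 0 + e 1 + e 2 + e 3 + e 4) / 4, (4 * e 0 + 2 * e 1 - 2 * e 3 - 4 * e 4) / 4,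
      (6 * e 0 - 2 * e 2 + 6 * e 4) / 4, (4 * e 0 - 2 * e 1 + 2 * e 3 - 4 * e 4) / 4, (e 0 - e 1 + e 2 - e 3 + e 4) / 4:] t"
      unfolding s4 by (simp add: eval_nat_numeral field_simps)
    finally show "f (\<lambda>i. w i + t * w' i) = \<dots>" .
  qed
  then have hww: "hess_quad n f w w' = 3 * e 0 - e 2 + 3 * e 4" by (simp add: numeral_2_eq_2)
  have "12 * e 4 \<le> M" using hi[OF uv(2) uv(2)] rad[of v] fv by simp
  moreover have "3 * (e 0 + e 1 + e 2 + e 3 + e 4) \<le> M" using hi[OF ww(1) ww(1)] rad[of w] fw by simp
  moreover have "3 * (e 0 - e 1 + e 2 - e 3 + e 4) \<le> M" using hi[OF ww(2) ww(2)] rad[of w'] fw by simp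
  moreover have "\<mu> \<le> 3 * e 0 - e 2 + 3 * e 4" using lo[OF ww] hww by simp
  moreover have "\<mu> \<le> 2 * e 2" using lo[OF uv(1,2)] huv by simp
  \<comment> \<open>Averaging the bounds at \<open>w\<close> and \<open>w'\<close> gives 3 (e0 + e2
    + e4) <= M. With 3 (e0 + e4) >= mu + e2 this yields mu + 4 e2 <= M. The second claim follows
    from the latter inequality with 2 e2 >= mu and 12 e4 <= M.\<close>
  ultimately have "2 * e 2 \<le> (M - \<mu>) / 2 \<and> 6 * \<mu> - M \<le> 12 * e 0" by auto
  then show "hess_quad n f u v \<le> (M - \<mu>) / 2" "6 * \<mu> - M \<le> hess_quad n f u u"
    unfolding huv rad fu by simp_all
qed

lemma sum_lessThan_remove_0:
  fixes g :: "nat \<Rightarrow> real"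
  assumes "n \<ge> 1" shows "(\<Sum>k<n. g k) = g 0 + (\<Sum>k\<in>{0<..<n}. g k)"
proof -
  have "{..<n} = insert 0 {0<..<n}" using assms by auto
  then show ?thesis by simp
qed

text \<open>The frame starts at \<open>y\<close>, not at \<open>u\<close>, so that all but one term
  of the trace are values at orthonormal pairs. The bound for general forms would only give
  \<open>2 * n * M\<close>.\<close>

lemma quartic_lap_hess_upper:
  assumes f: "is_form n 4 f" and n: "n \<ge> 1" and y: "y \<in> sphere_n n"
    and lo: "\<And>x y. x \<in> sphere_n n \<Longrightarrow> y \<in> sphere_n n \<Longrightarrow> \<mu> \<le> hess_quad n f x y"
    and hi: "\<And>x y. x \<in> sphere_n n \<Longrightarrow> y \<in> sphere_n n \<Longrightarrow> hess_quad n f x y \<le> M"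
  shows "lap n (\<lambda>x. hess_quad n f x y) u \<le> 2 * M + (real n - 1) * (M - \<mu>)"
proof -
  let ?p = "\<lambda>x. hess_quad n f x y"
  have p: "is_form n 2 ?p" using is_form_hess_quad[OF f, of y] by simp
  obtain R where R: "R 0 = y" "\<And>k. k < n \<Longrightarrow> R k \<in> sphere_n n"
    "\<And>k. 0 < k \<Longrightarrow> k < n \<Longrightarrow> dot n y (R k) = 0"
    "\<And>i j. i < n \<Longrightarrow> j < n \<Longrightarrow> (\<Sum>k<n. R k i * R k j) = (if i = j then 1 else 0)"
    using orthonormal_basis[OF n y] by blast
  have "lap n ?p u = (\<Sum>k<n. hess_quad n ?p u (R k))" by (rule lap_orthonormal) (rule R(4))
  also have "\<dots> = 2 * ?p (R 0) + (\<Sum>k\<in>{0<..<n}. 2 * ?p (R k))"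
    unfolding quadratic_form_hess[OF p] by (rule sum_lessThan_remove_0[OF n])
  also have "\<dots> \<le> 2 * M + (\<Sum>k\<in>{0<..<n}. M - \<mu>)"
  proof (intro add_mono sum_mono)
    show "2 * ?p (R 0) \<le> 2 * M" using hi[OF y y] R(1) by simp
    fix k assume k: "k \<in> {0<..<n}"
    have "dot n (R k) y = dot n y (R k)" by (simp add: dot_def mult.commute)
    then have "dot n (R k) y = 0" using R(3)[of k] k by simp
    then show "2 * ?p (R k) \<le> M - \<mu>"
      using quartic_orthogonal_bounds(1)[OF f R(2) y _ lo hi, of k] k by simp
  qed
  also have "(\<Sum>k\<in>{0<..<n}. M - \<mu>) = (real n - 1) * (M - \<mu>)" using n by (simp add: of_nat_diff)
  finally show ?thesis .
qed

text \<open>For a quadratic form the kernel on the sphere is \<open>q u\<close> minus its Laplacian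
  divided by 2 (n + 2 + 2 r). The hypothesis on \<open>r\<close> is 2 M + (n - 1)(M - mu) <= 2 (n +
  2 + 2 r) mu, rearranged.\<close>

lemma r_sos_convex_quartic:
  assumes f: "is_form n 4 f" and n: "n \<ge> 1"
    and lo: "\<And>x y. x \<in> sphere_n n \<Longrightarrow> y \<in> sphere_n n \<Longrightarrow> \<mu> \<le> hess_quad n f x y"
    and hi: "\<And>x y. x \<in> sphere_n n \<Longrightarrow> y \<in> sphere_n n \<Longrightarrow> hess_quad n f x y \<le> M"
    and r: "4 * real r * \<mu> \<ge> (real n + 1) * (M - 3 * \<mu>)"
  shows "r_sos_convex n r f"
proof (rule r_sos_convex_if_kappa_nonneg[OF _ _ _ f])
  fix u y
  show "0 \<le> kappa n (4 - 2) r (\<lambda>x. hess_quad n f x y) u"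
  proof (rule kappa_hess_nonneg_if_unit[OF f n])
    fix u y assume uy: "u \<in> sphere_n n" "y \<in> sphere_n n"
    let ?p = "\<lambda>x. hess_quad n f x y"
    let ?c = "2 * (real n + 2 + 2 * real r)"
    have c: "?c > 0" by simp
    have nu: "normsq n u = 1" using uy by (simp add: normsq_def sphere_n_def)
    have "kappa n (4 - 2) r ?p u = ?p u - lap n ?p u / ?c"
      unfolding kappa_def nu by (simp add: numeral_2_eq_2 algebra_simps)
    moreover have "lap n ?p u / ?c \<le> ?p u"
    proof -
      have "lap n ?p u \<le> 2 * M + (real n - 1) * (M - \<mu>)"
        by (rule quartic_lap_hess_upper[OF f n uy(2) lo hi])
      also have "\<dots> \<le> \<mu> * ?c" using r by (simp add: algebra_simps)
      also have "\<dots> \<le> ?p u * ?c" using lo[OF uy] c by (intro mult_right_mono) auto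
      finally show ?thesis using c by (simp add: pos_divide_le_eq)
    qed
    ultimately show "0 \<le> kappa n (4 - 2) r ?p u" by simp
  qed
qed (use n in auto)

text \<open>If \<open>f\<close> itself is an average of fourth powers of linear forms with nonnegative weights,
  differentiating under the average gives a sum of squares.\<close>

lemma sos_convex_quartic_if_kappa_nonneg:
  assumes f: "is_form n 4 f" and n: "n \<ge> 1" and pos: "\<And>u. kappa n 4 0 f u \<ge> 0"
  shows "r_sos_convex n 0 f"
proof -
  note fp = is_form_is_poly[OF f]
  have "n > 0" using n by simp
  from expect_kappa_dot[OF this, of 4 0] obtain C where C: "C > 0" "\<And>q x. is_form n 4 q \<Longrightarrow>
      expect n (\<lambda>u. kappa n 4 0 q u * dot n x u ^ (4 + 2 * 0)) = C * normsq n x ^ 0 * q x"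
    by blast
  let ?k = "kappa n 4 0 f"
  have kp: "is_poly n ?k" by (rule is_poly_kappa[OF fp])
  have fC: "f x = 1 / C * expect n (\<lambda>u. ?k u * dot n x u ^ 4)" for x
    using C(2)[OF f, of x] C(1) by simp
  \<comment> \<open>The 12 is twice the middle binomial coefficient of the fourth power.\<close>
  define c0 where "c0 = 12 / C"
  have c0: "c0 > 0" using C(1) by (simp add: c0_def)
  have hess: "hess_quad n f x v = expect n (\<lambda>u. c0 * (?k u * ((dot n x u)\<^sup>2 * (dot n v u)\<^sup>2)))" for x v
  proof -
    define c where "c j = 1 / C * (real (4 choose j) * expect n (\<lambda>u. ?k u * (dot n v u ^ j * dot n x u ^ (4 - j))))" for j
    have "hess_quad n f x v = 2 * coeff (\<Sum>j\<le>4. monom (c j) j) 2"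
    proof (rule hess_quad_eq_coeff[OF fp])
      fix t
      have "dot n (\<lambda>i. x i + t * v i) u = t * dot n v u + dot n x u" for u
        by (simp add: dot_def distrib_right sum.distrib sum_distrib_left mult.assoc add.commute)
      then have "?k u * dot n (\<lambda>i. x i + t * v i) u ^ 4
          = (\<Sum>j\<le>4. (real (4 choose j) * t ^ j) * (?k u * (dot n v u ^ j * dot n x u ^ (4 - j))))" for u
        by (simp only: binomial_ring sum_distrib_left power_mult_distrib mult_ac)
      then have "f (\<lambda>i. x i + t * v i) = 1 / C * expect n (\<lambda>u. \<Sum>j\<le>4. (real (4 choose j) * t ^ j) * (?k u * (dot n v u ^ j * dot n x u ^ (4 - j))))"
        unfolding fC[of "\<lambda>i. x i + t * v i"] by (simp only:)
      also have "\<dots> = 1 / C * (\<Sum>j\<le>4. (real (4 choose j) * t ^ j) * expect n (\<lambda>u. ?k u * (dot n v u ^ j * dot n x u ^ (4 - j))))"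
        by (subst expect_lincomb) (intro is_poly_intros kp is_poly_dot, simp)
      also have "\<dots> = poly (\<Sum>j\<le>4. monom (c j) j) t"
        unfolding poly_sum poly_monom c_def sum_distrib_left by (simp only: mult_ac)
      finally show "f (\<lambda>i. x i + t * v i) = \<dots>" .
    qed
    also have "coeff (\<Sum>j\<le>4. monom (c j) j) 2 = c 2" by (simp add: coeff_sum coeff_monom)
    also have "2 * c 2 = expect n (\<lambda>u. c0 * (?k u * ((dot n x u)\<^sup>2 * (dot n v u)\<^sup>2)))"
    proof -
      have "(4 choose 2 :: nat) = 6" by (simp add: choose_two)
      then show ?thesis unfolding c_def c0_def expect_cmult by (simp add: mult_ac)
    qed
    finally show ?thesis .
  qed
  define I where "I = {..<n} \<times> {..<n}"
  \<comment> \<open>The Gram vector consists of the products x_i y_j: the integrand contains the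
    square of (x . u)(y . u), which is linear in them.\<close>
  define \<phi> where "\<phi> p z = z (fst p) * z (n + snd p)" for p and z :: "nat \<Rightarrow> real"
  define W where "W p u = u (fst p) * u (snd p)" for p :: "nat \<times> nat" and u :: "nat \<Rightarrow> real"
  define F where "F p q u = (if p \<in> I \<and> q \<in> I then c0 * (?k u * (W p u * W q u)) else 0)" for p q u
  have Wp: "is_poly n (W p)" if "p \<in> I" for p
    unfolding W_def[abs_def] using that by (auto simp: I_def intro!: is_poly_mult is_poly_coord)
  have FS: "(\<Sum>p\<in>I. \<Sum>q\<in>I. c p * c q * F p q u) = c0 * (?k u * (\<Sum>p\<in>I. c p * W p u)\<^sup>2)" for c u
  proof -
    have "(\<Sum>p\<in>I. \<Sum>q\<in>I. c p * c q * F p q u) = (\<Sum>p\<in>I. \<Sum>q\<in>I. c0 * (?k u * ((c p * W p u) * (c q * W q u))))"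
      by (intro sum.cong) (auto simp: F_def)
    moreover have "(\<Sum>p\<in>I. c p * W p u)\<^sup>2 = (\<Sum>p\<in>I. \<Sum>q\<in>I. (c p * W p u) * (c q * W q u))"
      unfolding power2_eq_square by (rule sum_product)
    ultimately show ?thesis by (simp only: sum_distrib_left)
  qed
  have "is_sos (2 * n) (\<lambda>z. expect n (\<lambda>u. \<Sum>p\<in>I. \<Sum>q\<in>I. \<phi> p z * \<phi> q z * F p q u))"
  proof (rule is_sos_expect)
    show "finite I" by (simp add: I_def)
    show "is_poly n (F p q)" for p q
      unfolding F_def[abs_def] using kp Wp[of p] Wp[of q]
      by (cases "p \<in> I \<and> q \<in> I") (auto intro!: is_poly_mult is_poly_const)
    show "is_poly (2 * n) (\<phi> p)" if "p \<in> I" for p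
      unfolding \<phi>_def[abs_def] using that by (auto simp: I_def intro!: is_poly_mult is_poly_coord)
    show "0 \<le> (\<Sum>p\<in>I. \<Sum>q\<in>I. c p * c q * F p q u)" for c u
      unfolding FS using pos[of u] c0 by simp
  qed
  moreover have "expect n (\<lambda>u. \<Sum>p\<in>I. \<Sum>q\<in>I. \<phi> p z * \<phi> q z * F p q u)
     = hess_quad n f (\<lambda>i. if i < n then z i else 0) (\<lambda>i. if i < n then z (n + i) else 0)" for z
  proof -
    let ?x = "\<lambda>i. if i < n then z i else 0" and ?y = "\<lambda>i. if i < n then z (n + i) else 0"
    have "(\<Sum>p\<in>I. \<phi> p z * W p u) = dot n ?x u * dot n ?y u" for u
    proof -
      have "(\<Sum>p\<in>I. \<phi> p z * W p u) = (\<Sum>i<n. \<Sum>j<n. (z i * u i) * (z (n + j) * u j))"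
        unfolding I_def \<phi>_def W_def by (simp add: sum.cartesian_product case_prod_beta mult_ac)
      also have "\<dots> = (\<Sum>i<n. z i * u i) * (\<Sum>j<n. z (n + j) * u j)" by (simp add: sum_product)
      finally show ?thesis by (simp add: dot_def)
    qed
    then show ?thesis unfolding FS hess by (simp add: power_mult_distrib)
  qed
  ultimately show ?thesis unfolding r_sos_convex_def by simp
qed

text \<open>At \<open>r = 0\<close> the criterion \<open>r_sos_convex_quartic\<close> demands
  \<open>M \<le> 3 * \<mu>\<close>, which pinching allows only with equality. The kernel of
  \<open>f\<close> itself, instead of its Hessian form, leaves the small margin needed.\<close>

lemma sos_convex_ternary_quartic:
  assumes f: "is_form 3 4 f" and \<mu>: "\<mu> > 0"
    and lo: "\<And>x y. x \<in> sphere_n 3 \<Longrightarrow> y \<in> sphere_n 3 \<Longrightarrow> \<mu> \<le> hess_quad 3 f x y"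
    and hi: "\<And>x y. x \<in> sphere_n 3 \<Longrightarrow> y \<in> sphere_n 3 \<Longrightarrow> hess_quad 3 f x y \<le> M"
    and q: "M \<le> (31 / 10) * \<mu>"
  shows "r_sos_convex 3 0 f"
proof (rule sos_convex_quartic_if_kappa_nonneg[OF f])
  fix u
  have basis: "\<exists>R :: nat \<Rightarrow> nat \<Rightarrow> real. R 0 = u \<and> R 1 \<in> sphere_n 3 \<and> R 2 \<in> sphere_n 3 \<and> dot 3 u (R 1) = 0 \<and> dot 3 u (R 2) = 0 \<and>
     (\<forall>p x. lap 3 p x = hess_quad 3 p x (R 0) + hess_quad 3 p x (R 1) + hess_quad 3 p x (R 2))"
    if "u \<in> sphere_n 3" for u
  proof -
    have "1 \<le> (3 :: nat)" by simp
    from orthonormal_basis[OF this that] obtain R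
      where R: "R 0 = u" "\<And>k. k < (3 :: nat) \<Longrightarrow> R k \<in> sphere_n 3"
        "\<And>k. 0 < k \<Longrightarrow> k < (3 :: nat) \<Longrightarrow> dot 3 u (R k) = 0"
        "\<And>i j. i < (3 :: nat) \<Longrightarrow> j < (3 :: nat) \<Longrightarrow> (\<Sum>k<(3 :: nat). R k i * R k j) = (if i = j then 1 else 0)"
      by blast
    have "lap 3 p x = (\<Sum>k<3. hess_quad 3 p x (R k))" for p x by (rule lap_orthonormal) (rule R(4))
    moreover have "{..<3 :: nat} = {0, 1, 2}" by auto
    ultimately show ?thesis using R(1-3) by (intro exI[of _ R]) simp
  qed
  have lap2: "is_form 3 2 (lap 3 f)" using is_form_lap[OF f] by simp
  have lapf: "8 * \<mu> - M \<le> lap 3 f w \<and> lap 3 f w \<le> 2 * M - \<mu>" if w: "w \<in> sphere_n 3" for w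
  proof -
    obtain R :: "nat \<Rightarrow> nat \<Rightarrow> real" where R: "R 0 = w" "R 1 \<in> sphere_n 3" "R 2 \<in> sphere_n 3" "dot 3 w (R 1) = 0" "dot 3 w (R 2) = 0"
      "\<And>p x. lap 3 p x = hess_quad 3 p x (R 0) + hess_quad 3 p x (R 1) + hess_quad 3 p x (R 2)"
      using basis[OF w] by blast
    note B1 = quartic_orthogonal_bounds[OF f w R(2,4) lo hi]
    note B2 = quartic_orthogonal_bounds[OF f w R(3,5) lo hi]
    show ?thesis unfolding R(6) R(1)
      using B1 B2 lo[OF w R(2)] lo[OF w R(3)] hi[OF w w] by auto
  qed
  show "kappa 3 4 0 f u \<ge> 0"
  proof (rule is_form_nonneg[OF is_form_kappa[OF f]])
    fix u assume u: "u \<in> sphere_n 3"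
    obtain R :: "nat \<Rightarrow> nat \<Rightarrow> real" where R: "R 0 = u" "R 1 \<in> sphere_n 3" "R 2 \<in> sphere_n 3" "dot 3 u (R 1) = 0" "dot 3 u (R 2) = 0"
      "\<And>p x. lap 3 p x = hess_quad 3 p x (R 0) + hess_quad 3 p x (R 1) + hess_quad 3 p x (R 2)"
      using basis[OF u] by blast
    have nu: "normsq 3 u = 1" using u by (simp add: normsq_def sphere_n_def)
    have K: "kappa 3 4 0 f u = f u - lap 3 f u / 18 + lap 3 (lap 3 f) u / 504"
    proof -
      have "{..4 div 2 :: nat} = {0, 1, 2}" "{..<2 :: nat} = {0, 1}" by auto
      moreover have "(lap 3 ^^ 2) f = lap 3 (lap 3 f)" by (simp add: numeral_2_eq_2)
      ultimately show ?thesis unfolding kappa_def nu by simp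
    qed
    have "6 * \<mu> - M \<le> 12 * f u"
      using quartic_orthogonal_bounds(2)[OF f u R(2,4) lo hi] hess_quad_radial[OF f, of u] by simp
    moreover have "lap 3 f u \<le> 2 * M - \<mu>" using lapf[OF u] by simp
    moreover have "lap 3 (lap 3 f) u \<ge> 6 * (8 * \<mu> - M)"
      unfolding R(6)[of "lap 3 f"] quadratic_form_hess[OF lap2]
      using lapf[OF u] lapf[OF R(2)] lapf[OF R(3)] R(1) by simp
    \<comment> \<open>The three bounds add up to (41 mu - 13 M) / 63, and 41/13 exceeds
      31/10.\<close>
    ultimately show "kappa 3 4 0 f u \<ge> 0" unfolding K using q \<mu> by (simp add: field_simps)
  qed simp
qed simp

text \<open>For binary quartics the Hessian form at \<open>(x, y)\<close> is a quadratic form in the symmetric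
  matrix \<open>(x y\<^sup>T + y x\<^sup>T) / 2\<close>. It is nonnegative on indefinite matrices, which are exactly of this
  shape, and on definite ones, which are plus or minus a sum of two rank-one matrices.\<close>

lemma sos_convex_binary_quartic:
  assumes f: "is_form 2 4 f"
    and lo: "\<And>x y. x \<in> sphere_n 2 \<Longrightarrow> y \<in> sphere_n 2 \<Longrightarrow> 0 \<le> hess_quad 2 f x y"
  shows "r_sos_convex 2 0 f"
proof -
  note fp = is_form_is_poly[OF f]
  have four: "{..4::nat} = {0, 1, 2, 3, 4}" by auto
  have two: "{..<2::nat} = {0, 1}" by auto
  have three: "{..<3::nat} = {0, 1, 2}" by auto
  obtain e where e: "\<And>a b. f (\<lambda>i. a * (if i = 0 then 1 else 0) + b * (if i = 1 then 1 else 0))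
      = (\<Sum>j\<le>4. e j * a ^ (4 - j) * b ^ j)"
    using is_form_binary[OF f, of "\<lambda>i. if i = 0 then 1 else 0" "\<lambda>i. if i = 1 then 1 else 0"] by auto
  have fx: "f x = e 0 * x 0 ^ 4 + e 1 * x 0 ^ 3 * x 1 + e 2 * x 0 ^ 2 * x 1 ^ 2 + e 3 * x 0 * x 1 ^ 3 + e 4 * x 1 ^ 4" for x
  proof -
    have "f x = f (\<lambda>i. x 0 * (if i = 0 then 1 else 0) + x 1 * (if i = 1 then 1 else 0))"
      by (rule is_poly_cong_coords[OF fp]) (auto simp: less_2_cases_iff)
    then show ?thesis unfolding e four by simp
  qed
  define Q where "Q A S B = 12 * e 0 * A\<^sup>2 + 6 * e 1 * A * S + 2 * e 2 * (S\<^sup>2 + 2 * A * B) + 6 * e 3 * B * S + 12 * e 4 * B\<^sup>2" for A S B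
  have h: "hess_quad 2 f x y = Q (x 0 * y 0) (x 0 * y 1 + x 1 * y 0) (x 1 * y 1)" for x y
  proof -
    have "hess_quad 2 f x y = 2 * coeff
      [:f x,
        4 * e 0 * x 0 ^ 3 * y 0 + e 1 * (3 * x 0 ^ 2 * y 0 * x 1 + x 0 ^ 3 * y 1) + e 2 * (2 * x 0 * y 0 * x 1 ^ 2 + 2 * x 0 ^ 2 * x 1 * y 1)
          + e 3 * (y 0 * x 1 ^ 3 + 3 * x 0 * x 1 ^ 2 * y 1) + 4 * e 4 * x 1 ^ 3 * y 1,
        6 * e 0 * x 0 ^ 2 * y 0 ^ 2 + e 1 * (3 * x 0 * y 0 ^ 2 * x 1 + 3 * x 0 ^ 2 * y 0 * y 1)
          + e 2 * (y 0 ^ 2 * x 1 ^ 2 + 4 * x 0 * y 0 * x 1 * y 1 + x 0 ^ 2 * y 1 ^ 2)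
          + e 3 * (3 * y 0 * x 1 ^ 2 * y 1 + 3 * x 0 * x 1 * y 1 ^ 2) + 6 * e 4 * x 1 ^ 2 * y 1 ^ 2,
        4 * e 0 * y 0 ^ 3 * x 0 + e 1 * (3 * y 0 ^ 2 * x 0 * y 1 + y 0 ^ 3 * x 1) + e 2 * (2 * y 0 * x 0 * y 1 ^ 2 + 2 * y 0 ^ 2 * y 1 * x 1)
          + e 3 * (x 0 * y 1 ^ 3 + 3 * y 0 * y 1 ^ 2 * x 1) + 4 * e 4 * y 1 ^ 3 * x 1,
        f y:] 2"
      by (rule hess_quad_eq_coeff[OF fp]) (simp add: fx eval_nat_numeral algebra_simps)
    also have "\<dots> = Q (x 0 * y 0) (x 0 * y 1 + x 1 * y 0) (x 1 * y 1)"
      by (simp add: Q_def eval_nat_numeral algebra_simps)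
    finally show ?thesis .
  qed
  have nn: "0 \<le> hess_quad 2 f x y" for x y
  proof -
    obtain w where w: "w \<in> sphere_n 2" "\<And>i. i < 2 \<Longrightarrow> y i = sqrt (normsq 2 y) * w i"
      using unit_vector_scaling[of 2 y] by auto
    have "0 \<le> hess_quad 2 f x w"
      using is_form_nonneg[OF is_form_hess_quad[OF f, of w], of x] lo[OF _ w(1)] by simp
    moreover have "hess_quad 2 f x y = (sqrt (normsq 2 y))\<^sup>2 * hess_quad 2 f x w"
      unfolding hess_quad_scale[symmetric] using w(2) by (simp add: hess_quad_def)
    ultimately show ?thesis by simp
  qed
  have Qh: "0 \<le> Q (a * c) (a * d + b * c) (b * d)" for a b c d
    using nn[of "\<lambda>i. if i = 0 then a else b" "\<lambda>i. if i = 0 then c else d"] unfolding h by simp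
  have Qnn: "0 \<le> Q A S B" for A S B
  proof (cases "4 * A * B \<le> S\<^sup>2")
    case True
    show ?thesis
    proof (cases "A = 0")
      case True
      then show ?thesis using Qh[of 0 S B 1] by simp
    next
      case False
      \<comment> \<open>The nonnegative discriminant lets A + S t + B t^2 split into real linear
        factors (a + b t)(c + d t), whose coefficients are the two vectors.\<close>
      define \<delta> where "\<delta> = sqrt (S\<^sup>2 - 4 * A * B)"
      have "\<delta>\<^sup>2 = S\<^sup>2 - 4 * A * B" unfolding \<delta>_def using True by simp
      then have "(S - \<delta>) / (2 * A) * ((S + \<delta>) / 2) = B"
        using False by (simp add: field_simps power2_eq_square)
      moreover have "1 * ((S + \<delta>) / 2) + (S - \<delta>) / (2 * A) * A = S"
        using False by (simp add: field_simps)
      ultimately show ?thesis using Qh[of 1 A "(S + \<delta>) / 2" "(S - \<delta>) / (2 * A)"] by simp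
    qed
  next
    case False
    then have A: "A \<noteq> 0" by (auto simp: not_le)
    \<comment> \<open>Completing the square: the matrix is \<open>A\<close> times the square of the
      vector (1, c) plus \<open>g\<close> times that of (0, 1), with \<open>A\<close> and
      \<open>g\<close> of equal sign. The mixed term is again a Hessian value, at (1, c) and (0, 1),
      by symmetry of the fourth derivatives.\<close>
    define c where "c = S / (2 * A)"
    define g where "g = B - A * c\<^sup>2"
    have S: "S = 2 * A * c" and B: "B = A * c\<^sup>2 + g" using A by (simp_all add: c_def g_def)
    have "4 * (A * g) > 0" using False unfolding S B by (simp add: power2_eq_square algebra_simps)
    then have Ag: "A * g \<ge> 0" by simp
    have "Q A S B = A\<^sup>2 * Q 1 (2 * c) (c\<^sup>2) + 2 * (A * g) * Q 0 1 c + g\<^sup>2 * Q 0 0 1"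
      unfolding S B Q_def by (simp add: power2_eq_square algebra_simps)
    moreover have "0 \<le> Q 1 (2 * c) (c\<^sup>2)" using Qh[of 1 1 c c] by (simp add: power2_eq_square)
    moreover have "0 \<le> Q 0 1 c" using Qh[of 1 0 1 c] by simp
    moreover have "0 \<le> Q 0 0 1" using Qh[of 0 0 1 1] by simp
    ultimately show ?thesis using Ag by simp
  qed
  define G :: "nat \<Rightarrow> nat \<Rightarrow> real" where "G i j = (if i = j then (if i = 0 then 12 * e 0 else if i = 1 then 2 * e 2 else 12 * e 4)
     else if {i, j} = {0, 1} then 3 * e 1 else if {i, j} = {0, 2} then 2 * e 2 else 3 * e 3)" for i j
  have GQ: "(\<Sum>i<3. \<Sum>j<3. z i * z j * G i j) = Q (z 0) (z 1) (z 2)" for z :: "nat \<Rightarrow> real"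
    unfolding three by (simp add: G_def Q_def doubleton_eq_iff power2_eq_square algebra_simps)
  define \<phi> :: "nat \<Rightarrow> (nat \<Rightarrow> real) \<Rightarrow> real" where
    "\<phi> i = (if i = 0 then (\<lambda>z. z 0 * z 2) else if i = 1 then (\<lambda>z. z 0 * z 3 + z 1 * z 2) else (\<lambda>z. z 1 * z 3))" for i
  \<comment> \<open>A constant kernel, which averaging leaves unchanged.\<close>
  have "is_sos (2 * 2) (\<lambda>z. expect 1 (\<lambda>u. \<Sum>i<3. \<Sum>j<3. \<phi> i z * \<phi> j z * (\<lambda>u. G i j) u))"
  proof (rule is_sos_expect)
    show "is_poly (2 * 2) (\<phi> i)" for i unfolding \<phi>_def by (auto intro!: is_poly_add is_poly_mult is_poly_coord)
  qed (auto simp: GQ Qnn is_poly_const)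
  then show ?thesis unfolding r_sos_convex_def h by (simp add: GQ expect_const \<phi>_def)
qed

theorem theorem5:
  fixes n d r :: nat and f :: "(nat \<Rightarrow> real) \<Rightarrow> real"
  assumes "n \<ge> 2" and "even d" and "d \<ge> 2"
    and "is_form n d f"
    and "\<forall>x\<in>sphere_n n. \<forall>y\<in>sphere_n n. hess_quad n f x y > 0"
    and "real r \<ge> real n * (real d - 2) * (real d - 3) / (4 * ln 2 * eta n f)
                   - (real n + real d - 2) / 2 - real d"
  shows "r_sos_convex n r f"
proof -
  note f = assms(4)
  have n1: "n \<ge> 1" using assms(1) by simp
  define \<mu> M where "\<mu> = Inf (hess_values n f)" and "M = Sup (hess_values n f)"
  have \<mu>: "\<mu> > 0" unfolding \<mu>_def
    by (rule hess_values_bounds(1)[OF is_form_is_poly[OF f] n1]) (use assms(5) in auto)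
  have lo: "\<mu> \<le> hess_quad n f x y" if "x \<in> sphere_n n" "y \<in> sphere_n n" for x y
    unfolding \<mu>_def by (rule hess_values_bounds(2)[OF is_form_is_poly[OF f] n1 _ that]) (use assms(5) in auto)
  have hi: "hess_quad n f x y \<le> M" if "x \<in> sphere_n n" "y \<in> sphere_n n" for x y
    unfolding M_def by (rule hess_values_bounds(3)[OF is_form_is_poly[OF f] n1 _ that]) (use assms(5) in auto)
  obtain k where k: "d = 2 * k" using assms(2) by (elim evenE)
  have r: "real r \<ge> real n * (real (2 * k) - 2) * (real (2 * k) - 3) / (4 * ln 2 * (\<mu> / M))
                   - (real n + real (2 * k) - 2) / 2 - real (2 * k)"
    using assms(6) unfolding eta_def k \<mu>_def M_def .
  consider "k = 1" | "k = 2" | "k \<ge> 3" using assms(3) k by linarith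
  then show ?thesis
  proof cases
    case 1
    show ?thesis
    proof (rule r_sos_convex_if_kappa_nonneg[OF _ assms(2,3) f])
      fix u y
      show "0 \<le> kappa n (d - 2) r (\<lambda>x. hess_quad n f x y) u"
      proof (rule kappa_hess_nonneg_if_unit[OF f n1])
        fix u y assume "u \<in> sphere_n n" "y \<in> sphere_n n"
        then show "0 \<le> kappa n (d - 2) r (\<lambda>x. hess_quad n f x y) u"
          using lo[of u y] \<mu> by (simp add: k 1 kappa_degree_0)
      qed
    qed (use n1 in simp)
  next
    case 2
    have f4: "is_form n 4 f" using f k 2 by simp
    define q where "q = M / \<mu>"
    have "(real (2 * 2) - 1) * \<mu> \<le> M"
      by (rule hess_pinching[OF _ _ assms(1) lo hi]) (use f4 in simp_all)
    then have q3: "q \<ge> 3" using \<mu> by (simp add: q_def field_simps)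
    have M: "M = q * \<mu>" using \<mu> by (simp add: q_def)
    have ln: "0 < ln (2 :: real)" "ln 2 \<le> (25 / 36 :: real)" using ln2_le_25_over_36 by auto
    \<comment> \<open>The 5 is (d - 2)/2 + d at d = 4.\<close>
    have "real r \<ge> real n * q / (2 * ln 2) - real n / 2 - 5"
      using r \<mu> q3 unfolding 2 M by (simp add: field_simps)
    moreover have "real n * q / (2 * ln 2) \<ge> real n * q * (18 / 25)"
    proof -
      have "18 / 25 \<le> 1 / (2 * ln 2 :: real)" using ln by (simp add: field_simps)
      then have "real n * q * (18 / 25) \<le> real n * q * (1 / (2 * ln 2))" using q3 by (intro mult_left_mono) auto
      then show ?thesis by simp
    qed
    ultimately have rq: "real r \<ge> real n * q * (18 / 25) - real n / 2 - 5" by linarith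
    have quartic: "r_sos_convex n r f" if "4 * real r \<ge> (real n + 1) * (q - 3)"
    proof (rule r_sos_convex_quartic[OF f4 n1 lo hi])
      have "(real n + 1) * (q - 3) * \<mu> \<le> 4 * real r * \<mu>" using that \<mu> by (intro mult_right_mono) auto
      then show "4 * real r * \<mu> \<ge> (real n + 1) * (M - 3 * \<mu>)" unfolding M by (simp add: algebra_simps)
    qed
    consider "n = 2" | "n = 3" | "n \<ge> 4" using assms(1) by linarith
    then show ?thesis
    proof cases
      case 1
      have "0 \<le> hess_quad 2 f x y" if "x \<in> sphere_n 2" "y \<in> sphere_n 2" for x y
        using lo[of x y] that \<mu> 1 by simp
      then have "r_sos_convex 2 0 f" using sos_convex_binary_quartic f4 1 by simp
      then show ?thesis unfolding 1 by (rule r_sos_convex_mono)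
    next
      case 3: 2
      show ?thesis
      proof (cases "r = 0")
        case True
        \<comment> \<open>Here \<open>rq\<close> reads 54 q / 25 <= 13/2, so \<open>q\<close> is
          below 3.01.\<close>
        have "q \<le> 31 / 10" using rq True 3 by simp
        then have "M \<le> 31 / 10 * \<mu>" unfolding M using \<mu> by (intro mult_right_mono) auto
        then have "r_sos_convex 3 0 f"
          using sos_convex_ternary_quartic[OF _ \<mu>, of f M] f4 lo hi 3 by simp
        then show ?thesis using True 3 by simp
      next
        case False
        then have "real r \<ge> 1" by simp
        \<comment> \<open>What is needed is \<open>r \<ge> q - 3\<close>: for
          \<open>q \<le> 4\<close> it follows from \<open>r \<ge> 1\<close>, for larger
          \<open>q\<close> from \<open>rq\<close>.\<close>
        then show ?thesis using rq 3 by (intro quartic) simp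
      qed
    next
      case n4: 3
      \<comment> \<open>In the variables n - 4 and q - 3 the required inequality has only
        nonnegative coefficients, and this product is its one nonlinear term.\<close>
      have "(real n - 4) * (q - 3) \<ge> 0" using n4 q3 by (intro mult_nonneg_nonneg) auto
      then show ?thesis using rq n4 q3 by (intro quartic) (simp add: algebra_simps)
    qed
  next
    case 3
    show ?thesis
      by (rule r_sos_convex_high_degree[OF _ 3 assms(1) \<mu> lo hi r]) (use f k in simp)
  qed
qed

end
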